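(* Let $\{H_\omega\}_{\omega\in\Omega}$ be a $\mathbb Z^d$-stationary family of selfadjoint operators acting on $\mathcal H = L_2(\mathbb R^d)$ (continuous model) or on $\mathcal H = \ell_2(\mathbb Z^d)$ (discrete model), where the corresponding unitary operators are the translations $(U_i\varphi)(x)=\varphi(x-i)$, $i\in\mathbb Z^d$, $\varphi\in\mathcal H$. Let $\nu$ be the density of states measure of the family. Let $I\subset\mathbb R$ be a closed interval, possibly unbounded, with interior $I^\circ$. If $\Sigma\subset\mathbb R$ is a $\mathbb P$-positive spectrum for $\{H_\omega\}_{\omega\in\Omega}$, then $\nu(\Sigma\cap I)=0$ implies $\Sigma\cap I^\circ=\emptyset$.
   Context: $(\Omega,\mathcal M,\mathbb P)$ is a complete probability space, and $\mathbb E$ denotes expectation with respect to $\mathbb P$. Measurability: a family of bounded operators $\{B_\omega\}_{\omega\in\Omega}$ on $\mathcal H$ is weakly measurable if $\omega\mapsto\langle x,B_\omega y\rangle$ is measurable for all $x,y\in\mathcal H$. A family of (possibly unbounded) selfadjoint operators $\{H_\omega\}_{\omega\in\Omega}$ is measurable if $\omega\mapsto (H_\omega-z)^{-1}$ is weakly measurable for all $z\in\mathbb C\setminus\mathbb R$. Stationarity: a family of measurable transformations $T_i:\Omega\to\Omega$, $i\in\mathbb Z^d$, is measure preserving if $\mathbb P(T_i^{-1}A)=\mathbb P(A)$ for every $A\in\mathcal M$ and every $i$. A measurable family of selfadjoint operators $\{H_\omega\}_{\omega\in\Omega}$ on a separable Hilbert space $\mathcal H$ is $\mathbb Z^d$-stationary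 if there are a measure preserving family $\{T_i\}_{i\in\mathbb Z^d}$ and a family $\{U_i\}_{i\in\mathbb Z^d}$ of unitary operators on $\mathcal H$ such that $H_{T_i\omega}=U_iH_\omega U_i^*$ (for all $i$ and $\omega$). Density of states measure: $E_{H_\omega}(A)=\chi_A(H_\omega)$ denotes the spectral projection of $H_\omega$ for a Borel set $A\subset\mathbb R$. In the discrete model, $\nu(A):=\mathbb E(\langle\delta_0,E_{H_\omega}(A)\delta_0\rangle)$, where $\delta_0(0)=1$ and $\delta_0(n)=0$ for $n\neq 0$. In the continuous model, $\nu(A):=\mathbb E(\operatorname{tr}\,\chi_\Lambda E_{H_\omega}(A)\chi_\Lambda)$, where $\Lambda=[-1/2,1/2]^d$, $\chi_\Lambda$ is the operator of multiplication by the characteristic function of $\Lambda$, and the trace of a bounded positive operator $B$ is $\operatorname{tr}B=\sum_n\langle\varphi_n,B\varphi_n\rangle\in[0,\infty]$ for an orthonormal basis $\{\varphi_n\}$. Reducing subspaces and restrictions: a closed subspace $M\subset\mathcal H$ with orthogonal projection $P_M$ reduces an operator $H$ with domain $D(H)$ if $u\in D(H)$ implies $P_Mu\in D(H)$ and $HP_Mu\in M$. The restriction $H|_M$ is the operator in $M$ with domain $M\cap D(H)$ and $H|_Mf=Hf$. The spectrum of the operator on the zero space is empty. $\mathbb P$-positive spectrum: a set $\Sigma\subset\mathbb R$ (independent of $\omega$) is a $\mathbb P$-positive spectrum for $\{H_\omega\}_{\omega\in\Omega}$ if there are closed subspaces $M_\omega\subseteq\mathcal H$, with $M_\omega$ reducing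 $H_\omega$, and a set $\Omega_\Sigma\in\mathcal M$ with $\mathbb P(\Omega_\Sigma)>0$ such that $\Sigma=\sigma(H_\omega|_{M_\omega})$ for all $\omega\in\Omega_\Sigma$. No measurability of $\omega\mapsto M_\omega$ is required. *)

theory Defs
  imports "HOL-Probability.Probability"
begin

section \<open>Complex inner product spaces\<close>

text \<open>The norm and the topology are those of the underlying real inner product space; the complex
  inner product is conjugate linear in its first argument.\<close>

class complex_inner = real_inner +
  fixes scaleC :: "complex \<Rightarrow> 'a \<Rightarrow> 'a" (infixr "*\<^sub>C" 75)
    and cinner :: "'a \<Rightarrow> 'a \<Rightarrow> complex"
  assumes scaleC_add_right: "c *\<^sub>C (x + y) = c *\<^sub>C x + c *\<^sub>C y"
    and scaleC_add_left: "(c + d) *\<^sub>C x = c *\<^sub>C x + d *\<^sub>C x"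
    and scaleC_scaleC: "c *\<^sub>C d *\<^sub>C x = (c * d) *\<^sub>C x"
    and scaleC_of_real: "of_real r *\<^sub>C x = r *\<^sub>R x"
    and Re_cinner: "Re (cinner x y) = inner x y"
    and cinner_commute: "cinner x y = cnj (cinner y x)"
    and cinner_add_right: "cinner x (y + z) = cinner x y + cinner x z"
    and cinner_scaleC_right: "cinner x (c *\<^sub>C y) = c * cinner x y"

definition clinear :: "('h::complex_inner \<Rightarrow> 'h) \<Rightarrow> bool" where
  "clinear B \<longleftrightarrow> (\<forall>x y. B (x + y) = B x + B y) \<and> (\<forall>c x. B (c *\<^sub>C x) = c *\<^sub>C B x)"

definition closed_csubspace :: "'h::complex_inner set \<Rightarrow> bool" where
  "closed_csubspace M \<longleftrightarrow>
     0 \<in> M \<and> (\<forall>x\<in>M. \<forall>y\<in>M. x + y \<in> M) \<and> (\<forall>c. \<forall>x\<in>M. c *\<^sub>C x \<in> M) \<and> closed M"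

definition cadjoint :: "('h::complex_inner \<Rightarrow> 'h) \<Rightarrow> 'h \<Rightarrow> 'h" where
  "cadjoint B = (THE B'. \<forall>x y. cinner (B' x) y = cinner x (B y))"

definition unitary :: "('h::complex_inner \<Rightarrow> 'h) \<Rightarrow> bool" where
  "unitary U \<longleftrightarrow> clinear U \<and> surj U \<and> (\<forall>x y. cinner (U x) (U y) = cinner x y)"

definition orthogonal_projection :: "('h::complex_inner \<Rightarrow> 'h) \<Rightarrow> bool" where
  "orthogonal_projection P \<longleftrightarrow>
     clinear P \<and> (\<forall>x. P (P x) = P x) \<and> (\<forall>x y. cinner (P x) y = cinner x (P y))"

definition proj_onto :: "'h::complex_inner set \<Rightarrow> 'h \<Rightarrow> 'h" where
  "proj_onto M u = (THE p. p \<in> M \<and> (\<forall>m\<in>M. cinner m (u - p) = 0))"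

definition orthonormal_basis :: "'h::complex_inner set \<Rightarrow> bool" where
  "orthonormal_basis S \<longleftrightarrow>
     (\<forall>x\<in>S. \<forall>y\<in>S. cinner x y = (if x = y then 1 else 0)) \<and>
     (\<forall>x. (\<forall>s\<in>S. cinner s x = 0) \<longrightarrow> x = 0)"

text \<open>Meant for positive \<open>B\<close>, where the value does not depend on the chosen basis.\<close>

definition positive_trace :: "('h::complex_inner \<Rightarrow> 'h) \<Rightarrow> ennreal" where
  "positive_trace B =
     (\<Sum>\<^sub>\<infinity>s\<in>(SOME S. orthonormal_basis S). ennreal (Re (cinner s (B s))))"


section \<open>Unbounded operators\<close>

text \<open>An operator with domain \<open>D(H)\<close> is represented by its graph, so \<open>D(H) = Domain H\<close> and
  \<open>(x, y) \<in> H\<close> says that \<open>x \<in> D(H)\<close> and \<open>H x = y\<close>. Equality of graphs is equality of operators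
  including their domains.\<close>

type_synonym 'h operator = "('h \<times> 'h) set"

definition linear_operator :: "'h::complex_inner operator \<Rightarrow> bool" where
  "linear_operator H \<longleftrightarrow> single_valued H \<and> (0, 0) \<in> H \<and>
     (\<forall>(x, y)\<in>H. \<forall>(x', y')\<in>H. (x + x', y + y') \<in> H) \<and>
     (\<forall>c. \<forall>(x, y)\<in>H. (c *\<^sub>C x, c *\<^sub>C y) \<in> H)"

definition adjoint_graph :: "'h::complex_inner operator \<Rightarrow> 'h operator" where
  "adjoint_graph H = {(u, v). \<forall>(x, y)\<in>H. cinner u y = cinner v x}"

definition selfadjoint :: "'h::complex_inner operator \<Rightarrow> bool" where
  "selfadjoint H \<longleftrightarrow> linear_operator H \<and> closure (Domain H) = UNIV \<and> adjoint_graph H = H"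

text \<open>\<open>(H - z)\<^sup>-\<^sup>1\<close>: the vector \<open>x\<close> solves \<open>H x - z x = y\<close>.\<close>

definition resolvent :: "'h::complex_inner operator \<Rightarrow> complex \<Rightarrow> 'h \<Rightarrow> 'h" where
  "resolvent H z y = (THE x. (x, y + z *\<^sub>C x) \<in> H)"

definition reduces :: "'h::complex_inner set \<Rightarrow> 'h operator \<Rightarrow> bool" where
  "reduces M H \<longleftrightarrow> closed_csubspace M \<and>
     (\<forall>u\<in>Domain H. \<exists>v\<in>M. (proj_onto M u, v) \<in> H)"

definition restriction :: "'h operator \<Rightarrow> 'h set \<Rightarrow> 'h operator" where
  "restriction H M = {(f, g) \<in> H. f \<in> M}"

text \<open>Resolvent set and spectrum of an operator \<open>A \<subseteq> M \<times> M\<close> in the Hilbert space \<open>M\<close>: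
  \<open>A - z\<close> is a bijection of its domain onto \<open>M\<close>, with bounded inverse.\<close>

definition resolvent_set_in :: "'h::complex_inner set \<Rightarrow> 'h operator \<Rightarrow> complex set" where
  "resolvent_set_in M A =
     {z. (\<forall>y\<in>M. \<exists>!x. (x, y + z *\<^sub>C x) \<in> A) \<and>
         (\<exists>C. \<forall>(x, w)\<in>A. norm x \<le> C * norm (w - z *\<^sub>C x))}"

definition spectrum_in :: "'h::complex_inner set \<Rightarrow> 'h operator \<Rightarrow> complex set" where
  "spectrum_in M A = - resolvent_set_in M A"


section \<open>Spectral projections\<close>

definition projection_valued_measure :: "(real set \<Rightarrow> 'h::complex_inner \<Rightarrow> 'h) \<Rightarrow> bool" where
  "projection_valued_measure E \<longleftrightarrow>
     (\<forall>A\<in>sets borel. orthogonal_projection (E A)) \<and> (\<forall>x. E UNIV x = x) \<and>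
     (\<forall>A. range A \<subseteq> sets borel \<longrightarrow> disjoint_family A \<longrightarrow>
        (\<forall>x. (\<lambda>n. E (A n) x) sums E (\<Union>n::nat. A n) x))"

definition scalar_spectral_measure ::
    "(real set \<Rightarrow> 'h::complex_inner \<Rightarrow> 'h) \<Rightarrow> 'h \<Rightarrow> real measure" where
  "scalar_spectral_measure E x =
     measure_of UNIV (sets borel) (\<lambda>A. ennreal (Re (cinner x (E A x))))"

text \<open>\<open>H = \<integral> t dE(t)\<close>: the domain of \<open>H\<close> consists of the \<open>x\<close> for which the second moment of
  \<open>\<langle>x, E x\<rangle>\<close> is finite, and \<open>\<langle>x, H x\<rangle> = \<integral> t d\<langle>x, E(t) x\<rangle>\<close> there; by polarization this
  determines \<open>H\<close>.\<close>

definition spectral_resolution ::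
    "'h::complex_inner operator \<Rightarrow> (real set \<Rightarrow> 'h \<Rightarrow> 'h) \<Rightarrow> bool" where
  "spectral_resolution H E \<longleftrightarrow> projection_valued_measure E \<and>
     Domain H = {x. integrable (scalar_spectral_measure E x) (\<lambda>t. t\<^sup>2)} \<and>
     (\<forall>(x, y)\<in>H. cinner x y = of_real (\<integral>t. t \<partial>scalar_spectral_measure E x))"

text \<open>The description is applied to the value at \<open>A\<close>, since a spectral resolution is unique only
  on Borel sets.\<close>

definition spectral_projection :: "'h::complex_inner operator \<Rightarrow> real set \<Rightarrow> 'h \<Rightarrow> 'h" where
  "spectral_projection H A = (THE P. \<exists>E. spectral_resolution H E \<and> P = E A)"


section \<open>Random operators\<close>

definition weakly_measurable :: "'w measure \<Rightarrow> ('w \<Rightarrow> 'h::complex_inner \<Rightarrow> 'h) \<Rightarrow> bool" where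
  "weakly_measurable P B \<longleftrightarrow> (\<forall>x y. (\<lambda>\<omega>. cinner x (B \<omega> y)) \<in> borel_measurable P)"

definition measurable_selfadjoint_family ::
    "'w measure \<Rightarrow> ('w \<Rightarrow> 'h::complex_inner operator) \<Rightarrow> bool" where
  "measurable_selfadjoint_family P H \<longleftrightarrow>
     (\<forall>\<omega>\<in>space P. selfadjoint (H \<omega>)) \<and>
     (\<forall>z. z \<notin> \<real> \<longrightarrow> weakly_measurable P (\<lambda>\<omega>. resolvent (H \<omega>) z))"

definition measure_preserving_family :: "'w measure \<Rightarrow> ('i \<Rightarrow> 'w \<Rightarrow> 'w) \<Rightarrow> bool" where
  "measure_preserving_family P T \<longleftrightarrow>
     (\<forall>i. T i \<in> measurable P P \<and>
          (\<forall>A\<in>sets P. emeasure P (T i -` A \<inter> space P) = emeasure P A))"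

text \<open>The graph of \<open>U H U\<^sup>*\<close>, with domain \<open>{x. U\<^sup>* x \<in> D(H)}\<close>.\<close>

definition unitary_conjugate ::
    "('h::complex_inner \<Rightarrow> 'h) \<Rightarrow> 'h operator \<Rightarrow> 'h operator" where
  "unitary_conjugate U H = {(x, U y) | x y. (cadjoint U x, y) \<in> H}"

definition stationary_with ::
    "'w measure \<Rightarrow> ('i \<Rightarrow> 'h::complex_inner \<Rightarrow> 'h) \<Rightarrow> ('w \<Rightarrow> 'h operator) \<Rightarrow> bool" where
  "stationary_with P U H \<longleftrightarrow>
     measurable_selfadjoint_family P H \<and> (\<forall>i. unitary (U i)) \<and>
     (\<exists>T. measure_preserving_family P T \<and>
          (\<forall>i. \<forall>\<omega>\<in>space P. H (T i \<omega>) = unitary_conjugate (U i) (H \<omega>)))"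

definition positive_spectrum ::
    "'w measure \<Rightarrow> ('w \<Rightarrow> 'h::complex_inner operator) \<Rightarrow> real set \<Rightarrow> bool" where
  "positive_spectrum P H \<Sigma> \<longleftrightarrow>
     (\<exists>M. (\<forall>\<omega>\<in>space P. reduces (M \<omega>) (H \<omega>)) \<and>
        (\<exists>\<Omega>\<^sub>0\<in>sets P. measure P \<Omega>\<^sub>0 > 0 \<and>
           (\<forall>\<omega>\<in>\<Omega>\<^sub>0. complex_of_real ` \<Sigma> = spectrum_in (M \<omega>) (restriction (H \<omega>) (M \<omega>)))))"


section \<open>Square integrable functions\<close>

definition square_integrable :: "'a measure \<Rightarrow> ('a \<Rightarrow> complex) \<Rightarrow> bool" where
  "square_integrable M f \<longleftrightarrow> f \<in> borel_measurable M \<and> integrable M (\<lambda>x. (norm (f x))\<^sup>2)"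

lemma square_integrable_zero: "square_integrable M (\<lambda>_. 0)"
  by (simp add: square_integrable_def)

lemma square_integrable_scale:
  assumes "square_integrable M f"
  shows "square_integrable M (\<lambda>x. c * f x)"
  using assms by (auto simp: square_integrable_def norm_mult power_mult_distrib)

lemma square_integrable_mult:
  assumes "square_integrable M f" "square_integrable M g"
  shows "integrable M (\<lambda>x. cnj (f x) * g x)"
proof (rule Bochner_Integration.integrable_bound)
  show "integrable M (\<lambda>x. (norm (f x))\<^sup>2 + (norm (g x))\<^sup>2)"
    using assms by (simp add: square_integrable_def)
  show "(\<lambda>x. cnj (f x) * g x) \<in> borel_measurable M"
    using assms unfolding square_integrable_def
    by (intro borel_measurable_times borel_measurable_continuous_on[of cnj])
       (auto intro: continuous_intros)
  have "a * b \<le> a\<^sup>2 + b\<^sup>2" if "a \<ge> 0" "b \<ge> 0" for a b :: real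
  proof -
    have "2 * (a * b) \<le> a\<^sup>2 + b\<^sup>2"
      using sum_squares_bound[of a b] by simp
    with that show ?thesis
      using mult_nonneg_nonneg[of a b] by linarith
  qed
  then show "AE x in M. norm (cnj (f x) * g x) \<le> norm ((norm (f x))\<^sup>2 + (norm (g x))\<^sup>2)"
    by (simp add: norm_mult)
qed

lemma square_integrable_add:
  assumes "square_integrable M f" "square_integrable M g"
  shows "square_integrable M (\<lambda>x. f x + g x)"
proof -
  have [measurable]: "f \<in> borel_measurable M" "g \<in> borel_measurable M"
    using assms by (auto simp: square_integrable_def)
  have "integrable M (\<lambda>x. (norm (f x + g x))\<^sup>2)"
  proof (rule Bochner_Integration.integrable_bound)
    show "integrable M (\<lambda>x. 2 * (norm (f x))\<^sup>2 + 2 * (norm (g x))\<^sup>2)"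
      using assms by (simp add: square_integrable_def)
    have "(norm (a + b))\<^sup>2 \<le> 2 * (norm a)\<^sup>2 + 2 * (norm b)\<^sup>2" for a b :: complex
    proof -
      have "(norm (a + b))\<^sup>2 \<le> (norm a + norm b)\<^sup>2"
        by (intro power_mono norm_triangle_ineq) auto
      also have "\<dots> \<le> 2 * (norm a)\<^sup>2 + 2 * (norm b)\<^sup>2"
        using sum_squares_bound[of "norm a" "norm b"] by (simp add: power2_sum)
      finally show ?thesis .
    qed
    then show "AE x in M. norm ((norm (f x + g x))\<^sup>2)
        \<le> norm (2 * (norm (f x))\<^sup>2 + 2 * (norm (g x))\<^sup>2)"
      by simp
  qed simp
  then show ?thesis by (simp add: square_integrable_def)
qed

definition L2_inner :: "'a measure \<Rightarrow> ('a \<Rightarrow> complex) \<Rightarrow> ('a \<Rightarrow> complex) \<Rightarrow> complex" where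
  "L2_inner M f g = (\<integral>x. cnj (f x) * g x \<partial>M)"

lemma L2_inner_commute: "L2_inner M f g = cnj (L2_inner M g f)"
proof -
  have "(\<integral>x. cnj (cnj (g x) * f x) \<partial>M) = cnj (L2_inner M g f)"
    unfolding L2_inner_def by (rule Bochner_Integration.integral_cnj)
  then show ?thesis by (simp add: L2_inner_def mult.commute)
qed

lemma L2_inner_add_right:
  assumes "square_integrable M f" "square_integrable M g" "square_integrable M h"
  shows "L2_inner M f (\<lambda>x. g x + h x) = L2_inner M f g + L2_inner M f h"
  using square_integrable_mult[OF assms(1,2)] square_integrable_mult[OF assms(1,3)]
  by (simp add: L2_inner_def distrib_left)

lemma L2_inner_scale_right: "L2_inner M f (\<lambda>x. c * g x) = c * L2_inner M f g"
proof -
  have "(\<lambda>x. cnj (f x) * (c * g x)) = (\<lambda>x. c * (cnj (f x) * g x))"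
    by (auto simp: algebra_simps)
  then show ?thesis by (simp add: L2_inner_def)
qed

lemma L2_inner_self:
  "L2_inner M f f = of_real (\<integral>x. (norm (f x))\<^sup>2 \<partial>M)"
proof -
  have "(\<lambda>x. cnj (f x) * f x) = (\<lambda>x. complex_of_real ((norm (f x))\<^sup>2))"
    by (simp add: complex_norm_square mult.commute del: of_real_power)
  then show ?thesis
    by (simp only: L2_inner_def integral_complex_of_real)
qed

lemma L2_inner_self_eq_0_iff:
  assumes "square_integrable M f"
  shows "Re (L2_inner M f f) = 0 \<longleftrightarrow> (AE x in M. f x = 0)"
  using assms integral_nonneg_eq_0_iff_AE[of M "\<lambda>x. (norm (f x))\<^sup>2"]
  by (simp add: L2_inner_self square_integrable_def)


section \<open>The Hilbert space of square summable functions\<close>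

text \<open>Integrals with respect to the counting measure are absolutely convergent sums.\<close>

typedef 'i ell2 = "{f :: 'i \<Rightarrow> complex. square_integrable (count_space UNIV) f}"
  using square_integrable_zero by blast

setup_lifting type_definition_ell2

instantiation ell2 :: (type) complex_inner
begin

lift_definition zero_ell2 :: "'a ell2" is "\<lambda>_. 0"
  by (rule square_integrable_zero)

lift_definition plus_ell2 :: "'a ell2 \<Rightarrow> 'a ell2 \<Rightarrow> 'a ell2" is "\<lambda>f g x. f x + g x"
  by (rule square_integrable_add)

lift_definition scaleC_ell2 :: "complex \<Rightarrow> 'a ell2 \<Rightarrow> 'a ell2" is "\<lambda>c f x. c * f x"
  by (rule square_integrable_scale)

lift_definition cinner_ell2 :: "'a ell2 \<Rightarrow> 'a ell2 \<Rightarrow> complex" is "L2_inner (count_space UNIV)" .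

definition scaleR_ell2 :: "real \<Rightarrow> 'a ell2 \<Rightarrow> 'a ell2" where
  "scaleR_ell2 r x = of_real r *\<^sub>C x"

definition uminus_ell2 :: "'a ell2 \<Rightarrow> 'a ell2" where
  "uminus_ell2 x = (-1) *\<^sub>C x"

definition minus_ell2 :: "'a ell2 \<Rightarrow> 'a ell2 \<Rightarrow> 'a ell2" where
  "minus_ell2 x y = x + - y"

definition inner_ell2 :: "'a ell2 \<Rightarrow> 'a ell2 \<Rightarrow> real" where
  "inner_ell2 x y = Re (cinner x y)"

definition norm_ell2 :: "'a ell2 \<Rightarrow> real" where
  "norm_ell2 x = sqrt (inner x x)"

definition sgn_ell2 :: "'a ell2 \<Rightarrow> 'a ell2" where
  "sgn_ell2 x = inverse (norm x) *\<^sub>R x"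

definition dist_ell2 :: "'a ell2 \<Rightarrow> 'a ell2 \<Rightarrow> real" where
  "dist_ell2 x y = norm (x - y)"

definition uniformity_ell2 :: "('a ell2 \<times> 'a ell2) filter" where
  "uniformity_ell2 = (INF e\<in>{0<..}. principal {(x, y). dist x y < e})"

definition open_ell2 :: "'a ell2 set \<Rightarrow> bool" where
  "open_ell2 U = (\<forall>x\<in>U. \<forall>\<^sub>F (x', y) in uniformity. x' = x \<longrightarrow> y \<in> U)"

instance
proof
  fix x y z :: "'a ell2" and c d :: complex and r s :: real
  show add_assoc: "x + y + z = x + (y + z)" by transfer (simp add: add.assoc)
  show "x + y = y + x" by transfer (simp add: add.commute)
  show "0 + x = x" by transfer simp
  show "- x + x = 0" unfolding uminus_ell2_def by transfer simp
  show "x - y = x + - y" by (rule minus_ell2_def)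
  show scaleC_add_right: "c *\<^sub>C (x + y) = c *\<^sub>C x + c *\<^sub>C y"
    by transfer (simp add: algebra_simps)
  show scaleC_add_left: "(c + d) *\<^sub>C x = c *\<^sub>C x + d *\<^sub>C x"
    by transfer (simp add: algebra_simps)
  show scaleC_scaleC: "c *\<^sub>C d *\<^sub>C x = (c * d) *\<^sub>C x"
    by transfer (simp add: algebra_simps)
  show "of_real r *\<^sub>C x = r *\<^sub>R x" by (simp add: scaleR_ell2_def)
  show "r *\<^sub>R (x + y) = r *\<^sub>R x + r *\<^sub>R y"
    unfolding scaleR_ell2_def by transfer (simp add: algebra_simps)
  show "(r + s) *\<^sub>R x = r *\<^sub>R x + s *\<^sub>R x"
    unfolding scaleR_ell2_def by transfer (simp add: algebra_simps)
  show "r *\<^sub>R s *\<^sub>R x = (r * s) *\<^sub>R x"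
    unfolding scaleR_ell2_def by transfer (simp add: algebra_simps)
  show "1 *\<^sub>R x = x"
    unfolding scaleR_ell2_def by transfer simp
  show cinner_commute: "cinner x y = cnj (cinner y x)" by transfer (rule L2_inner_commute)
  show cinner_add: "cinner x (y + z) = cinner x y + cinner x z"
    by transfer (auto intro: L2_inner_add_right)
  show cinner_scaleC: "cinner x (c *\<^sub>C y) = c * cinner x y"
    by transfer (rule L2_inner_scale_right)
  show "Re (cinner x y) = inner x y" by (simp add: inner_ell2_def)
  show "sgn x = inverse (norm x) *\<^sub>R x" by (rule sgn_ell2_def)
  show "dist x y = norm (x - y)" by (rule dist_ell2_def)
  show "norm x = sqrt (inner x x)" by (rule norm_ell2_def)
  show "(uniformity :: ('a ell2 \<times> 'a ell2) filter) =
      (INF e\<in>{0<..}. principal {(x, y). dist x y < e})"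
    by (rule uniformity_ell2_def)
  show "open U = (\<forall>x\<in>U. \<forall>\<^sub>F (x', y) in uniformity. x' = x \<longrightarrow> y \<in> U)" for U :: "'a ell2 set"
    by (rule open_ell2_def)
  show "inner x y = inner y x"
    unfolding inner_ell2_def by transfer (subst L2_inner_commute, simp)
  have "cinner (x + y) z = cinner x z + cinner y z"
    by transfer (subst (1 2 3) L2_inner_commute, simp add: L2_inner_add_right)
  then show "inner (x + y) z = inner x z + inner y z" by (simp add: inner_ell2_def)
  have "cinner (c *\<^sub>C x) y = cnj c * cinner x y" for c
    by transfer (subst (1 2) L2_inner_commute, simp add: L2_inner_scale_right)
  then show "inner (r *\<^sub>R x) y = r * inner x y" by (simp add: inner_ell2_def scaleR_ell2_def)
  show "0 \<le> inner x x"
    unfolding inner_ell2_def by transfer (simp add: L2_inner_self)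
  show "inner x x = 0 \<longleftrightarrow> x = 0"
    unfolding inner_ell2_def
    by transfer (simp add: L2_inner_self_eq_0_iff AE_count_space fun_eq_iff)
qed

end

lift_definition delta :: "'i \<Rightarrow> 'i ell2" is "\<lambda>k n. if n = k then 1 else 0"
proof -
  fix k :: 'i
  have "integrable (count_space UNIV) (indicator {k} :: 'i \<Rightarrow> real)"
    by simp
  moreover have "(\<lambda>n. (norm (if n = k then 1 else 0 :: complex))\<^sup>2) = indicator {k}"
    by (auto simp: indicator_def)
  ultimately have
    "integrable (count_space UNIV) (\<lambda>n. (norm (if n = k then 1 else 0 :: complex))\<^sup>2)"
    by (simp only:)
  then show "square_integrable (count_space UNIV) (\<lambda>n. if n = k then 1 else 0 :: complex)"
    by (simp add: square_integrable_def)
qed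

lift_definition ell2_translation :: "'i::ab_group_add \<Rightarrow> 'i ell2 \<Rightarrow> 'i ell2"
  is "\<lambda>i f n. f (n - i)"
proof -
  fix i :: 'i and f :: "'i \<Rightarrow> complex"
  assume "square_integrable (count_space UNIV) f"
  moreover have "bij (\<lambda>n. n - i)"
    by (rule bij_betw_byWitness[where f' = "\<lambda>n. n + i"]) auto
  ultimately show "square_integrable (count_space UNIV) (\<lambda>n. f (n - i))"
    using integrable_bij_count_space[of "\<lambda>n. n - i" UNIV UNIV "\<lambda>n. (norm (f n))\<^sup>2"]
    by (simp add: square_integrable_def)
qed


section \<open>The Hilbert space of square integrable functions\<close>

definition L2_rel :: "('a::euclidean_space \<Rightarrow> complex) \<Rightarrow> ('a \<Rightarrow> complex) \<Rightarrow> bool" where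
  "L2_rel f g \<longleftrightarrow>
     square_integrable lborel f \<and> square_integrable lborel g \<and> (AE x in lborel. f x = g x)"

quotient_type (overloaded) 'a L2 = "'a::euclidean_space \<Rightarrow> complex" / partial: L2_rel
proof (rule part_equivpI)
  show "\<exists>f. L2_rel f f" using square_integrable_zero by (auto simp: L2_rel_def)
  show "symp L2_rel" by (rule sympI) (auto simp: L2_rel_def)
  show "transp L2_rel" by (rule transpI) (auto simp: L2_rel_def)
qed

lemma L2_inner_cong:
  assumes "L2_rel f f'" "L2_rel g g'"
  shows "L2_inner lborel f g = L2_inner lborel f' g'"
  unfolding L2_inner_def
proof (rule integral_cong_AE)
  have "integrable lborel (\<lambda>x. cnj (f x) * g x)" "integrable lborel (\<lambda>x. cnj (f' x) * g' x)"
    using assms by (auto simp: L2_rel_def intro: square_integrable_mult)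
  then show "(\<lambda>x. cnj (f x) * g x) \<in> borel_measurable lborel"
    "(\<lambda>x. cnj (f' x) * g' x) \<in> borel_measurable lborel"
    by (blast dest: borel_measurable_integrable)+
  show "AE x in lborel. cnj (f x) * g x = cnj (f' x) * g' x"
    using assms by (auto simp: L2_rel_def)
qed

instantiation L2 :: (euclidean_space) complex_inner
begin

lift_definition zero_L2 :: "'a L2" is "\<lambda>_. 0"
  by (simp add: L2_rel_def square_integrable_zero)

lift_definition plus_L2 :: "'a L2 \<Rightarrow> 'a L2 \<Rightarrow> 'a L2" is "\<lambda>f g x. f x + g x"
  by (auto simp: L2_rel_def square_integrable_add)

lift_definition scaleC_L2 :: "complex \<Rightarrow> 'a L2 \<Rightarrow> 'a L2" is "\<lambda>c f x. c * f x"
  by (auto simp: L2_rel_def square_integrable_scale)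

lift_definition cinner_L2 :: "'a L2 \<Rightarrow> 'a L2 \<Rightarrow> complex" is "L2_inner lborel"
  by (rule L2_inner_cong)

definition scaleR_L2 :: "real \<Rightarrow> 'a L2 \<Rightarrow> 'a L2" where
  "scaleR_L2 r x = of_real r *\<^sub>C x"

definition uminus_L2 :: "'a L2 \<Rightarrow> 'a L2" where
  "uminus_L2 x = (-1) *\<^sub>C x"

definition minus_L2 :: "'a L2 \<Rightarrow> 'a L2 \<Rightarrow> 'a L2" where
  "minus_L2 x y = x + - y"

definition inner_L2 :: "'a L2 \<Rightarrow> 'a L2 \<Rightarrow> real" where
  "inner_L2 x y = Re (cinner x y)"

definition norm_L2 :: "'a L2 \<Rightarrow> real" where
  "norm_L2 x = sqrt (inner x x)"

definition sgn_L2 :: "'a L2 \<Rightarrow> 'a L2" where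
  "sgn_L2 x = inverse (norm x) *\<^sub>R x"

definition dist_L2 :: "'a L2 \<Rightarrow> 'a L2 \<Rightarrow> real" where
  "dist_L2 x y = norm (x - y)"

definition uniformity_L2 :: "('a L2 \<times> 'a L2) filter" where
  "uniformity_L2 = (INF e\<in>{0<..}. principal {(x, y). dist x y < e})"

definition open_L2 :: "'a L2 set \<Rightarrow> bool" where
  "open_L2 U = (\<forall>x\<in>U. \<forall>\<^sub>F (x', y) in uniformity. x' = x \<longrightarrow> y \<in> U)"

instance
proof
  note si = square_integrable_zero square_integrable_add square_integrable_scale
  fix x y z :: "'a L2" and c d :: complex and r s :: real
  show "x + y + z = x + (y + z)" by transfer (simp add: L2_rel_def si add.assoc)
  show "x + y = y + x" by transfer (simp add: L2_rel_def si add.commute)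
  show "0 + x = x" by transfer (simp add: L2_rel_def)
  show "- x + x = 0" unfolding uminus_L2_def by transfer (simp add: L2_rel_def si)
  show "x - y = x + - y" by (rule minus_L2_def)
  show "c *\<^sub>C (x + y) = c *\<^sub>C x + c *\<^sub>C y"
    by transfer (simp add: L2_rel_def si distrib_left)
  show "(c + d) *\<^sub>C x = c *\<^sub>C x + d *\<^sub>C x"
    by transfer (simp add: L2_rel_def si distrib_right)
  show "c *\<^sub>C d *\<^sub>C x = (c * d) *\<^sub>C x"
    by transfer (simp add: L2_rel_def si mult.assoc)
  show "of_real r *\<^sub>C x = r *\<^sub>R x" by (simp add: scaleR_L2_def)
  show "r *\<^sub>R (x + y) = r *\<^sub>R x + r *\<^sub>R y"
    unfolding scaleR_L2_def by transfer (simp add: L2_rel_def si distrib_left)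
  show "(r + s) *\<^sub>R x = r *\<^sub>R x + s *\<^sub>R x"
    unfolding scaleR_L2_def by transfer (simp add: L2_rel_def si distrib_right)
  show "r *\<^sub>R s *\<^sub>R x = (r * s) *\<^sub>R x"
    unfolding scaleR_L2_def by transfer (simp add: L2_rel_def si mult.assoc)
  show "1 *\<^sub>R x = x"
    unfolding scaleR_L2_def by transfer (simp add: L2_rel_def)
  show "cinner x y = cnj (cinner y x)" by transfer (rule L2_inner_commute)
  show "cinner x (y + z) = cinner x y + cinner x z"
    by transfer (auto intro: L2_inner_add_right simp: L2_rel_def)
  show "cinner x (c *\<^sub>C y) = c * cinner x y"
    by transfer (rule L2_inner_scale_right)
  show "Re (cinner x y) = inner x y" by (simp add: inner_L2_def)
  show "sgn x = inverse (norm x) *\<^sub>R x" by (rule sgn_L2_def)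
  show "dist x y = norm (x - y)" by (rule dist_L2_def)
  show "norm x = sqrt (inner x x)" by (rule norm_L2_def)
  show "(uniformity :: ('a L2 \<times> 'a L2) filter) =
      (INF e\<in>{0<..}. principal {(x, y). dist x y < e})"
    by (rule uniformity_L2_def)
  show "open U = (\<forall>x\<in>U. \<forall>\<^sub>F (x', y) in uniformity. x' = x \<longrightarrow> y \<in> U)" for U :: "'a L2 set"
    by (rule open_L2_def)
  show "inner x y = inner y x"
    unfolding inner_L2_def by transfer (subst L2_inner_commute, simp)
  have "cinner (x + y) z = cinner x z + cinner y z"
    by transfer (subst (1 2 3) L2_inner_commute, simp add: L2_inner_add_right L2_rel_def)
  then show "inner (x + y) z = inner x z + inner y z" by (simp add: inner_L2_def)
  have "cinner (c *\<^sub>C x) y = cnj c * cinner x y" for c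
    by transfer (subst (1 2) L2_inner_commute, simp add: L2_inner_scale_right)
  then show "inner (r *\<^sub>R x) y = r * inner x y" by (simp add: inner_L2_def scaleR_L2_def)
  show "0 \<le> inner x x"
    unfolding inner_L2_def by transfer (simp add: L2_inner_self)
  show "inner x x = 0 \<longleftrightarrow> x = 0"
    unfolding inner_L2_def
    by transfer (simp add: L2_inner_self_eq_0_iff L2_rel_def square_integrable_zero)
qed

end

lift_definition L2_translation :: "'a::euclidean_space \<Rightarrow> 'a L2 \<Rightarrow> 'a L2" is "\<lambda>a f x. f (x - a)"
proof -
  fix a :: 'a and f g :: "'a \<Rightarrow> complex"
  assume fg: "L2_rel f g"
  have "distr lborel lborel (\<lambda>x. x - a) = distr lborel borel ((+) (- a))"
    by (rule distr_cong) auto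
  then have shift: "distr lborel lborel (\<lambda>x. x - a) = lborel"
    by (simp only: lborel_distr_plus)
  have si: "square_integrable lborel (\<lambda>x. h (x - a))" if "square_integrable lborel h" for h
  proof -
    have [measurable]: "h \<in> borel_measurable borel"
      using that by (simp add: square_integrable_def)
    have "integrable (distr lborel lborel (\<lambda>x. x - a)) (\<lambda>x. (norm (h x))\<^sup>2)"
      using that unfolding shift by (simp add: square_integrable_def)
    then have "integrable lborel (\<lambda>x. (norm (h (x - a)))\<^sup>2)"
      by (subst (asm) integrable_distr_eq) auto
    then show ?thesis by (simp add: square_integrable_def)
  qed
  have "AE x in distr lborel lborel (\<lambda>x. x - a). f x = g x"
    using fg unfolding shift by (simp add: L2_rel_def)
  then have "AE x in lborel. f (x - a) = g (x - a)"
    by (rule AE_distrD[rotated]) simp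
  then show "L2_rel (\<lambda>x. f (x - a)) (\<lambda>x. g (x - a))"
    using fg by (simp add: L2_rel_def si)
qed

definition unit_cube :: "(real ^ 'd::finite) set" where
  "unit_cube = cbox (\<chi> k. - 1 / 2) (\<chi> k. 1 / 2)"

lift_definition chi_unit_cube :: "(real ^ 'd::finite) L2 \<Rightarrow> (real ^ 'd) L2"
  is "\<lambda>f x. indicator unit_cube x * f x"
proof -
  fix f g :: "real ^ 'd \<Rightarrow> complex"
  assume fg: "L2_rel f g"
  have [measurable]: "(unit_cube :: (real ^ 'd) set) \<in> sets borel"
    by (simp add: unit_cube_def)
  have "square_integrable lborel (\<lambda>x. indicator unit_cube x * h x)"
    if "square_integrable lborel h" for h :: "real ^ 'd \<Rightarrow> complex"
  proof -
    have [measurable]: "h \<in> borel_measurable borel"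
      using that by (simp add: square_integrable_def)
    have "integrable lborel (\<lambda>x. (norm (indicator unit_cube x * h x))\<^sup>2)"
    proof (rule Bochner_Integration.integrable_bound)
      show "integrable lborel (\<lambda>x. (norm (h x))\<^sup>2)"
        using that by (simp add: square_integrable_def)
    qed (auto simp: indicator_def)
    then show ?thesis by (simp add: square_integrable_def)
  qed
  then show "L2_rel (\<lambda>x. indicator unit_cube x * f x) (\<lambda>x. indicator unit_cube x * g x)"
    using fg by (auto simp: L2_rel_def)
qed

definition lattice_vec :: "int ^ 'd \<Rightarrow> real ^ 'd" where
  "lattice_vec i = (\<chi> k. real_of_int (i $ k))"


section \<open>Density of states measure\<close>

definition dos_discrete ::
    "'w measure \<Rightarrow> ('w \<Rightarrow> (int ^ 'd::finite) ell2 operator) \<Rightarrow> real set \<Rightarrow> ennreal" where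
  "dos_discrete P H A =
     (\<integral>\<^sup>+\<omega>. ennreal (Re (cinner (delta 0) (spectral_projection (H \<omega>) A (delta 0)))) \<partial>P)"

definition dos_continuous ::
    "'w measure \<Rightarrow> ('w \<Rightarrow> (real ^ 'd::finite) L2 operator) \<Rightarrow> real set \<Rightarrow> ennreal" where
  "dos_continuous P H A =
     (\<integral>\<^sup>+\<omega>. positive_trace (chi_unit_cube \<circ> spectral_projection (H \<omega>) A \<circ> chi_unit_cube) \<partial>P)"

end

theory Submission
  imports Defs
begin

text \<open>If \<open>\<lambda>\<close> lies in \<open>\<Sigma>\<close> and in the interior of \<open>I\<close>, then for every \<open>\<omega>\<close> in a set of positive
  probability the spectral projection of \<open>H\<^sub>\<omega>\<close> for \<open>\<Sigma> \<inter> I\<close> is nonzero: otherwise the projections for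
  a neighbourhood of \<open>\<lambda>\<close> would vanish on the reducing subspace \<open>M\<^sub>\<omega>\<close>, because the points outside \<open>\<Sigma>\<close>
  have neighbourhoods with this property (Lindelof), and \<open>\<lambda>\<close> would be in the resolvent set of the
  restriction. On the other hand, if \<open>\<nu>(\<Sigma> \<inter> I) = 0\<close> then this projection almost surely annihilates
  \<open>\<delta>\<^sub>0\<close> (respectively all functions supported in the unit cube), by stationarity it almost surely
  annihilates every member of a countable total family of translates, and hence it is almost surely
  zero.

  The spectral projections are well defined by the spectral theorem. For existence, the moments
  \<open>\<langle>x, U\<^sup>k x\<rangle>\<close> of the Cayley transform \<open>U\<close> are realized by a measure on the circle, a weak limit of
  measures with Fejer densities, which is transported to the line; the projections for half-lines
  are strong limits of trigonometric polynomials of \<open>U\<close>. As these polynomials depend measurably on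
  \<open>\<omega>\<close>, so do the spectral projections. For uniqueness, \<open>H - s\<close> acts on the ranges of two spectral
  projections with different growth rates unless their sets meet.\<close>

section \<open>Hilbert spaces\<close>

text \<open>\<open>spectral_projection\<close> is a definite description, so nothing can be said
  about it before existence and uniqueness of a resolution are both proved; and a resolution records
  only the domain and the quadratic form of \<open>H\<close>, so even its commutation with
  \<open>H\<close> must be derived. The Cayley transform is preferred to \<open>H\<close> because
  its polynomials are everywhere defined, their norms at a vector are mean squares of their symbols,
  and they are algebraic in the resolvents, the only objects assumed measurable. Weak measurability
  does not pass to products by itself; the resolvent identity supplies it here without expanding in
  a basis. The subspaces \<open>M \<omega>\<close> may depend on \<omega> arbitrarily: they enter
  for one \<omega> at a time, and only a conclusion about the whole operator is used across
  \<omega>. The interior of \<open>I\<close> appears because a full neighbourhood of the spectral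
  point must lie in \<open>I\<close>. In the continuous model the trace refers to an orthonormal
  basis that is not known to be countable, so exceptional null sets are united vector by
  vector.\<close>

class chilbert_space = complex_inner + complete_space

lemma cinner_add_left: "cinner (x + y) z = cinner x z + cinner y z"
  by (subst (1 2 3) cinner_commute) (simp add: cinner_add_right)

lemma cinner_scaleC_left: "cinner (c *\<^sub>C x) y = cnj c * cinner x y"
  by (subst (1 2) cinner_commute) (simp add: cinner_scaleC_right)

lemma scaleC_zero_left [simp]: "0 *\<^sub>C x = 0"
  using scaleC_of_real[of 0 x] by simp

lemma scaleC_one [simp]: "1 *\<^sub>C x = x"
  using scaleC_of_real[of 1 x] by simp

lemma scaleC_minus_one: "(-1) *\<^sub>C x = - x"
  using scaleC_of_real[of "-1" x] by simp

lemma scaleC_zero_right [simp]: "c *\<^sub>C 0 = 0"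
  using scaleC_scaleC[of c 0 0] by simp

lemma scaleC_minus_left: "(- c) *\<^sub>C x = - (c *\<^sub>C x)"
  by (metis mult_minus1 scaleC_minus_one scaleC_scaleC)

lemma scaleC_minus_right: "c *\<^sub>C (- x) = - (c *\<^sub>C x)"
  by (metis mult_minus1_right scaleC_minus_left scaleC_minus_one scaleC_scaleC)

lemma scaleC_diff_right: "c *\<^sub>C (x - y) = c *\<^sub>C x - c *\<^sub>C y"
  using scaleC_add_right[of c x "- y"] by (simp add: scaleC_minus_right)

lemma scaleC_diff_left: "(c - d) *\<^sub>C x = c *\<^sub>C x - d *\<^sub>C x"
  using scaleC_add_left[of c "- d" x] by (simp add: scaleC_minus_left)

lemma cinner_zero_left [simp]: "cinner 0 x = 0"
  using cinner_scaleC_left[of 0 0 x] by simp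

lemma cinner_zero_right [simp]: "cinner x 0 = 0"
  using cinner_scaleC_right[of x 0 0] by simp

lemma cinner_minus_left: "cinner (- x) y = - cinner x y"
  using cinner_scaleC_left[of "-1" x y] by (simp add: scaleC_minus_one)

lemma cinner_minus_right: "cinner x (- y) = - cinner x y"
  using cinner_scaleC_right[of x "-1" y] by (simp add: scaleC_minus_one)

lemma cinner_diff_left: "cinner (x - y) z = cinner x z - cinner y z"
  using cinner_add_left[of x "- y" z] by (simp add: cinner_minus_left)

lemma cinner_diff_right: "cinner x (y - z) = cinner x y - cinner x z"
  using cinner_add_right[of x y "- z"] by (simp add: cinner_minus_right)

lemmas cinner_simps = cinner_add_left cinner_add_right cinner_diff_left cinner_diff_right
  cinner_minus_left cinner_minus_right cinner_scaleC_left cinner_scaleC_right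

lemma cinner_sum_right: "cinner x (\<Sum>i\<in>A. f i) = (\<Sum>i\<in>A. cinner x (f i))"
  by (induction A rule: infinite_finite_induct) (auto simp: cinner_add_right)

lemma cinner_sum_left: "cinner (\<Sum>i\<in>A. f i) x = (\<Sum>i\<in>A. cinner (f i) x)"
  by (induction A rule: infinite_finite_induct) (auto simp: cinner_add_left)

lemma cinner_self: "cinner x x = of_real ((norm x)\<^sup>2)"
proof (rule complex_eqI)
  show "Re (cinner x x) = Re (of_real ((norm x)\<^sup>2))"
    by (simp add: Re_cinner power2_norm_eq_inner)
  show "Im (cinner x x) = Im (of_real ((norm x)\<^sup>2))"
    using arg_cong[OF cinner_commute[of x x], of Im] by simp
qed

lemma cinner_self_eq_0 [simp]: "cinner x x = 0 \<longleftrightarrow> x = 0"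
  by (simp add: cinner_self)

lemma norm_scaleC: "norm (c *\<^sub>C x) = norm c * norm x"
proof -
  have "complex_of_real ((norm (c *\<^sub>C x))\<^sup>2) = of_real ((norm c * norm x)\<^sup>2)"
    using cinner_self[of "c *\<^sub>C x", symmetric]
    by (simp add: cinner_self[of x] cinner_scaleC_left cinner_scaleC_right power_mult_distrib
        mult.assoc complex_norm_square[of c, unfolded of_real_power, symmetric] mult.left_commute)
  then have "(norm (c *\<^sub>C x))\<^sup>2 = (norm c * norm x)\<^sup>2"
    by (metis of_real_eq_iff)
  then show ?thesis by simp
qed

text \<open>Multiplying \<open>y\<close> by a unimodular constant makes the product real, which
  reduces the claim to the real inequality.\<close>

lemma cinner_cauchy_schwarz: "norm (cinner x y) \<le> norm x * norm y"
proof (cases "cinner x y = 0")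
  case False
  define c where "c = cnj (sgn (cinner x y))"
  have "cnj (sgn w) * w = of_real (norm w)" if "w \<noteq> 0" for w :: complex
    using that complex_norm_square[of w]
    by (simp add: sgn_eq field_simps power2_eq_square)
  then have "cinner x (c *\<^sub>C y) = of_real (norm (cinner x y))"
    using False by (simp add: c_def cinner_scaleC_right)
  then have "norm (cinner x y) = inner x (c *\<^sub>C y)"
    by (metis Re_cinner Re_complex_of_real)
  also have "\<dots> \<le> norm x * norm (c *\<^sub>C y)"
    by (rule norm_cauchy_schwarz)
  also have "\<dots> = norm x * norm y"
    using False by (simp add: norm_scaleC c_def norm_sgn)
  finally show ?thesis .
qed simp

lemma bounded_bilinear_cinner: "bounded_bilinear (cinner :: 'h::complex_inner \<Rightarrow> 'h \<Rightarrow> complex)"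
proof
  fix a b :: 'h and r :: real
  show "cinner (r *\<^sub>R a) b = r *\<^sub>R cinner a b"
    by (simp add: scaleC_of_real[symmetric] cinner_scaleC_left scaleR_conv_of_real)
  show "cinner a (r *\<^sub>R b) = r *\<^sub>R cinner a b"
    by (simp add: scaleC_of_real[symmetric] cinner_scaleC_right scaleR_conv_of_real)
  show "\<exists>K. \<forall>(a::'h) b. norm (cinner a b) \<le> norm a * norm b * K"
    by (rule exI[of _ 1]) (simp add: cinner_cauchy_schwarz)
qed (simp_all add: cinner_add_left cinner_add_right)

lemmas tendsto_cinner = bounded_bilinear.tendsto[OF bounded_bilinear_cinner]
lemmas continuous_on_cinner = bounded_bilinear.continuous_on[OF bounded_bilinear_cinner]

lemma tendsto_scaleC:
  assumes "(f \<longlongrightarrow> x) F"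
  shows "((\<lambda>i. c *\<^sub>C f i) \<longlongrightarrow> c *\<^sub>C x) F"
proof -
  have "((\<lambda>i. norm c * norm (f i - x)) \<longlongrightarrow> norm c * 0) F"
    using assms by (intro tendsto_mult tendsto_const tendsto_norm_zero) (simp add: LIM_zero)
  then have "((\<lambda>i. norm (c *\<^sub>C f i - c *\<^sub>C x)) \<longlongrightarrow> 0) F"
    by (simp add: norm_scaleC[symmetric] scaleC_diff_right)
  then show ?thesis
    by (simp add: LIM_zero_iff tendsto_norm_zero_iff)
qed

lemma parallelogram:
  fixes x y :: "'a::real_inner"
  shows "(norm (x + y))\<^sup>2 + (norm (x - y))\<^sup>2 = 2 * (norm x)\<^sup>2 + 2 * (norm y)\<^sup>2"
proof -
  have "(norm (x + y))\<^sup>2 = (norm x)\<^sup>2 + 2 * inner x y + (norm y)\<^sup>2"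
    "(norm (x - y))\<^sup>2 = (norm x)\<^sup>2 - 2 * inner x y + (norm y)\<^sup>2"
    using dot_norm[of x y] dot_norm_neg[of x y] by (simp_all add: field_simps)
  then show ?thesis by simp
qed

lemma clinear_add: "clinear F \<Longrightarrow> F (x + y) = F x + F y"
  and clinear_scaleC: "clinear F \<Longrightarrow> F (c *\<^sub>C x) = c *\<^sub>C F x"
  by (auto simp: clinear_def)

lemma clinear_zero: "clinear F \<Longrightarrow> F 0 = 0"
  using clinear_scaleC[of F 0 0] by simp

lemma clinear_minus: "clinear F \<Longrightarrow> F (- x) = - F x"
  using clinear_scaleC[of F "-1" x] by (simp add: scaleC_minus_one)

lemma clinear_diff: "clinear F \<Longrightarrow> F (x - y) = F x - F y"
  using clinear_add[of F x "- y"] by (simp add: clinear_minus)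

lemma clinear_tendsto:
  assumes "clinear F" and "\<And>x. norm (F x) \<le> C * norm x" and "(f \<longlongrightarrow> x) G"
  shows "((\<lambda>i. F (f i)) \<longlongrightarrow> F x) G"
proof -
  have "((\<lambda>i. C * norm (f i - x)) \<longlongrightarrow> C * 0) G"
    using assms(3) by (intro tendsto_mult tendsto_const tendsto_norm_zero) (simp add: LIM_zero)
  then have "((\<lambda>i. C * norm (f i - x)) \<longlongrightarrow> 0) G" by simp
  then have "((\<lambda>i. F (f i - x)) \<longlongrightarrow> 0) G"
    by (rule Lim_null_comparison[rotated]) (intro always_eventually allI assms(2))
  then have "((\<lambda>i. F (f i) - F x) \<longlongrightarrow> 0) G"
    by (simp only: clinear_diff[OF assms(1)])
  then show ?thesis by (rule LIM_zero_cancel)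
qed

text \<open>Complex polarization. Evaluating the vanishing form of the difference at
  \<open>x + y\<close> and at \<open>x + \<i> y\<close> makes both the sum and the difference of the
  two mixed terms zero. This is how operators are identified below from scalar measures
  alone.\<close>

lemma quadratic_form_determines:
  assumes F: "clinear F" and G: "clinear G" and eq: "\<And>x. cinner x (F x) = cinner x (G x)"
  shows "F x = G x"
proof -
  define D where "D x = F x - G x" for x
  have add: "D (x + y) = D x + D y" and scale: "D (c *\<^sub>C x) = c *\<^sub>C D x" for c x y
    using F G by (auto simp: D_def clinear_def algebra_simps scaleC_diff_right)
  have quad: "cinner x (D x) = 0" for x
    using eq by (simp add: D_def cinner_diff_right)
  have 1: "cinner x (D y) + cinner y (D x) = 0" for x y
    using quad[of "x + y"] quad[of x] quad[of y] by (simp add: add cinner_simps add.commute)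
  have "\<i> * cinner x (D y) - \<i> * cinner y (D x) = 0" for x y
    using 1[of x "\<i> *\<^sub>C y"] by (simp add: scale cinner_simps)
  then have "cinner x (D y) = cinner y (D x)" for x y
    by simp
  with 1 have "cinner x (D y) = 0" for x y
    by (metis mult_2 mult_eq_0_iff zero_neq_numeral)
  then have "D x = 0" by (metis cinner_self_eq_0)
  then show ?thesis by (simp add: D_def)
qed

lemma cinner_zero_dense:
  assumes "closure S = UNIV" and "\<And>s. s \<in> S \<Longrightarrow> cinner s v = 0"
  shows "v = 0"
proof -
  obtain f where f: "\<And>n. f n \<in> S" "f \<longlonglongrightarrow> v"
    using assms(1) closure_sequential[of v S] by auto
  have "(\<lambda>n. cinner (f n) v) \<longlonglongrightarrow> cinner v v"
    by (intro tendsto_cinner f tendsto_const)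
  then have "cinner v v = 0"
    using f(1) assms(2) by (simp add: LIMSEQ_const_iff)
  then show ?thesis by simp
qed

section \<open>Orthogonal projections\<close>

lemma closed_csubspaceD:
  assumes "closed_csubspace M"
  shows "0 \<in> M" and "x \<in> M \<Longrightarrow> y \<in> M \<Longrightarrow> x + y \<in> M" and "x \<in> M \<Longrightarrow> c *\<^sub>C x \<in> M"
    and "x \<in> M \<Longrightarrow> y \<in> M \<Longrightarrow> x - y \<in> M" and "closed M" and "x \<in> M \<Longrightarrow> - x \<in> M"
proof -
  show neg: "x \<in> M \<Longrightarrow> - x \<in> M" for x
    using assms scaleC_minus_one[of x] unfolding closed_csubspace_def by metis
  show "x \<in> M \<Longrightarrow> y \<in> M \<Longrightarrow> x - y \<in> M"
    using assms neg[of y] unfolding closed_csubspace_def by (metis diff_conv_add_uminus)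
qed (use assms in \<open>auto simp: closed_csubspace_def\<close>)

text \<open>The optimal coefficient \<open>c\<close> lowers the squared norm by
  \<open>|<m, w>|^2 / |m|^2\<close>, so a closest vector leaves no room for a nonzero
  product.\<close>

lemma orthogonal_if_closest:
  fixes m w :: "'h::complex_inner"
  assumes "\<And>c. norm w \<le> norm (w - c *\<^sub>C m)"
  shows "cinner m w = 0"
proof (cases "m = 0")
  case False
  define c where "c = cinner m w / of_real ((norm m)\<^sup>2)"
  have nz: "complex_of_real ((norm m)\<^sup>2) \<noteq> 0" using False by simp
  have "cinner (w - c *\<^sub>C m) (w - c *\<^sub>C m) = cinner w w - c * cnj (cinner m w)"
    using nz cinner_commute[of w m]
    by (simp add: cinner_simps cinner_self[of m] c_def field_simps)
  also have "c * cnj (cinner m w) = of_real ((norm (cinner m w))\<^sup>2 / (norm m)\<^sup>2)"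
    using complex_norm_square[of "cinner m w"] by (simp add: c_def)
  finally have "complex_of_real ((norm (w - c *\<^sub>C m))\<^sup>2) =
      of_real ((norm w)\<^sup>2 - (norm (cinner m w))\<^sup>2 / (norm m)\<^sup>2)"
    by (simp add: cinner_self)
  then have "(norm (w - c *\<^sub>C m))\<^sup>2 = (norm w)\<^sup>2 - (norm (cinner m w))\<^sup>2 / (norm m)\<^sup>2"
    using of_real_eq_iff by blast
  moreover have "(norm w)\<^sup>2 \<le> (norm (w - c *\<^sub>C m))\<^sup>2"
    using assms by (intro power_mono) auto
  ultimately have "(norm (cinner m w))\<^sup>2 / (norm m)\<^sup>2 \<le> 0" by simp
  then have "(norm (cinner m w))\<^sup>2 \<le> 0"
    using False by (simp add: divide_le_0_iff)
  then show ?thesis by simp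
qed simp

text \<open>A minimizing sequence is Cauchy: midpoints stay in \<open>M\<close> and hence at squared
  distance at least \<open>d\<close>, and the parallelogram identity converts this into a bound on
  the distance of two members.\<close>

lemma projection_exists:
  fixes u :: "'h::chilbert_space"
  assumes M: "closed_csubspace M"
  shows "\<exists>p\<in>M. \<forall>m\<in>M. cinner m (u - p) = 0"
proof -
  note MD = closed_csubspaceD[OF M]
  define d where "d = (INF m\<in>M. (norm (u - m))\<^sup>2)"
  have bdd: "bdd_below ((\<lambda>m. (norm (u - m))\<^sup>2) ` M)"
    by (rule bdd_belowI[of _ 0]) auto
  have d_le: "d \<le> (norm (u - m))\<^sup>2" if "m \<in> M" for m
    unfolding d_def by (rule cINF_lower[OF bdd that])
  have "\<exists>m\<in>M. (norm (u - m))\<^sup>2 < d + 1 / real (Suc n)" for n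
  proof -
    have "(INF m\<in>M. (norm (u - m))\<^sup>2) < d + 1 / real (Suc n)"
      by (simp add: d_def)
    then show ?thesis
      using MD(1) bdd by (subst (asm) cINF_less_iff) auto
  qed
  then obtain f where f: "\<And>n. f n \<in> M" "\<And>n. (norm (u - f n))\<^sup>2 < d + 1 / real (Suc n)"
    by metis
  have dist: "(dist (f n) (f k))\<^sup>2 \<le> 2 / real (Suc n) + 2 / real (Suc k)" for n k
  proof -
    have "(1/2) *\<^sub>R (f n + f k) \<in> M"
      using MD(3)[OF MD(2)[OF f(1)[of n] f(1)[of k]], of "1/2"] scaleC_of_real[of "1/2" "f n + f k"]
      by simp
    then have "4 * d \<le> 4 * (norm (u - (1/2) *\<^sub>R (f n + f k)))\<^sup>2"
      using d_le by simp
    also have "\<dots> = (norm (2 *\<^sub>R (u - (1/2) *\<^sub>R (f n + f k))))\<^sup>2"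
      by (simp add: power_mult_distrib)
    also have "2 *\<^sub>R (u - (1/2) *\<^sub>R (f n + f k)) = (u - f n) + (u - f k)"
      by (simp add: algebra_simps scaleR_2)
    finally have "4 * d \<le> (norm ((u - f n) + (u - f k)))\<^sup>2" .
    moreover have "(norm ((u - f n) - (u - f k)))\<^sup>2 = (dist (f n) (f k))\<^sup>2"
      by (simp add: dist_norm norm_minus_commute)
    ultimately show ?thesis
      using parallelogram[of "u - f n" "u - f k"] f(2)[of n] f(2)[of k] by simp
  qed
  have "Cauchy f"
  proof (rule metric_CauchyI)
    fix e :: real assume e: "e > 0"
    obtain N :: nat where N: "4 / e\<^sup>2 < real N" using reals_Archimedean2 by blast
    have "dist (f n) (f k) < e" if "n \<ge> N" "k \<ge> N" for n k
    proof -
      have N0: "real N > 0" using N e by (meson divide_pos_pos less_trans zero_less_numeral zero_less_power)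
      have "2 / real (Suc n) + 2 / real (Suc k) \<le> 2 / real N + 2 / real N"
        using that N0 by (intro add_mono divide_left_mono) auto
      also have "\<dots> < e\<^sup>2"
        using N N0 e by (simp add: field_simps)
      finally have "(dist (f n) (f k))\<^sup>2 < e\<^sup>2" using dist[of n k] by simp
      then show ?thesis using e by (simp add: power2_less_imp_less)
    qed
    then show "\<exists>N. \<forall>m\<ge>N. \<forall>n\<ge>N. dist (f m) (f n) < e" by blast
  qed
  then obtain p where p: "f \<longlonglongrightarrow> p" by (meson Cauchy_convergent convergentD)
  have pM: "p \<in> M" using MD(5) f(1) p closed_sequentially by blast
  have "(norm (u - p))\<^sup>2 \<le> d"
  proof (rule LIMSEQ_le[of "\<lambda>n. (norm (u - f n))\<^sup>2" _ "\<lambda>n. d + 1 / real (Suc n)"])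
    show "(\<lambda>n. (norm (u - f n))\<^sup>2) \<longlonglongrightarrow> (norm (u - p))\<^sup>2"
      by (intro tendsto_intros p)
    show "(\<lambda>n. d + 1 / real (Suc n)) \<longlonglongrightarrow> d"
      using tendsto_add[OF tendsto_const LIMSEQ_inverse_real_of_nat, of d]
      by (simp add: inverse_eq_divide)
  qed (use f(2) less_imp_le in blast)
  then have "norm (u - p) \<le> norm (u - m)" if "m \<in> M" for m
    using d_le[OF that] by (meson norm_ge_zero order_trans power2_le_imp_le)
  then have "norm (u - p) \<le> norm (u - p - c *\<^sub>C m)" if "m \<in> M" for m c
    using MD(2)[OF pM MD(3)[OF that], of c] by (metis diff_diff_eq)
  then show ?thesis using pM orthogonal_if_closest by blast
qed

lemma proj_onto_eqI:
  assumes "closed_csubspace M" and "p \<in> M" and "\<And>m. m \<in> M \<Longrightarrow> cinner m (u - p) = 0"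
  shows "proj_onto M u = p"
  unfolding proj_onto_def
proof (rule the_equality)
  fix q assume q: "q \<in> M \<and> (\<forall>m\<in>M. cinner m (u - q) = 0)"
  have "q - p \<in> M" using q assms closed_csubspaceD(4) by blast
  then have "cinner (q - p) (u - p) - cinner (q - p) (u - q) = 0"
    using q assms(3) by simp
  then have "cinner (q - p) (q - p) = 0" by (simp add: cinner_diff_right)
  then show "q = p" by simp
qed (use assms in blast)

lemma proj_onto:
  fixes u :: "'h::chilbert_space"
  assumes "closed_csubspace M"
  shows proj_onto_mem: "proj_onto M u \<in> M"
    and proj_onto_orthogonal: "m \<in> M \<Longrightarrow> cinner m (u - proj_onto M u) = 0"
  using projection_exists[OF assms, of u] proj_onto_eqI[OF assms] by metis+

lemma proj_onto_id: "closed_csubspace M \<Longrightarrow> u \<in> M \<Longrightarrow> proj_onto M u = u"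
  by (rule proj_onto_eqI) auto

lemma orthogonal_projection_proj_onto:
  fixes M :: "'h::chilbert_space set"
  assumes M: "closed_csubspace M"
  shows "orthogonal_projection (proj_onto M)"
proof -
  note MD = closed_csubspaceD[OF M] and pm = proj_onto_mem[OF M] and po = proj_onto_orthogonal[OF M]
  have "proj_onto M (x + y) = proj_onto M x + proj_onto M y" for x y
  proof (rule proj_onto_eqI[OF M MD(2)[OF pm pm]])
    fix m assume m: "m \<in> M"
    show "cinner m (x + y - (proj_onto M x + proj_onto M y)) = 0"
      using po[OF m, of x] po[OF m, of y] by (simp add: cinner_simps)
  qed
  moreover have "proj_onto M (c *\<^sub>C x) = c *\<^sub>C proj_onto M x" for c x
    by (rule proj_onto_eqI[OF M MD(3)[OF pm]])
      (simp add: scaleC_diff_right[symmetric] cinner_scaleC_right po)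
  moreover have "cinner (proj_onto M x) y = cinner x (proj_onto M y)" for x y
  proof -
    have 1: "cinner (proj_onto M x) y = cinner (proj_onto M x) (proj_onto M y)" for x y
      using po[OF pm[of x], of y] by (simp add: cinner_diff_right)
    show ?thesis
      using 1[of x y] arg_cong[OF 1[of y x], of cnj] by (metis cinner_commute)
  qed
  ultimately show ?thesis
    unfolding orthogonal_projection_def clinear_def
    using proj_onto_id[OF M] pm by blast
qed

lemma orthogonal_projectionD:
  assumes "orthogonal_projection P"
  shows "clinear P" and "P (P x) = P x" and "cinner (P x) y = cinner x (P y)"
    and "cinner x (P x) = of_real ((norm (P x))\<^sup>2)" and "norm (P x) \<le> norm x"
    and "Re (cinner x (P x)) = (norm (P x))\<^sup>2"
proof -
  show 1: "clinear P" and 2: "P (P x) = P x" and 3: "cinner (P x) y = cinner x (P y)" for x y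
    using assms by (auto simp: orthogonal_projection_def)
  show 4: "cinner x (P x) = of_real ((norm (P x))\<^sup>2)" for x
    using 3[of x "P x"] 2[of x] by (simp add: cinner_self)
  show "Re (cinner x (P x)) = (norm (P x))\<^sup>2"
    unfolding 4 by simp
  have "(norm (P x))\<^sup>2 \<le> norm x * norm (P x)"
    using cinner_cauchy_schwarz[of x "P x"] unfolding 4 by (simp add: norm_power)
  then show "norm (P x) \<le> norm x"
    by (cases "P x = 0") (auto simp: power2_eq_square)
qed

lemma orthogonal_projection_complement:
  assumes "orthogonal_projection P"
  shows "orthogonal_projection (\<lambda>x. x - P x)"
  using orthogonal_projectionD(2,3)[OF assms] clinear_add[OF orthogonal_projectionD(1)[OF assms]]
    clinear_diff[OF orthogonal_projectionD(1)[OF assms]]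
    clinear_scaleC[OF orthogonal_projectionD(1)[OF assms]]
  by (simp add: orthogonal_projection_def clinear_def cinner_simps scaleC_diff_right)

lemma norm_projection_pythagoras:
  assumes "orthogonal_projection P"
  shows "(norm x)\<^sup>2 = (norm (P x))\<^sup>2 + (norm (x - P x))\<^sup>2"
proof -
  note P = orthogonal_projectionD[OF assms]
  have "cinner (x - P x) (x - P x) = cinner x x - of_real ((norm (P x))\<^sup>2)"
    using P(3)[of x x] P(3)[of x "P x"] by (simp add: cinner_simps P)
  then have "complex_of_real ((norm (x - P x))\<^sup>2) = of_real ((norm x)\<^sup>2 - (norm (P x))\<^sup>2)"
    by (simp add: cinner_self)
  then have "(norm (x - P x))\<^sup>2 = (norm x)\<^sup>2 - (norm (P x))\<^sup>2"
    using of_real_eq_iff by blast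
  then show ?thesis by simp
qed

section \<open>Completeness of the square integrable functions\<close>

lemma square_integrable_diff:
  assumes "square_integrable M f" "square_integrable M g"
  shows "square_integrable M (\<lambda>x. f x - g x)"
  using square_integrable_add[OF assms(1) square_integrable_scale[OF assms(2), of "-1"]] by simp

text \<open>The elementary bound \<open>|x| <= 1 / c + c x^2\<close> with \<open>c = 2 ^ k\<close>
  trades the first power for a geometric series plus the weighted square. It replaces a triangle
  inequality for mean square norms, so that only integrals of squares occur.\<close>

lemma summable_of_weighted_squares:
  fixes a :: "nat \<Rightarrow> real"
  assumes "summable (\<lambda>k. 2 ^ k * (a k)\<^sup>2)"
  shows "summable (\<lambda>k. \<bar>a k\<bar>)"
proof (rule summable_comparison_test)
  show "summable (\<lambda>k. (1 / 2) ^ k + 2 ^ k * (a k)\<^sup>2)"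
    by (intro summable_add assms summable_geometric) simp
  have "\<bar>x\<bar> \<le> 1 / c + c * x\<^sup>2" if "c > 0" for x c :: real
  proof -
    have "0 \<le> (1 - c * \<bar>x\<bar>)\<^sup>2" by simp
    then have "2 * (c * \<bar>x\<bar>) \<le> 1 + c\<^sup>2 * x\<^sup>2"
      by (simp add: power2_eq_square algebra_simps abs_mult_self_eq)
    then have "c * \<bar>x\<bar> \<le> 1 + c\<^sup>2 * x\<^sup>2"
      using that mult_nonneg_nonneg[of c "\<bar>x\<bar>"] by linarith
    also have "1 + c\<^sup>2 * x\<^sup>2 = c * (1 / c + c * x\<^sup>2)"
      using that by (simp add: field_simps power2_eq_square)
    finally show ?thesis using that by simp
  qed
  from this[of "2 ^ _"] show "\<exists>N. \<forall>k\<ge>N. norm \<bar>a k\<bar> \<le> (1 / 2) ^ k + 2 ^ k * (a k)\<^sup>2"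
    by (simp add: power_one_over)
qed

text \<open>Along a rapidly convergent subsequence the weighted squares of the increments are summable
  almost everywhere, so the subsequence converges pointwise; Fatou's lemma turns the pointwise
  limit into a limit in the mean.\<close>

lemma square_integrable_complete:
  fixes f :: "nat \<Rightarrow> 'a \<Rightarrow> complex"
  assumes si: "\<And>n. square_integrable M (f n)"
    and cauchy: "\<And>e. e > 0 \<Longrightarrow> \<exists>N. \<forall>m\<ge>N. \<forall>n\<ge>N. (\<integral>x. (norm (f m x - f n x))\<^sup>2 \<partial>M) < e"
  shows "\<exists>g. square_integrable M g \<and> (\<lambda>n. \<integral>x. (norm (f n x - g x))\<^sup>2 \<partial>M) \<longlonglongrightarrow> 0"
proof -
  have [measurable]: "f n \<in> borel_measurable M" for n
    using si by (simp add: square_integrable_def)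
  have int: "integrable M (\<lambda>x. (norm (f m x - f n x))\<^sup>2)" for m n
    using square_integrable_diff[OF si si] by (simp add: square_integrable_def)
  define d where "d m n = (\<integral>x. (norm (f m x - f n x))\<^sup>2 \<partial>M)" for m n
  have nn_d: "(\<integral>\<^sup>+x. ennreal ((norm (f m x - f n x))\<^sup>2) \<partial>M) = ennreal (d m n)" for m n
    unfolding d_def by (rule nn_integral_eq_integral[OF int]) simp
  \<comment> \<open>The rate \<open>(1 / 4) ^ k\<close> leaves \<open>(1 / 2) ^ k\<close> after
    multiplication by the weight \<open>2 ^ k\<close>.\<close>
  have "\<exists>N. \<forall>m\<ge>N. \<forall>n\<ge>N. d m n < (1 / 4) ^ k" for k
    using cauchy[of "(1 / 4) ^ k"] by (simp add: d_def)
  then obtain N where N: "\<And>k m n. m \<ge> N k \<Longrightarrow> n \<ge> N k \<Longrightarrow> d m n < (1 / 4) ^ k"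
    by metis
  \<comment> \<open>The sum of all thresholds up to \<open>k\<close> makes \<open>r k\<close> and
    \<open>r (Suc k)\<close> both exceed \<open>N k\<close>; the summand \<open>k\<close> drives
    \<open>r\<close> to infinity, as the tail estimate requires.\<close>
  define r where "r k = (\<Sum>j\<le>k. N j) + k" for k
  have r_ge: "N k \<le> r k" "N k \<le> r (Suc k)" "k \<le> r k" for k
    unfolding r_def using member_le_sum[of k "{..k}" N] member_le_sum[of k "{..Suc k}" N]
    by (auto simp del: sum.atMost_Suc)
  have r_d: "d (r (Suc k)) (r k) < (1 / 4) ^ k" for k
    using r_ge N by blast
  have "AE x in M. summable (\<lambda>k. 2 ^ k * (norm (f (r (Suc k)) x - f (r k) x))\<^sup>2)"
  proof -
    have "(\<integral>\<^sup>+x. (\<Sum>k. ennreal (2 ^ k * (norm (f (r (Suc k)) x - f (r k) x))\<^sup>2)) \<partial>M)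
        = (\<Sum>k. \<integral>\<^sup>+x. ennreal (2 ^ k * (norm (f (r (Suc k)) x - f (r k) x))\<^sup>2) \<partial>M)"
      by (rule nn_integral_suminf) measurable
    also have "\<dots> = (\<Sum>k. ennreal (2 ^ k * d (r (Suc k)) (r k)))"
      by (simp add: ennreal_mult' nn_integral_cmult nn_d)
    also have "\<dots> \<le> (\<Sum>k. ennreal ((1 / 2) ^ k))"
    proof (rule suminf_le)
      fix k
      have "2 ^ k * d (r (Suc k)) (r k) \<le> 2 ^ k * (1 / 4) ^ k"
        using r_d[of k] by simp
      also have "\<dots> = (1 / 2 :: real) ^ k"
        by (simp add: power_mult_distrib[symmetric])
      finally show "ennreal (2 ^ k * d (r (Suc k)) (r k)) \<le> ennreal ((1 / 2) ^ k)"
        by (rule ennreal_leI)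
    qed auto
    also have "\<dots> < \<infinity>"
      by (subst suminf_ennreal2) (auto intro: summable_geometric)
    finally have "AE x in M. (\<Sum>k. ennreal (2 ^ k * (norm (f (r (Suc k)) x - f (r k) x))\<^sup>2)) \<noteq> \<infinity>"
      by (intro nn_integral_PInf_AE) auto
    then show ?thesis
      by eventually_elim (rule summable_suminf_not_top, auto simp: top_unique)
  qed
  then have conv: "AE x in M. convergent (\<lambda>k. f (r k) x)"
  proof eventually_elim
    fix x assume "summable (\<lambda>k. 2 ^ k * (norm (f (r (Suc k)) x - f (r k) x))\<^sup>2)"
    from summable_of_weighted_squares[OF this]
    have "summable (\<lambda>k. f (r (Suc k)) x - f (r k) x)"
      by (intro summable_norm_cancel[of "\<lambda>k. f (r (Suc k)) x - f (r k) x"]) simp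
    then obtain l where "(\<lambda>n. \<Sum>k<n. f (r (Suc k)) x - f (r k) x) \<longlonglongrightarrow> l"
      unfolding summable_def sums_def by blast
    then have "(\<lambda>n. f (r n) x - f (r 0) x) \<longlonglongrightarrow> l"
      by (simp add: sum_lessThan_telescope[of "\<lambda>k. f (r k) x"])
    then have "(\<lambda>n. f (r n) x - f (r 0) x + f (r 0) x) \<longlonglongrightarrow> l + f (r 0) x"
      by (intro tendsto_intros)
    then show "convergent (\<lambda>k. f (r k) x)"
      by (auto simp: convergent_def)
  qed
  define g where "g x = lim (\<lambda>k. f (r k) x)" for x
  have [measurable]: "g \<in> borel_measurable M"
    unfolding g_def by measurable
  have lim: "AE x in M. (\<lambda>k. f (r k) x) \<longlonglongrightarrow> g x"
    using conv by eventually_elim (simp add: g_def convergent_LIMSEQ_iff)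
  have fatou: "(\<integral>\<^sup>+x. ennreal ((norm (f n x - g x))\<^sup>2) \<partial>M) \<le> ennreal c"
    if c: "\<And>k. k \<ge> K \<Longrightarrow> d n (r k) \<le> c" for n c K
  proof -
    have "(\<integral>\<^sup>+x. ennreal ((norm (f n x - g x))\<^sup>2) \<partial>M)
        = (\<integral>\<^sup>+x. liminf (\<lambda>k. ennreal ((norm (f n x - f (r k) x))\<^sup>2)) \<partial>M)"
    proof (rule nn_integral_cong_AE, use lim in eventually_elim)
      fix x assume "(\<lambda>k. f (r k) x) \<longlonglongrightarrow> g x"
      then have "(\<lambda>k. ennreal ((norm (f n x - f (r k) x))\<^sup>2))
          \<longlonglongrightarrow> ennreal ((norm (f n x - g x))\<^sup>2)"
        by (intro tendsto_intros)
      then show "ennreal ((norm (f n x - g x))\<^sup>2) = liminf (\<lambda>k. ennreal ((norm (f n x - f (r k) x))\<^sup>2))"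
        by (rule lim_imp_Liminf[OF trivial_limit_sequentially, symmetric])
    qed
    also have "\<dots> \<le> liminf (\<lambda>k. \<integral>\<^sup>+x. ennreal ((norm (f n x - f (r k) x))\<^sup>2) \<partial>M)"
      by (rule nn_integral_liminf) measurable
    also have "\<dots> \<le> ennreal c"
      unfolding nn_d
      by (rule Liminf_le) (auto simp: eventually_sequentially intro!: exI[of _ K] ennreal_leI c)
    finally show ?thesis .
  qed
  have tail: "\<exists>n0. \<forall>n\<ge>n0. (\<integral>\<^sup>+x. ennreal ((norm (f n x - g x))\<^sup>2) \<partial>M) \<le> ennreal e" if e: "e > 0" for e
  proof -
    obtain n0 where n0: "\<And>m n. m \<ge> n0 \<Longrightarrow> n \<ge> n0 \<Longrightarrow> d m n < e"
      using cauchy[OF e] unfolding d_def by blast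
    have "(\<integral>\<^sup>+x. ennreal ((norm (f n x - g x))\<^sup>2) \<partial>M) \<le> ennreal e" if "n \<ge> n0" for n
    proof (rule fatou[of n0])
      fix k assume "k \<ge> n0"
      then have "r k \<ge> n0" using r_ge(3)[of k] by linarith
      then show "d n (r k) \<le> e" using n0[OF that] by (simp add: less_imp_le)
    qed
    then show ?thesis by blast
  qed
  have si_diff: "square_integrable M (\<lambda>x. f n x - g x)"
    if "(\<integral>\<^sup>+x. ennreal ((norm (f n x - g x))\<^sup>2) \<partial>M) \<le> ennreal e" for n e
    using that unfolding square_integrable_def
    by (auto intro!: integrableI_bounded simp: top_unique less_top[symmetric])
  obtain n1 where n1: "\<And>n. n \<ge> n1 \<Longrightarrow> (\<integral>\<^sup>+x. ennreal ((norm (f n x - g x))\<^sup>2) \<partial>M) \<le> ennreal 1"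
    using tail[of 1] by auto
  \<comment> \<open>Only the differences \<open>f n - g\<close> are known to be square integrable,
    by Fatou; \<open>g\<close> is recovered by subtracting one of them from
    \<open>f n\<close>.\<close>
  have si_g: "square_integrable M g"
    using square_integrable_diff[OF si[of n1] si_diff[OF n1[of n1]]] by simp
  have "(\<lambda>n. \<integral>x. (norm (f n x - g x))\<^sup>2 \<partial>M) \<longlonglongrightarrow> 0"
  proof (rule LIMSEQ_I)
    fix e :: real assume e: "e > 0"
    obtain n0 where n0: "\<And>n. n \<ge> n0 \<Longrightarrow> (\<integral>\<^sup>+x. ennreal ((norm (f n x - g x))\<^sup>2) \<partial>M) \<le> ennreal (e / 2)"
      using tail[of "e / 2"] e by auto
    have "norm ((\<integral>x. (norm (f n x - g x))\<^sup>2 \<partial>M) - 0) < e" if "n \<ge> n0" for n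
    proof -
      have "integrable M (\<lambda>x. (norm (f n x - g x))\<^sup>2)"
        using si_diff[OF n0[OF that]] by (simp add: square_integrable_def)
      then have "ennreal (\<integral>x. (norm (f n x - g x))\<^sup>2 \<partial>M) \<le> ennreal (e / 2)"
        using n0[OF that] by (subst (asm) nn_integral_eq_integral) auto
      then show ?thesis using e by (simp add: ennreal_le_iff)
    qed
    then show "\<exists>no. \<forall>n\<ge>no. norm ((\<integral>x. (norm (f n x - g x))\<^sup>2 \<partial>M) - 0) < e" by blast
  qed
  then show ?thesis using si_g by blast
qed

lemma less_sqrt_imp_square_less:
  fixes x e :: real
  assumes "0 \<le> x" and "x < sqrt e"
  shows "x\<^sup>2 < e"
  using assms real_less_rsqrt real_sqrt_less_iff[of "x\<^sup>2" e] by simp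

lemma norm_ell2: "(norm x)\<^sup>2 = (\<integral>n. (norm (Rep_ell2 x n))\<^sup>2 \<partial>count_space UNIV)"
proof -
  have "cinner x x = of_real (\<integral>n. (norm (Rep_ell2 x n))\<^sup>2 \<partial>count_space UNIV)"
    unfolding cinner_ell2.rep_eq by (rule L2_inner_self)
  then show ?thesis using of_real_eq_iff cinner_self[of x] by metis
qed

lemma Rep_ell2_diff: "Rep_ell2 (x - y) n = Rep_ell2 x n - Rep_ell2 y n"
  unfolding minus_ell2_def uminus_ell2_def by (simp only: plus_ell2.rep_eq scaleC_ell2.rep_eq) simp

instance ell2 :: (type) chilbert_space
proof
  fix X :: "nat \<Rightarrow> 'a ell2"
  assume X: "Cauchy X"
  have "\<exists>g. square_integrable (count_space UNIV) g \<and>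
      (\<lambda>n. \<integral>x. (norm (Rep_ell2 (X n) x - g x))\<^sup>2 \<partial>count_space UNIV) \<longlonglongrightarrow> 0"
  proof (rule square_integrable_complete)
    fix e :: real assume "e > 0"
    then obtain N where "\<And>m n. m \<ge> N \<Longrightarrow> n \<ge> N \<Longrightarrow> norm (X m - X n) < sqrt e"
      using CauchyD[OF X, of "sqrt e"] by auto
    then have "\<And>m n. m \<ge> N \<Longrightarrow> n \<ge> N \<Longrightarrow> (norm (X m - X n))\<^sup>2 < e"
      by (intro less_sqrt_imp_square_less) auto
    then show "\<exists>N. \<forall>m\<ge>N. \<forall>n\<ge>N.
        (\<integral>x. (norm (Rep_ell2 (X m) x - Rep_ell2 (X n) x))\<^sup>2 \<partial>count_space UNIV) < e"
      by (auto simp: norm_ell2 Rep_ell2_diff)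
  qed (use Rep_ell2 in auto)
  then obtain g where g: "square_integrable (count_space UNIV) g"
    and lim: "(\<lambda>n. \<integral>x. (norm (Rep_ell2 (X n) x - g x))\<^sup>2 \<partial>count_space UNIV) \<longlonglongrightarrow> 0"
    by blast
  have "(\<lambda>n. (norm (X n - Abs_ell2 g))\<^sup>2) \<longlonglongrightarrow> 0"
    using lim g by (simp add: norm_ell2 Rep_ell2_diff Abs_ell2_inverse)
  then have "(\<lambda>n. sqrt ((norm (X n - Abs_ell2 g))\<^sup>2)) \<longlonglongrightarrow> sqrt 0"
    by (intro tendsto_intros)
  then have "X \<longlonglongrightarrow> Abs_ell2 g"
    by (simp add: tendsto_norm_zero_iff LIM_zero_iff)
  then show "convergent X" by (auto simp: convergent_def)
qed

lemma norm_abs_L2: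
  assumes "square_integrable lborel f"
  shows "(norm (abs_L2 f))\<^sup>2 = (\<integral>x. (norm (f x))\<^sup>2 \<partial>lborel)"
proof -
  have "L2_rel f f" using assms by (simp add: L2_rel_def)
  then have "cinner (abs_L2 f) (abs_L2 f) = of_real (\<integral>x. (norm (f x))\<^sup>2 \<partial>lborel)"
    by (simp only: cinner_L2.abs_eq L2_inner_self)
  then show ?thesis using of_real_eq_iff cinner_self[of "abs_L2 f"] by metis
qed

lemma abs_L2_diff:
  assumes "square_integrable lborel f" "square_integrable lborel g"
  shows "abs_L2 f - abs_L2 g = abs_L2 (\<lambda>x. f x - g x)"
proof -
  have "L2_rel f f" "L2_rel g g" "L2_rel (\<lambda>x. (- 1) * g x) (\<lambda>x. (- 1) * g x)"
    using assms square_integrable_scale[of lborel g "- 1"] by (simp_all add: L2_rel_def)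
  then show ?thesis
    unfolding minus_L2_def uminus_L2_def by (simp only: scaleC_L2.abs_eq plus_L2.abs_eq) simp
qed

lemma L2_cases:
  obtains f where "square_integrable lborel f" "x = abs_L2 f"
proof -
  have "L2_rel (rep_L2 x) (rep_L2 x)" by (rule Quotient3_rep_reflp[OF Quotient3_L2])
  moreover have "x = abs_L2 (rep_L2 x)" by (rule Quotient3_abs_rep[OF Quotient3_L2, symmetric])
  ultimately show thesis using that by (auto simp: L2_rel_def)
qed

instance L2 :: (euclidean_space) chilbert_space
proof
  fix X :: "nat \<Rightarrow> 'a L2"
  assume X: "Cauchy X"
  have "\<forall>n. \<exists>f. square_integrable lborel f \<and> X n = abs_L2 f"
    by (meson L2_cases)
  then obtain F where F: "\<And>n. square_integrable lborel (F n)" "\<And>n. X n = abs_L2 (F n)"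
    using choice[of "\<lambda>n f. square_integrable lborel f \<and> X n = abs_L2 f"] by blast
  have "\<exists>g. square_integrable lborel g \<and> (\<lambda>n. \<integral>x. (norm (F n x - g x))\<^sup>2 \<partial>lborel) \<longlonglongrightarrow> 0"
  proof (rule square_integrable_complete[OF F(1)])
    fix e :: real assume "e > 0"
    then obtain N where "\<And>m n. m \<ge> N \<Longrightarrow> n \<ge> N \<Longrightarrow> norm (X m - X n) < sqrt e"
      using CauchyD[OF X, of "sqrt e"] by auto
    then have "\<And>m n. m \<ge> N \<Longrightarrow> n \<ge> N \<Longrightarrow> (norm (X m - X n))\<^sup>2 < e"
      by (intro less_sqrt_imp_square_less) auto
    then show "\<exists>N. \<forall>m\<ge>N. \<forall>n\<ge>N. (\<integral>x. (norm (F m x - F n x))\<^sup>2 \<partial>lborel) < e"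
      by (auto simp: F abs_L2_diff norm_abs_L2 square_integrable_diff)
  qed
  then obtain g where g: "square_integrable lborel g"
    and lim: "(\<lambda>n. \<integral>x. (norm (F n x - g x))\<^sup>2 \<partial>lborel) \<longlonglongrightarrow> 0"
    by blast
  have "(\<lambda>n. (norm (X n - abs_L2 g))\<^sup>2) \<longlonglongrightarrow> 0"
    using lim g F by (simp only: abs_L2_diff norm_abs_L2 square_integrable_diff)
  then have "(\<lambda>n. sqrt ((norm (X n - abs_L2 g))\<^sup>2)) \<longlonglongrightarrow> sqrt 0"
    by (intro tendsto_intros)
  then have "X \<longlonglongrightarrow> abs_L2 g"
    by (simp add: tendsto_norm_zero_iff LIM_zero_iff)
  then show "convergent X" by (auto simp: convergent_def)
qed

section \<open>Selfadjoint operators and their resolvents\<close>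

lemma selfadjointD:
  assumes "selfadjoint H"
  shows selfadjoint_unique: "(x, y) \<in> H \<Longrightarrow> (x, y') \<in> H \<Longrightarrow> y = y'"
    and selfadjoint_zero: "(0, 0) \<in> H"
    and selfadjoint_add: "(x, y) \<in> H \<Longrightarrow> (x', y') \<in> H \<Longrightarrow> (x + x', y + y') \<in> H"
    and selfadjoint_scaleC: "(x, y) \<in> H \<Longrightarrow> (c *\<^sub>C x, c *\<^sub>C y) \<in> H"
    and selfadjoint_diff: "(x, y) \<in> H \<Longrightarrow> (x', y') \<in> H \<Longrightarrow> (x - x', y - y') \<in> H"
    and selfadjoint_sym: "(x, y) \<in> H \<Longrightarrow> (u, v) \<in> H \<Longrightarrow> cinner u y = cinner v x"
    and selfadjoint_adj: "(\<And>x y. (x, y) \<in> H \<Longrightarrow> cinner u y = cinner v x) \<Longrightarrow> (u, v) \<in> H"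
    and selfadjoint_dense: "closure (Domain H) = UNIV"
proof -
  have sv: "single_valued H" and adj: "adjoint_graph H = H"
    and add: "\<And>x y x' y'. (x, y) \<in> H \<Longrightarrow> (x', y') \<in> H \<Longrightarrow> (x + x', y + y') \<in> H"
    and sc: "\<And>x y c. (x, y) \<in> H \<Longrightarrow> (c *\<^sub>C x, c *\<^sub>C y) \<in> H"
    using assms by (auto simp: selfadjoint_def linear_operator_def)
  show "(x, y) \<in> H \<Longrightarrow> (x, y') \<in> H \<Longrightarrow> y = y'"
    using sv by (auto dest: single_valuedD)
  show "(0, 0) \<in> H" "closure (Domain H) = UNIV"
    using assms by (auto simp: selfadjoint_def linear_operator_def)
  show "(x, y) \<in> H \<Longrightarrow> (x', y') \<in> H \<Longrightarrow> (x + x', y + y') \<in> H"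
    "(x, y) \<in> H \<Longrightarrow> (c *\<^sub>C x, c *\<^sub>C y) \<in> H"
    by (fact add sc)+
  show "(x - x', y - y') \<in> H" if "(x, y) \<in> H" "(x', y') \<in> H"
    using add[OF that(1) sc[OF that(2), of "- 1"]] by (simp add: scaleC_minus_one)
  show "(x, y) \<in> H \<Longrightarrow> (u, v) \<in> H \<Longrightarrow> cinner u y = cinner v x"
    using adj unfolding adjoint_graph_def by blast
  show "(u, v) \<in> H" if "\<And>x y. (x, y) \<in> H \<Longrightarrow> cinner u y = cinner v x"
  proof -
    have "(u, v) \<in> adjoint_graph H" using that by (auto simp: adjoint_graph_def)
    then show ?thesis using adj by simp
  qed
qed

text \<open>Adjoints are closed: the identity that defines membership passes to limits by continuity
  of the inner product.\<close>

lemma selfadjoint_closed: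
  assumes sa: "selfadjoint H" and mem: "\<And>n. (f n, g n) \<in> H"
    and lim: "f \<longlonglongrightarrow> x" "g \<longlonglongrightarrow> y"
  shows "(x, y) \<in> H"
proof (rule selfadjoint_adj[OF sa])
  fix u v assume uv: "(u, v) \<in> H"
  have "(\<lambda>n. cinner (f n) v) \<longlonglongrightarrow> cinner x v" "(\<lambda>n. cinner (g n) u) \<longlonglongrightarrow> cinner y u"
    by (intro tendsto_cinner lim tendsto_const)+
  moreover have "cinner (f n) v = cinner (g n) u" for n
    using selfadjoint_sym[OF sa uv mem] .
  ultimately show "cinner x v = cinner y u"
    using LIMSEQ_unique by simp
qed

text \<open>Reduction only provides some value of \<open>H\<close> at the projected vector that lies
  in \<open>M\<close>. To see that it is the projection of \<open>y\<close>, pair the discrepancy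
  with the dense domain: symmetry of \<open>H\<close> moves everything onto \<open>x - P x\<close>,
  which \<open>P\<close> annihilates.\<close>

lemma reduces_proj:
  fixes H :: "'h::chilbert_space operator"
  assumes sa: "selfadjoint H" and red: "reduces M H" and xy: "(x, y) \<in> H"
  shows "(proj_onto M x, proj_onto M y) \<in> H"
proof -
  have M: "closed_csubspace M" using red by (simp add: reduces_def)
  define P where "P = proj_onto M"
  note P = orthogonal_projectionD[OF orthogonal_projection_proj_onto[OF M], folded P_def]
  have ex: "\<exists>v\<in>M. (P u, v) \<in> H" if "(u, w) \<in> H" for u w
    using red that by (auto simp: reduces_def P_def)
  have PM: "P v = v" if "v \<in> M" for v
    using that by (simp add: P_def proj_onto_id[OF M])
  obtain v where v: "v \<in> M" "(P x, v) \<in> H" using ex[OF xy] by blast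
  have "P (y - v) = 0"
  proof (rule cinner_zero_dense[OF selfadjoint_dense[OF sa]])
    fix u assume "u \<in> Domain H"
    then obtain w where "w \<in> M" "(P u, w) \<in> H" using ex by blast
    then have "cinner (P u) (y - v) = cinner (P w) (x - P x)"
      using selfadjoint_sym[OF sa selfadjoint_diff[OF sa xy v(2)]] PM by simp
    also have "\<dots> = cinner w (P (x - P x))" by (simp add: P(3))
    also have "\<dots> = 0" by (simp add: clinear_diff[OF P(1)] P(2))
    finally show "cinner u (P (y - v)) = 0" by (simp add: P(3))
  qed
  then have "P y = v"
    using PM[OF v(1)] by (simp add: clinear_diff[OF P(1)])
  then show ?thesis using v(2) by (simp add: P_def)
qed

lemma reduces_range:
  fixes H :: "'h::chilbert_space operator"
  assumes "selfadjoint H" and "reduces M H" and "(x, y) \<in> H" and "x \<in> M"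
  shows "y \<in> M"
proof -
  have M: "closed_csubspace M" using assms by (simp add: reduces_def)
  have "(x, proj_onto M y) \<in> H"
    using reduces_proj[OF assms(1-3)] proj_onto_id[OF M assms(4)] by simp
  then have "y = proj_onto M y" by (rule selfadjoint_unique[OF assms(1,3)])
  then show ?thesis using proj_onto_mem[OF M, of y] by metis
qed

text \<open>Lets the next lemma serve both the resolvent of \<open>H\<close> itself and the
  restrictions of \<open>H\<close>.\<close>

lemma reduces_UNIV:
  fixes H :: "'h::chilbert_space operator"
  shows "reduces UNIV H"
proof -
  have "closed_csubspace (UNIV :: 'h set)" by (simp add: closed_csubspace_def)
  then show ?thesis by (auto simp: reduces_def proj_onto_id)
qed

text \<open>The lower bound and closedness of the graph make the range of \<open>H - z\<close> on
  \<open>M\<close> closed; a vector of \<open>M\<close> orthogonal to the range would be an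
  eigenvector for the conjugate of \<open>z\<close>, which \<open>ker\<close> excludes.\<close>

lemma bounded_below_imp_surj:
  fixes H :: "'h::chilbert_space operator"
  assumes sa: "selfadjoint H" and red: "reduces M H"
    and bound: "\<And>x w. (x, w) \<in> H \<Longrightarrow> x \<in> M \<Longrightarrow> norm x \<le> C * norm (w - z *\<^sub>C x)"
    and ker: "\<And>x. (x, cnj z *\<^sub>C x) \<in> H \<Longrightarrow> x \<in> M \<Longrightarrow> x = 0"
    and y: "y \<in> M"
  shows "\<exists>x\<in>M. (x, y + z *\<^sub>C x) \<in> H"
proof -
  have M: "closed_csubspace M" using red by (simp add: reduces_def)
  note MD = closed_csubspaceD[OF M]
  define P where "P = proj_onto M"
  note P = orthogonal_projectionD[OF orthogonal_projection_proj_onto[OF M], folded P_def]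
  define S where "S = {w - z *\<^sub>C x | x w. (x, w) \<in> H \<and> x \<in> M}"
  have SM: "S \<subseteq> M"
    using reduces_range[OF sa red] MD by (auto simp: S_def)
  have S: "closed_csubspace S"
    unfolding closed_csubspace_def
  proof (intro conjI ballI allI)
    show "0 \<in> S"
      using selfadjoint_zero[OF sa] MD(1) unfolding S_def
      by (auto intro!: exI[of _ 0])
    fix a b c assume "a \<in> S" "b \<in> S"
    then obtain x w x' w' where 1: "(x, w) \<in> H" "x \<in> M" "a = w - z *\<^sub>C x"
      and 2: "(x', w') \<in> H" "x' \<in> M" "b = w' - z *\<^sub>C x'"
      by (auto simp: S_def)
    have "a + b = (w + w') - z *\<^sub>C (x + x')"
      by (simp add: 1 2 scaleC_add_right)
    then show "a + b \<in> S"
      unfolding S_def using selfadjoint_add[OF sa 1(1) 2(1)] MD(2)[OF 1(2) 2(2)] by blast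
    have "c *\<^sub>C a = (c *\<^sub>C w) - z *\<^sub>C (c *\<^sub>C x)"
      by (simp add: 1 scaleC_diff_right scaleC_scaleC mult.commute)
    then show "c *\<^sub>C a \<in> S"
      unfolding S_def using selfadjoint_scaleC[OF sa 1(1)] MD(3)[OF 1(2)] by blast
  next
    show "closed S"
      unfolding closed_sequential_limits
    proof (intro allI impI)
      fix r l assume rl: "(\<forall>n. r n \<in> S) \<and> r \<longlonglongrightarrow> l"
      then have "\<forall>n. \<exists>x w. (x, w) \<in> H \<and> x \<in> M \<and> r n = w - z *\<^sub>C x"
        unfolding S_def by blast
      then obtain f g where fg: "\<And>n. (f n, g n) \<in> H" "\<And>n. f n \<in> M" "\<And>n. r n = g n - z *\<^sub>C f n"
        by metis
      have fd: "norm (f m - f n) \<le> C * norm (r m - r n)" for m n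
      proof -
        have "norm (f m - f n) \<le> C * norm ((g m - g n) - z *\<^sub>C (f m - f n))"
          by (intro bound selfadjoint_diff[OF sa] fg MD(4))
        also have "(g m - g n) - z *\<^sub>C (f m - f n) = r m - r n"
          by (simp add: fg(3) scaleC_diff_right)
        finally show ?thesis .
      qed
      have "Cauchy r" using rl LIMSEQ_imp_Cauchy by blast
      have "Cauchy f"
      proof (rule CauchyI)
        fix e :: real assume e: "e > 0"
        obtain N where N: "\<And>m n. m \<ge> N \<Longrightarrow> n \<ge> N \<Longrightarrow> norm (r m - r n) < e / (\<bar>C\<bar> + 1)"
          using CauchyD[OF \<open>Cauchy r\<close>, of "e / (\<bar>C\<bar> + 1)"] e by auto
        have "norm (f m - f n) < e" if "m \<ge> N" "n \<ge> N" for m n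
        proof -
          have "norm (f m - f n) \<le> (\<bar>C\<bar> + 1) * norm (r m - r n)"
            using fd[of m n] by (rule order_trans) (intro mult_right_mono, auto)
          also have "\<dots> < e"
            using N[OF that] by (simp add: field_simps)
          finally show ?thesis .
        qed
        then show "\<exists>N. \<forall>m\<ge>N. \<forall>n\<ge>N. norm (f m - f n) < e" by blast
      qed
      then obtain x where x: "f \<longlonglongrightarrow> x" by (meson Cauchy_convergent convergentD)
      have "(\<lambda>n. r n + z *\<^sub>C f n) \<longlonglongrightarrow> l + z *\<^sub>C x"
        using rl x by (intro tendsto_add tendsto_scaleC) auto
      then have "g \<longlonglongrightarrow> l + z *\<^sub>C x" by (simp add: fg(3))
      then have "(x, l + z *\<^sub>C x) \<in> H" by (rule selfadjoint_closed[OF sa fg(1) x])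
      moreover have "x \<in> M" using MD(5) fg(2) x closed_sequentially by blast
      moreover have "l = (l + z *\<^sub>C x) - z *\<^sub>C x" by simp
      ultimately show "l \<in> S" unfolding S_def by blast
    qed
  qed
  define v where "v = y - proj_onto S y"
  have vM: "v \<in> M" using MD(4)[OF y] proj_onto_mem[OF S] SM by (auto simp: v_def)
  have vS: "cinner r v = 0" if "r \<in> S" for r
    using proj_onto_orthogonal[OF S that] by (simp add: v_def)
  have "(v, cnj z *\<^sub>C v) \<in> H"
  proof (rule selfadjoint_adj[OF sa])
    fix u w assume uw: "(u, w) \<in> H"
    \<comment> \<open>Testing against the whole domain, with each test vector projected into
      \<open>M\<close>, places \<open>v\<close> in the domain of \<open>H\<close> itself.\<close>
    have "P w - z *\<^sub>C P u \<in> S"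
      using reduces_proj[OF sa red uw] proj_onto_mem[OF M] by (auto simp: S_def P_def)
    from vS[OF this] have "cinner (P (w - z *\<^sub>C u)) v = 0"
      by (simp add: clinear_diff[OF P(1)] clinear_scaleC[OF P(1)])
    then have "cinner (w - z *\<^sub>C u) v = 0"
      using proj_onto_id[OF M vM] by (simp add: P(3)) (simp add: P_def)
    then have "cinner v (w - z *\<^sub>C u) = 0"
      by (subst cinner_commute) simp
    then show "cinner v w = cinner (cnj z *\<^sub>C v) u"
      by (simp add: cinner_simps)
  qed
  then have "v = 0" using ker vM by blast
  then have "y \<in> S" using proj_onto_mem[OF S, of y] by (simp add: v_def)
  then obtain x w where "(x, w) \<in> H" "x \<in> M" "y = w - z *\<^sub>C x" by (auto simp: S_def)
  then show ?thesis by (intro bexI[of _ x]) auto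
qed

text \<open>By symmetry \<open><x, H x>\<close> is real, so the imaginary part of
  \<open><x, (H - z) x>\<close> is \<open>- Im z\<close> times the squared norm.\<close>

lemma Im_bound:
  assumes sa: "selfadjoint H" and xw: "(x, w) \<in> H"
  shows "\<bar>Im z\<bar> * norm x \<le> norm (w - z *\<^sub>C x)"
proof (cases "x = 0")
  case False
  have "cinner x w = cnj (cinner x w)"
    using selfadjoint_sym[OF sa xw xw] cinner_commute[of x w] by simp
  then have "Im (cinner x w) = 0" by (simp add: complex_eq_iff)
  then have "Im (cinner x (w - z *\<^sub>C x)) = - Im z * (norm x)\<^sup>2"
    by (simp add: cinner_simps cinner_self)
  then have "\<bar>Im z\<bar> * (norm x)\<^sup>2 \<le> norm (cinner x (w - z *\<^sub>C x))"
    using abs_Im_le_cmod[of "cinner x (w - z *\<^sub>C x)"] by (simp add: abs_mult)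
  also have "\<dots> \<le> norm x * norm (w - z *\<^sub>C x)" by (rule cinner_cauchy_schwarz)
  finally show ?thesis using False by (simp add: power2_eq_square)
qed simp

lemma nonreal_eigenvector_zero:
  assumes sa: "selfadjoint H" and z: "Im z \<noteq> 0" and x: "(x, z *\<^sub>C x) \<in> H"
  shows "x = 0"
  using Im_bound[OF sa x, of z] z by (simp add: mult_le_0_iff)

lemma resolvent_eqI:
  assumes sa: "selfadjoint H" and z: "Im z \<noteq> 0" and x: "(x, y + z *\<^sub>C x) \<in> H"
  shows "resolvent H z y = x"
  unfolding resolvent_def
proof (rule the_equality)
  show "(x, y + z *\<^sub>C x) \<in> H" by (rule x)
  fix x' assume "(x', y + z *\<^sub>C x') \<in> H"
  from selfadjoint_diff[OF sa this x] have "(x' - x, z *\<^sub>C (x' - x)) \<in> H"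
    by (simp add: scaleC_diff_right)
  then show "x' = x" using nonreal_eigenvector_zero[OF sa z] by fastforce
qed

lemma resolvent_mem:
  fixes H :: "'h::chilbert_space operator"
  assumes sa: "selfadjoint H" and z: "Im z \<noteq> 0"
  shows "(resolvent H z y, y + z *\<^sub>C resolvent H z y) \<in> H"
proof -
  have "\<exists>x\<in>UNIV. (x, y + z *\<^sub>C x) \<in> H"
  proof (rule bounded_below_imp_surj[OF sa reduces_UNIV])
    show "norm x \<le> (1 / \<bar>Im z\<bar>) * norm (w - z *\<^sub>C x)" if "(x, w) \<in> H" for x w
      using Im_bound[OF sa that, of z] z by (simp add: field_simps)
    show "x = 0" if "(x, cnj z *\<^sub>C x) \<in> H" for x
      using nonreal_eigenvector_zero[OF sa _ that] z by simp
  qed simp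
  then show ?thesis using resolvent_eqI[OF sa z] by auto
qed

context
  fixes H :: "'h::chilbert_space operator"
  assumes sa: "selfadjoint H"
begin

lemma clinear_resolvent: "Im z \<noteq> 0 \<Longrightarrow> clinear (resolvent H z)"
  unfolding clinear_def
proof (intro conjI allI)
  fix x y c assume z: "Im z \<noteq> 0"
  note mem = resolvent_mem[OF sa z]
  show "resolvent H z (x + y) = resolvent H z x + resolvent H z y"
    using selfadjoint_add[OF sa mem mem, of x y]
    by (intro resolvent_eqI[OF sa z]) (simp add: scaleC_add_right algebra_simps)
  show "resolvent H z (c *\<^sub>C x) = c *\<^sub>C resolvent H z x"
    using selfadjoint_scaleC[OF sa mem, of c x]
    by (intro resolvent_eqI[OF sa z]) (simp add: scaleC_add_right scaleC_scaleC mult.commute)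
qed

lemma norm_resolvent: "Im z \<noteq> 0 \<Longrightarrow> norm (resolvent H z y) \<le> norm y / \<bar>Im z\<bar>"
  using Im_bound[OF sa resolvent_mem[OF sa, of z y], of z] by (simp add: field_simps)

lemma resolvent_adjoint:
  assumes "Im z \<noteq> 0"
  shows "cinner x (resolvent H z y) = cinner (resolvent H (cnj z) x) y"
  using selfadjoint_sym[OF sa resolvent_mem[OF sa assms, of y] resolvent_mem[OF sa, of "cnj z" x]] assms
  by (simp add: cinner_simps)

lemma resolvent_identity:
  assumes "Im z \<noteq> 0" "Im w \<noteq> 0"
  shows "resolvent H z y - resolvent H w y = (z - w) *\<^sub>C resolvent H z (resolvent H w y)"
proof -
  define b c where "b = resolvent H w y" and "c = resolvent H z b"
  have b: "(b, y + w *\<^sub>C b) \<in> H" and c: "(c, b + z *\<^sub>C c) \<in> H"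
    unfolding b_def c_def using resolvent_mem[OF sa] assms by auto
  have "(b + (z - w) *\<^sub>C c, (y + w *\<^sub>C b) + (z - w) *\<^sub>C (b + z *\<^sub>C c)) \<in> H"
    by (intro selfadjoint_add[OF sa] selfadjoint_scaleC[OF sa] b c)
  also have "(y + w *\<^sub>C b) + (z - w) *\<^sub>C (b + z *\<^sub>C c) = y + z *\<^sub>C (b + (z - w) *\<^sub>C c)"
    by (simp add: scaleC_add_right scaleC_diff_left scaleC_diff_right scaleC_scaleC
        right_diff_distrib mult.commute)
  finally have "resolvent H z y = b + (z - w) *\<^sub>C c"
    by (rule resolvent_eqI[OF sa assms(1)])
  then show ?thesis by (simp add: b_def c_def)
qed

text \<open>Approaching along a horizontal line keeps the resolvents uniformly bounded by
  \<open>1 / |Im z|\<close>; the resolvent identity then gives a linear rate.\<close>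

lemma resolvent_tendsto:
  assumes z: "Im z \<noteq> 0" and lim: "w \<longlonglongrightarrow> z" and w: "\<And>n. Im (w n) = Im z"
  shows "(\<lambda>n. resolvent H (w n) y) \<longlonglongrightarrow> resolvent H z y"
proof -
  define K where "K = norm (resolvent H z y) / \<bar>Im z\<bar>"
  have "(\<lambda>n. norm (w n - z) * K) \<longlonglongrightarrow> 0 * K"
    using lim by (intro tendsto_mult tendsto_const tendsto_norm_zero) (simp add: LIM_zero)
  then have lim0: "(\<lambda>n. norm (w n - z) * K) \<longlonglongrightarrow> 0" by simp
  have le: "norm (resolvent H (w n) y - resolvent H z y) \<le> norm (w n - z) * K" for n
    using norm_resolvent[of "w n" "resolvent H z y"] z w[of n]
    by (simp add: resolvent_identity norm_scaleC K_def mult_left_mono del: times_divide_eq_right)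
  show ?thesis
    by (rule LIM_zero_cancel, rule Lim_null_comparison[OF always_eventually[OF allI[OF le]] lim0])
qed

end

section \<open>The Cayley transform\<close>

text \<open>The inverse, which is also the adjoint, is carried along as a second function. Words in
  both can then be formed without the descriptions behind \<open>inv\<close> and
  \<open>cadjoint\<close>.\<close>

definition unitary_pair :: "('h::complex_inner \<Rightarrow> 'h) \<Rightarrow> ('h \<Rightarrow> 'h) \<Rightarrow> bool" where
  "unitary_pair U V \<longleftrightarrow> clinear U \<and> clinear V \<and> (\<forall>x. U (V x) = x) \<and> (\<forall>x. V (U x) = x) \<and>
     (\<forall>x y. cinner x (U y) = cinner (V x) y)"

text \<open>This is \<open>(H - \<i>) (H + \<i>)^-1\<close>, rewritten as
  \<open>1 - 2 \<i> (H + \<i>)^-1\<close> so that it is a bounded everywhere defined function. The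
  inverse below is treated in the same way.\<close>

definition cayley :: "'h::complex_inner operator \<Rightarrow> 'h \<Rightarrow> 'h" where
  "cayley H y = y - (2 * \<i>) *\<^sub>C resolvent H (- \<i>) y"

definition cayley_inv :: "'h::complex_inner operator \<Rightarrow> 'h \<Rightarrow> 'h" where
  "cayley_inv H y = y + (2 * \<i>) *\<^sub>C resolvent H \<i> y"

lemma unitary_pairD:
  assumes "unitary_pair U V"
  shows "clinear U" "clinear V" "U (V x) = x" "V (U x) = x" "cinner x (U y) = cinner (V x) y"
    "cinner (U x) y = cinner x (V y)" "norm (U x) = norm x" "norm (V x) = norm x"
proof -
  show 1: "clinear U" "clinear V" "U (V x) = x" "V (U x) = x" "cinner x (U y) = cinner (V x) y" for x y
    using assms by (auto simp: unitary_pair_def)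
  show 2: "cinner (U x) y = cinner x (V y)" for x y
    using 1(5)[of y x] by (metis cinner_commute)
  have "complex_of_real ((norm (U x))\<^sup>2) = of_real ((norm x)\<^sup>2)" for x
    unfolding cinner_self[symmetric] by (simp add: 1 2)
  then show n: "norm (U x) = norm x" for x
    by (metis of_real_eq_iff norm_ge_zero power2_eq_iff_nonneg)
  show "norm (V x) = norm x" using n[of "V x"] by (simp add: 1)
qed

text \<open>In both compositions the terms linear in the resolvents cancel the quadratic one by the
  resolvent identity for \<open>\<i>\<close> and \<open>- \<i>\<close>.\<close>

lemma unitary_pair_cayley:
  fixes H :: "'h::chilbert_space operator"
  assumes sa: "selfadjoint H"
  shows "unitary_pair (cayley H) (cayley_inv H)"
proof -
  define R S where "R = resolvent H (- \<i>)" and "S = resolvent H \<i>"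
  have lin: "clinear R" "clinear S"
    unfolding R_def S_def by (auto intro!: clinear_resolvent[OF sa])
  note ls = clinear_add[OF lin(1)] clinear_add[OF lin(2)] clinear_diff[OF lin(1)]
    clinear_diff[OF lin(2)] clinear_scaleC[OF lin(1)] clinear_scaleC[OF lin(2)]
  have RS: "R y - S y = (- 2 * \<i>) *\<^sub>C R (S y)" and SR: "S y - R y = (2 * \<i>) *\<^sub>C S (R y)" for y
    using resolvent_identity[OF sa, of "- \<i>" \<i> y] resolvent_identity[OF sa, of \<i> "- \<i>" y]
    by (simp_all add: R_def S_def)
  have "cayley H (cayley_inv H y) = y - (2 * \<i>) *\<^sub>C (R y - S y) - ((2 * \<i>) * (2 * \<i>)) *\<^sub>C R (S y)" for y
    by (simp add: cayley_def cayley_inv_def R_def[symmetric] S_def[symmetric] ls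
        scaleC_add_right scaleC_diff_right scaleC_scaleC)
  then have UV: "cayley H (cayley_inv H y) = y" for y
    by (simp only: RS scaleC_scaleC) (simp add: scaleC_minus_left)
  have "cayley_inv H (cayley H y) = y + (2 * \<i>) *\<^sub>C (S y - R y) - ((2 * \<i>) * (2 * \<i>)) *\<^sub>C S (R y)" for y
    by (simp add: cayley_def cayley_inv_def R_def[symmetric] S_def[symmetric] ls
        scaleC_add_right scaleC_diff_right scaleC_scaleC)
  then have VU: "cayley_inv H (cayley H y) = y" for y
    by (simp only: SR scaleC_scaleC) simp
  have "cinner x (cayley H y) = cinner (cayley_inv H x) y" for x y
    using resolvent_adjoint[OF sa, of "- \<i>" x y]
    by (simp add: cayley_def cayley_inv_def cinner_simps)
  moreover have "clinear (cayley H)" "clinear (cayley_inv H)"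
    unfolding clinear_def cayley_def cayley_inv_def R_def[symmetric] S_def[symmetric]
    by (simp_all add: ls scaleC_add_right scaleC_diff_right scaleC_scaleC algebra_simps)
  ultimately show ?thesis using UV VU by (simp add: unitary_pair_def)
qed

section \<open>Projection valued measures\<close>

lemma cinner_ext:
  assumes "\<And>u. cinner u a = cinner u b"
  shows "a = b"
  using assms[of "a - b"] cinner_self_eq_0[of "a - b"] by (simp add: cinner_diff_right)

lemma clinear_bounded_linear:
  assumes "clinear F" and "\<And>x. norm (F x) \<le> C * norm x"
  shows "bounded_linear F"
proof (rule bounded_linear_intro[where K = C])
  show "F (r *\<^sub>R x) = r *\<^sub>R F x" for r x
    using clinear_scaleC[OF assms(1), of "of_real r" x] by (simp add: scaleC_of_real)
qed (use assms in \<open>auto simp: clinear_add mult.commute\<close>)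

lemma pvmD:
  assumes "projection_valued_measure E"
  shows pvm_proj: "A \<in> sets borel \<Longrightarrow> orthogonal_projection (E A)"
    and pvm_UNIV: "E UNIV x = x"
    and pvm_sums: "range B \<subseteq> sets borel \<Longrightarrow> disjoint_family B \<Longrightarrow> (\<lambda>n. E (B n) x) sums E (\<Union>n. B n) x"
  using assms by (auto simp: projection_valued_measure_def)

context
  fixes E :: "real set \<Rightarrow> 'h::complex_inner \<Rightarrow> 'h"
  assumes pvm: "projection_valued_measure E"
begin

text \<open>The empty set is the disjoint union of infinitely many copies of itself, so a constant
  series converges.\<close>

lemma pvm_empty: "E {} x = 0"
proof -
  have "(\<lambda>n::nat. E {} x) sums E (\<Union>n::nat. {}) x"
    using pvm_sums[OF pvm, of "\<lambda>_. {}"] by (simp add: disjoint_family_on_def)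
  then have "(\<lambda>n::nat. E {} x) \<longlonglongrightarrow> 0"
    using summable_LIMSEQ_zero sums_summable by blast
  then show ?thesis by (simp add: LIMSEQ_const_iff)
qed

lemma pvm_union:
  assumes "A \<in> sets borel" "B \<in> sets borel" "A \<inter> B = {}"
  shows "E (A \<union> B) x = E A x + E B x"
proof -
  have "(\<lambda>n. E (binaryset A B n) x) sums E (\<Union>n. binaryset A B n) x"
    using assms by (intro pvm_sums[OF pvm])
      (auto simp: range_binaryset_eq disjoint_family_on_def binaryset_def)
  moreover have "(\<lambda>n. E (binaryset A B n) x) sums (E A x + E B x)"
    by (rule binaryset_sums) (rule pvm_empty)
  ultimately show ?thesis
    using sums_unique2 by (metis UN_binaryset_eq)
qed

lemma pvm_compl: "A \<in> sets borel \<Longrightarrow> E (- A) x = x - E A x"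
  using pvm_union[of A "- A" x] pvm_UNIV[OF pvm, of x] by (simp add: Compl_partition algebra_simps)

text \<open>Multiplicativity is not part of the definition and comes from norms: for
  \<open>y\<close> in the range of \<open>E B\<close>, additivity makes
  \<open>|E (A \<union> B) y|^2\<close> equal to \<open>|E A y|^2 + |y|^2\<close>, while a
  projection cannot exceed \<open>|y|^2\<close>.\<close>

lemma pvm_disjoint:
  assumes A: "A \<in> sets borel" and B: "B \<in> sets borel" and disj: "A \<inter> B = {}"
  shows "E A (E B x) = 0"
proof -
  note PA = orthogonal_projectionD[OF pvm_proj[OF pvm A]] and PB = orthogonal_projectionD[OF pvm_proj[OF pvm B]]
  have AB: "A \<union> B \<in> sets borel" using A B by simp
  note PAB = orthogonal_projectionD[OF pvm_proj[OF pvm AB]]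
  define y where "y = E B x"
  have By: "E B y = y" by (simp add: y_def PB)
  have "Re (cinner y (E (A \<union> B) y)) = Re (cinner y (E A y)) + Re (cinner y (E B y))"
    by (simp add: pvm_union[OF A B disj] cinner_add_right)
  then have "(norm (E (A \<union> B) y))\<^sup>2 = (norm (E A y))\<^sup>2 + (norm y)\<^sup>2"
    unfolding PA(6) PB(6) PAB(6) unfolding By .
  moreover have "(norm (E (A \<union> B) y))\<^sup>2 \<le> (norm y)\<^sup>2"
    using PAB(5) by (intro power_mono) auto
  ultimately have "(norm (E A y))\<^sup>2 \<le> 0" by simp
  then show ?thesis by (simp add: y_def)
qed

lemma pvm_Int:
  assumes A: "A \<in> sets borel" and B: "B \<in> sets borel"
  shows "E A (E B x) = E (A \<inter> B) x"
proof -
  have "A \<inter> B \<in> sets borel" "A - B \<in> sets borel" "B - A \<in> sets borel" using A B by auto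
  note S = this
  have "E A (E B x) = E (A \<inter> B \<union> (A - B)) (E B x)"
    by (simp add: Int_Diff_Un)
  also have "\<dots> = E (A \<inter> B) (E B x)"
    using pvm_disjoint[OF S(2) B, of x] by (subst pvm_union[OF S(1,2)]) auto
  also have "E (A \<inter> B) (E B x) = E (A \<inter> B) x"
  proof -
    have "B = A \<inter> B \<union> (B - A)" by blast
    then have "E B x = E (A \<inter> B) x + E (B - A) x"
      using pvm_union[OF S(1,3), of x] by auto
    moreover have "E (A \<inter> B) (E (B - A) x) = 0" by (rule pvm_disjoint[OF S(1,3)]) blast
    ultimately show ?thesis
      using orthogonal_projectionD(1,2)[OF pvm_proj[OF pvm S(1)]] by (simp add: clinear_add)
  qed
  finally show ?thesis .
qed

lemma sets_scalar [simp, measurable_cong]: "sets (scalar_spectral_measure E x) = sets borel"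
  using sets.sigma_sets_eq[of "borel :: real measure"] by (simp add: scalar_spectral_measure_def)

lemma space_scalar [simp]: "space (scalar_spectral_measure E x) = UNIV"
  by (simp add: scalar_spectral_measure_def)

lemma emeasure_scalar:
  assumes "A \<in> sets borel"
  shows "emeasure (scalar_spectral_measure E x) A = ennreal ((norm (E A x))\<^sup>2)"
proof -
  have nn: "Re (cinner x (E A x)) = (norm (E A x))\<^sup>2" if "A \<in> sets borel" for A
    using orthogonal_projectionD(6)[OF pvm_proj[OF pvm that]] .
  have "sigma_algebra UNIV (sets (borel :: real measure))"
    using sets.sigma_algebra_axioms[of "borel :: real measure"] by simp
  moreover have "positive (sets borel) (\<lambda>A. ennreal (Re (cinner x (E A x))))"
    by (simp add: positive_def pvm_empty)
  moreover have "countably_additive (sets borel) (\<lambda>A. ennreal (Re (cinner x (E A x))))"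
  proof (rule countably_additiveI)
    fix B :: "nat \<Rightarrow> real set"
    assume B: "range B \<subseteq> sets borel" "disjoint_family B"
    have "(\<lambda>n. inner x (E (B n) x)) sums inner x (E (\<Union>n. B n) x)"
      by (rule bounded_linear.sums[OF bounded_linear_inner_right pvm_sums[OF pvm B]])
    moreover have "0 \<le> inner x (E (B n) x)" for n
      using nn[of "B n"] B by (auto simp: Re_cinner)
    ultimately show "(\<Sum>n. ennreal (Re (cinner x (E (B n) x)))) = ennreal (Re (cinner x (E (\<Union> (range B)) x)))"
      unfolding Re_cinner by (intro suminf_ennreal_eq)
  qed
  ultimately show ?thesis
    unfolding scalar_spectral_measure_def
    by (subst emeasure_measure_of_sigma) (auto simp: assms nn)
qed

lemma finite_measure_scalar: "finite_measure (scalar_spectral_measure E x)"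
  by (rule finite_measureI) (simp add: emeasure_scalar)

lemma measure_scalar: "A \<in> sets borel \<Longrightarrow> measure (scalar_spectral_measure E x) A = (norm (E A x))\<^sup>2"
  by (simp add: measure_def emeasure_scalar)

text \<open>Splitting a vector by \<open>E B\<close> thereby becomes splitting an integral over
  \<open>B\<close> and its complement, the mechanism behind the commutation results below.\<close>

lemma scalar_projection:
  assumes B: "B \<in> sets borel"
  shows "scalar_spectral_measure E (E B x) = density (scalar_spectral_measure E x) (\<lambda>t. ennreal (indicator B t))"
proof (rule measure_eqI)
  fix A assume "A \<in> sets (scalar_spectral_measure E (E B x))"
  then have A: "A \<in> sets borel" by simp
  show "emeasure (scalar_spectral_measure E (E B x)) A =
      emeasure (density (scalar_spectral_measure E x) (\<lambda>t. ennreal (indicator B t))) A"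
    using A B by (simp add: emeasure_scalar pvm_Int ennreal_indicator emeasure_restricted Int_commute)
qed simp

lemma scalar_projection_integral:
  fixes f :: "real \<Rightarrow> real"
  assumes B: "B \<in> sets borel" and f: "f \<in> borel_measurable borel"
  shows "integrable (scalar_spectral_measure E (E B x)) f \<longleftrightarrow>
      integrable (scalar_spectral_measure E x) (\<lambda>t. indicator B t * f t)"
    and "integral\<^sup>L (scalar_spectral_measure E (E B x)) f =
      (\<integral>t. indicator B t * f t \<partial>scalar_spectral_measure E x)"
  unfolding scalar_projection[OF B] using B f
  by (subst integrable_density integral_density; auto)+

lemma AE_scalar:
  assumes B: "B \<in> sets borel" and x: "E B x = x"
  shows "AE t in scalar_spectral_measure E x. t \<in> B"
proof (rule AE_I[where N = "- B"])
  show "emeasure (scalar_spectral_measure E x) (- B) = 0"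
    using B x by (simp add: emeasure_scalar pvm_compl)
qed (use B in auto)

lemma measure_scalar_UNIV: "measure (scalar_spectral_measure E x) UNIV = (norm x)\<^sup>2"
  by (simp add: measure_scalar pvm_UNIV[OF pvm])

end

lemma unitary_pair_of_unitary:
  assumes "unitary U"
  shows "unitary_pair U (inv U)"
proof -
  have lin: "clinear U" and sj: "surj U" and iso: "\<And>x y. cinner (U x) (U y) = cinner x y"
    using assms by (auto simp: unitary_def)
  have UV: "U (inv U x) = x" for x using sj by (simp add: surj_f_inv_f)
  have adj: "cinner x (U y) = cinner (inv U x) y" for x y
    using iso[of "inv U x" y] by (simp add: UV)
  have "inv U (U x) = x" for x
  proof (rule cinner_ext)
    show "cinner u (inv U (U x)) = cinner u x" for u
      using iso[of u "inv U (U x)"] iso[of u x] by (simp add: UV)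
  qed
  moreover have "clinear (inv U)"
    unfolding clinear_def
  proof (intro conjI allI; rule cinner_ext)
    show "cinner u (inv U (x + y)) = cinner u (inv U x + inv U y)" for u x y
      unfolding cinner_add_right by (metis UV adj iso cinner_add_right)
    show "cinner u (inv U (c *\<^sub>C x)) = cinner u (c *\<^sub>C inv U x)" for u c x
      unfolding cinner_scaleC_right by (metis UV adj iso cinner_scaleC_right)
  qed
  ultimately show ?thesis using lin UV adj by (simp add: unitary_pair_def)
qed

lemma cadjoint_unitary_pair:
  assumes "unitary_pair U V"
  shows "cadjoint U = V"
  unfolding cadjoint_def
proof (rule the_equality)
  show "\<forall>x y. cinner (V x) y = cinner x (U y)" using unitary_pairD[OF assms] by simp
  fix B assume B: "\<forall>x y. cinner (B x) y = cinner x (U y)"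
  show "B = V"
  proof
    fix x show "B x = V x"
      by (rule cinner_ext) (metis B cinner_commute unitary_pairD(5)[OF assms])
  qed
qed

section \<open>Spectral resolutions\<close>

context
  fixes H :: "'h::complex_inner operator" and E :: "real set \<Rightarrow> 'h \<Rightarrow> 'h"
  assumes sa: "selfadjoint H" and res: "spectral_resolution H E"
begin

lemma resolution_pvm: "projection_valued_measure E"
  using res by (simp add: spectral_resolution_def)

lemma resolution_domain: "x \<in> Domain H \<longleftrightarrow> integrable (scalar_spectral_measure E x) (\<lambda>t. t\<^sup>2)"
  using res by (simp add: spectral_resolution_def)

lemma resolution_form: "(x, y) \<in> H \<Longrightarrow> cinner x y = of_real (\<integral>t. t \<partial>scalar_spectral_measure E x)"
  using res by (auto simp: spectral_resolution_def)

lemma resolution_integrable: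
  assumes "(x, y) \<in> H"
  shows "integrable (scalar_spectral_measure E x) (\<lambda>t. t)"
proof (rule Bochner_Integration.integrable_bound)
  interpret finite_measure "scalar_spectral_measure E x" by (rule finite_measure_scalar[OF resolution_pvm])
  show "integrable (scalar_spectral_measure E x) (\<lambda>t. 1 + t\<^sup>2)"
    using iffD1[OF resolution_domain, of x] assms by (auto intro!: Bochner_Integration.integrable_add)
  have "\<bar>t\<bar> \<le> 1 + t\<^sup>2" for t :: real
    using sum_squares_bound[of 1 "\<bar>t\<bar>"] by simp
  then show "AE t in scalar_spectral_measure E x. norm t \<le> norm (1 + t\<^sup>2)"
    by simp
qed (simp add: sets_scalar[OF resolution_pvm] cong: measurable_cong_sets)

lemma resolution_domain_proj:
  assumes B: "B \<in> sets borel" and x: "x \<in> Domain H"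
  shows "E B x \<in> Domain H"
proof -
  have int: "integrable (scalar_spectral_measure E x) (\<lambda>t. t\<^sup>2)"
    using x unfolding resolution_domain .
  have "integrable (scalar_spectral_measure E x) (\<lambda>t. indicator B t * t\<^sup>2)"
    using integrable_real_mult_indicator[OF _ int, of B] B
    by (simp add: sets_scalar[OF resolution_pvm] mult.commute)
  then show ?thesis
    unfolding resolution_domain by (subst scalar_projection_integral(1)[OF resolution_pvm B]) simp_all
qed

text \<open>The resolution controls only the quadratic form of \<open>H\<close>. Evaluated at
  \<open>u + c w\<close>, its integral splits over \<open>B\<close> and the complement into the
  forms at \<open>u\<close> and at \<open>c w\<close>, so the mixed terms must cancel for every
  \<open>c\<close>.\<close>

lemma resolution_orthogonal:
  assumes B: "B \<in> sets borel" and u: "(u, hu) \<in> H" "E B u = u" and w: "(w, hw) \<in> H" "E B w = 0"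
  shows "cinner w hu = 0"
proof -
  note P = orthogonal_projectionD[OF pvm_proj[OF resolution_pvm B]]
  have B': "- B \<in> sets borel" using B by auto
  have eq: "cinner u (c *\<^sub>C hw) + cinner (c *\<^sub>C w) hu = 0" for c
  proof -
    define v where "v = u + c *\<^sub>C w"
    let ?m = "scalar_spectral_measure E v"
    have v: "(v, hu + c *\<^sub>C hw) \<in> H" and cw: "(c *\<^sub>C w, c *\<^sub>C hw) \<in> H"
      unfolding v_def by (intro selfadjoint_add[OF sa] selfadjoint_scaleC[OF sa] u w)+
    have Bv: "E B v = u" and B'v: "E (- B) v = c *\<^sub>C w"
      using u w by (simp_all add: v_def clinear_add[OF P(1)] clinear_scaleC[OF P(1)]
          pvm_compl[OF resolution_pvm B])
    have int: "integrable ?m (\<lambda>t. indicator A t * t)" if "A \<in> sets borel" for A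
      using integrable_real_mult_indicator[OF _ resolution_integrable[OF v], of A] that
      by (simp add: sets_scalar[OF resolution_pvm] mult.commute)
    have "(\<integral>t. t \<partial>?m) = (\<integral>t. indicator B t * t + indicator (- B) t * t \<partial>?m)"
      by (intro Bochner_Integration.integral_cong) (auto simp: indicator_def)
    also have "\<dots> = (\<integral>t. indicator B t * t \<partial>?m) + (\<integral>t. indicator (- B) t * t \<partial>?m)"
      by (intro Bochner_Integration.integral_add int B B')
    also have "\<dots> = (\<integral>t. t \<partial>scalar_spectral_measure E u) + (\<integral>t. t \<partial>scalar_spectral_measure E (c *\<^sub>C w))"
      using scalar_projection_integral(2)[OF resolution_pvm B, of "\<lambda>t. t" v]
        scalar_projection_integral(2)[OF resolution_pvm B', of "\<lambda>t. t" v]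
      by (simp add: Bv B'v)
    finally have "cinner v (hu + c *\<^sub>C hw) = cinner u hu + cinner (c *\<^sub>C w) (c *\<^sub>C hw)"
      unfolding resolution_form[OF v] resolution_form[OF u(1)] resolution_form[OF cw] by simp
    then show ?thesis by (simp add: v_def cinner_simps algebra_simps)
  qed
  \<comment> \<open>The choices \<open>c = 1\<close> and \<open>c = \<i>\<close> give the sum and
    the difference of the two mixed terms.\<close>
  from eq[of 1] have 1: "cinner u hw = - cinner w hu" by (simp add: eq_neg_iff_add_eq_0)
  from eq[of \<i>] show ?thesis by (simp add: cinner_simps 1)
qed

text \<open>For \<open>w\<close> in the domain the complementary part \<open>w - E B w\<close> is
  again in the domain, and the previous lemma makes it orthogonal to \<open>hu\<close>; density of
  the domain finishes.\<close>

lemma resolution_invariant: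
  assumes B: "B \<in> sets borel" and u: "(u, hu) \<in> H" "E B u = u"
  shows "E B hu = hu"
proof -
  note P = orthogonal_projectionD[OF pvm_proj[OF resolution_pvm B]]
  have "hu - E B hu = 0"
  proof (rule cinner_zero_dense[OF selfadjoint_dense[OF sa]])
    fix w assume w: "w \<in> Domain H"
    then obtain hw hw' where "(w, hw) \<in> H" "(E B w, hw') \<in> H"
      using resolution_domain_proj[OF B w] by auto
    from selfadjoint_diff[OF sa this] have "cinner (w - E B w) hu = 0"
      by (rule resolution_orthogonal[OF B u]) (simp add: clinear_diff[OF P(1)] P(2))
    then show "cinner w (hu - E B hu) = 0"
      by (simp add: cinner_simps P(3))
  qed
  then show ?thesis by simp
qed

text \<open>\<open>H\<close> keeps the part of \<open>x\<close> in the range of \<open>E B\<close>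
  and the part in the range of the complement in their ranges, so applying \<open>E B\<close> to
  \<open>y\<close> selects the image of the first part.\<close>

lemma resolution_commutes:
  assumes B: "B \<in> sets borel" and xy: "(x, y) \<in> H"
  shows "(E B x, E B y) \<in> H"
proof -
  note P = orthogonal_projectionD[OF pvm_proj[OF resolution_pvm B]]
  have B': "- B \<in> sets borel" using B by auto
  obtain v where v: "(E B x, v) \<in> H" using resolution_domain_proj[OF B] xy by blast
  have "E B v = v" using resolution_invariant[OF B v] P(2) by simp
  moreover have "E (- B) (y - v) = y - v"
    by (rule resolution_invariant[OF B' selfadjoint_diff[OF sa xy v]])
      (simp add: pvm_compl[OF resolution_pvm B] clinear_diff[OF P(1)] P(2))
  ultimately have "E B y = v"
    by (simp add: pvm_compl[OF resolution_pvm B] clinear_diff[OF P(1)])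
  then show ?thesis using v by simp
qed

lemma resolution_form_shifted:
  assumes xy: "(x, y) \<in> H"
  shows "Re (cinner x (y - of_real s *\<^sub>C x)) = (\<integral>t. t - s \<partial>scalar_spectral_measure E x)"
    and "integrable (scalar_spectral_measure E x) (\<lambda>t. t - s)"
proof -
  interpret finite_measure "scalar_spectral_measure E x" by (rule finite_measure_scalar[OF resolution_pvm])
  show "integrable (scalar_spectral_measure E x) (\<lambda>t. t - s)"
    using resolution_integrable[OF xy] by auto
  show "Re (cinner x (y - of_real s *\<^sub>C x)) = (\<integral>t. t - s \<partial>scalar_spectral_measure E x)"
    using resolution_integrable[OF xy] measure_scalar_UNIV[OF resolution_pvm, of x]
      space_scalar[OF resolution_pvm, of x]
    by (simp add: cinner_simps resolution_form[OF xy] cinner_self mult.commute)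
qed

lemma resolution_bounded_domain:
  assumes B: "B \<in> sets borel" and r: "\<And>t. t \<in> B \<Longrightarrow> \<bar>t\<bar> \<le> r" and x: "E B x = x"
  shows "x \<in> Domain H"
  unfolding resolution_domain
proof (rule Bochner_Integration.integrable_bound)
  interpret finite_measure "scalar_spectral_measure E x" by (rule finite_measure_scalar[OF resolution_pvm])
  show "integrable (scalar_spectral_measure E x) (\<lambda>t. r\<^sup>2)" by simp
  show "AE t in scalar_spectral_measure E x. norm (t\<^sup>2) \<le> norm (r\<^sup>2)"
    using AE_scalar[OF resolution_pvm B x]
  proof eventually_elim
    fix t assume "t \<in> B"
    then have "\<bar>t\<bar> \<le> r" by (rule r)
    then have "\<bar>t\<bar>\<^sup>2 \<le> r\<^sup>2" by (intro power_mono) auto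
    then show "norm (t\<^sup>2) \<le> norm (r\<^sup>2)" by simp
  qed
qed (simp add: sets_scalar[OF resolution_pvm] cong: measurable_cong_sets)

lemma resolution_numerical_range:
  assumes B: "B \<in> sets borel" and r: "\<And>t. t \<in> B \<Longrightarrow> \<bar>t - s\<bar> \<le> r"
    and xy: "(x, y) \<in> H" and x: "E B x = x"
  shows "\<bar>Re (cinner x (y - of_real s *\<^sub>C x))\<bar> \<le> r * (norm x)\<^sup>2"
proof -
  let ?m = "scalar_spectral_measure E x"
  interpret finite_measure ?m by (rule finite_measure_scalar[OF resolution_pvm])
  have "\<bar>\<integral>t. t - s \<partial>?m\<bar> \<le> (\<integral>t. \<bar>t - s\<bar> \<partial>?m)" by (rule integral_abs_bound)
  also have "\<dots> \<le> (\<integral>t. r \<partial>?m)"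
    using AE_scalar[OF resolution_pvm B x] resolution_form_shifted(2)[OF xy, of s] r
    by (intro integral_mono_AE) auto
  also have "\<dots> = r * (norm x)\<^sup>2"
    using measure_scalar_UNIV[OF resolution_pvm, of x] space_scalar[OF resolution_pvm, of x] by simp
  finally show ?thesis by (simp add: resolution_form_shifted(1)[OF xy])
qed

text \<open>A symmetric operator is bounded by its numerical radius.\<close>

lemma resolution_upper_bound:
  assumes B: "B \<in> sets borel" and r: "\<And>t. t \<in> B \<Longrightarrow> \<bar>t - s\<bar> \<le> r"
    and xy: "(x, y) \<in> H" and x: "E B x = x"
  shows "norm (y - of_real s *\<^sub>C x) \<le> r * norm x"
proof (cases "y - of_real s *\<^sub>C x = 0 \<or> x = 0")
  case True
  moreover have "0 \<le> r * (norm x)\<^sup>2"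
    using resolution_numerical_range[OF B r xy x] by linarith
  moreover have "y = 0" if "x = 0"
    using selfadjoint_unique[OF sa xy[unfolded that] selfadjoint_zero[OF sa]] .
  ultimately show ?thesis
    by (cases "x = 0") (auto simp: zero_le_mult_iff)
next
  case False
  note P = orthogonal_projectionD[OF pvm_proj[OF resolution_pvm B]]
  define w where "w = y - of_real s *\<^sub>C x"
  have w: "w \<noteq> 0" and x0: "x \<noteq> 0" using False by (auto simp: w_def)
  have Bw: "E B w = w"
    unfolding w_def using resolution_invariant[OF B xy x] x
    by (simp add: clinear_diff[OF P(1)] clinear_scaleC[OF P(1)])
  have "\<bar>t\<bar> \<le> \<bar>s\<bar> + r" if "t \<in> B" for t using r[OF that] by linarith
  from resolution_bounded_domain[OF B this Bw] obtain hw where hw: "(w, hw) \<in> H" by auto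
  \<comment> \<open>The vector \<open>w\<close> stays in the range of \<open>E B\<close>, hence in
    the domain, and can serve as a second argument of the form. Rescaling it to the norm of
    \<open>x\<close> makes the parallelogram identity yield the constant \<open>r\<close> without
    loss.\<close>
  define a where "a = norm x / norm w"
  define v hv where "v = of_real a *\<^sub>C w" and "hv = of_real a *\<^sub>C hw"
  have v: "(v, hv) \<in> H" unfolding v_def hv_def by (rule selfadjoint_scaleC[OF sa hw])
  have Bv: "E B v = v" by (simp add: v_def clinear_scaleC[OF P(1)] Bw)
  have "0 \<le> a" by (simp add: a_def)
  then have "norm v = a * norm w" by (simp add: v_def norm_scaleC)
  then have nv: "norm v = norm x" using w by (simp add: a_def)
  define q where "q f g = Re (cinner f (g - of_real s *\<^sub>C f))" for f g :: 'h
  have "q (v + x) (hv + y) \<le> r * (norm (v + x))\<^sup>2"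
    using resolution_numerical_range[OF B r selfadjoint_add[OF sa v xy]] x Bv
    by (simp add: q_def clinear_add[OF P(1)])
  moreover have "- q (v - x) (hv - y) \<le> r * (norm (v - x))\<^sup>2"
    using resolution_numerical_range[OF B r selfadjoint_diff[OF sa v xy]] x Bv
    by (simp add: q_def clinear_diff[OF P(1)])
  \<comment> \<open>Polarization; symmetry of \<open>H\<close> turns the two mixed terms into
    complex conjugates with equal real parts.\<close>
  moreover have "q (v + x) (hv + y) - q (v - x) (hv - y) = 4 * Re (cinner v w)"
  proof -
    have "cinner x hv = cinner y v" using selfadjoint_sym[OF sa v xy] .
    then have "cinner x hv = cnj (cinner v y)" using cinner_commute[of y v] by simp
    moreover have "cinner x v = cnj (cinner v x)" by (rule cinner_commute)
    ultimately show ?thesis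
      by (simp add: q_def w_def cinner_simps scaleC_add_right scaleC_diff_right algebra_simps)
  qed
  ultimately have "4 * Re (cinner v w) \<le> r * ((norm (v + x))\<^sup>2 + (norm (v - x))\<^sup>2)"
    by (simp add: distrib_left)
  also have "\<dots> = 4 * (r * (norm x)\<^sup>2)"
    by (simp add: parallelogram nv)
  finally have "Re (cinner v w) \<le> r * (norm x)\<^sup>2" by simp
  moreover have "Re (cinner v w) = norm x * norm w"
    using w by (simp add: v_def cinner_scaleC_left cinner_self a_def power2_eq_square)
  ultimately show ?thesis
    using x0 by (simp add: w_def power2_eq_square mult.left_commute)
qed

text \<open>The formula for \<open>|(H - s) x|^2\<close> as an integral is not at hand. Instead
  \<open>x\<close> is split into \<open>p\<close> above \<open>s\<close> and \<open>n\<close> at or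
  below \<open>s\<close>: pairing \<open>(H - s) x\<close> with the reflected vector
  \<open>p - n\<close> gives the integral of \<open>|t - s|\<close>, and reflection does not change
  the norm, so Cauchy-Schwarz suffices.\<close>

lemma resolution_lower_bound:
  assumes C: "C \<in> sets borel" and r: "\<And>t. t \<in> C \<Longrightarrow> r \<le> \<bar>t - s\<bar>"
    and xy: "(x, y) \<in> H" and x: "E C x = x"
  shows "r * norm x \<le> norm (y - of_real s *\<^sub>C x)"
proof (cases "x = 0")
  case False
  let ?m = "scalar_spectral_measure E x"
  interpret finite_measure ?m by (rule finite_measure_scalar[OF resolution_pvm])
  define G where "G = {s<..}"
  have G: "G \<in> sets borel" and G': "- G \<in> sets borel" by (auto simp: G_def)
  note P = orthogonal_projectionD[OF pvm_proj[OF resolution_pvm G]]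
  note P' = orthogonal_projectionD[OF pvm_proj[OF resolution_pvm G']]
  define T where "T = y - of_real s *\<^sub>C x"
  define p n where "p = E G x" and "n = E (- G) x"
  have pn: "x = p + n" by (simp add: p_def n_def pvm_compl[OF resolution_pvm G])
  have p: "(p, E G y) \<in> H" and n: "(n, E (- G) y) \<in> H"
    unfolding p_def n_def by (intro resolution_commutes G G' xy)+
  have "cinner p T = cinner p (E G y - of_real s *\<^sub>C p)"
    using P(3)[of p T] P(2)[of x]
    by (simp add: p_def T_def clinear_diff[OF P(1)] clinear_scaleC[OF P(1)])
  then have "Re (cinner p T) = (\<integral>t. t - s \<partial>scalar_spectral_measure E p)"
    using resolution_form_shifted(1)[OF p] by simp
  also have "\<dots> = (\<integral>t. indicator G t * (t - s) \<partial>?m)"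
    unfolding p_def by (rule scalar_projection_integral[OF resolution_pvm G]) simp
  finally have pT: "Re (cinner p T) = (\<integral>t. indicator G t * (t - s) \<partial>?m)" .
  have "cinner n T = cinner n (E (- G) y - of_real s *\<^sub>C n)"
    using P'(3)[of n T] P'(2)[of x]
    by (simp add: n_def T_def clinear_diff[OF P'(1)] clinear_scaleC[OF P'(1)])
  then have "Re (cinner n T) = (\<integral>t. t - s \<partial>scalar_spectral_measure E n)"
    using resolution_form_shifted(1)[OF n] by simp
  also have "\<dots> = (\<integral>t. indicator (- G) t * (t - s) \<partial>?m)"
    unfolding n_def by (rule scalar_projection_integral[OF resolution_pvm G']) simp
  finally have nT: "Re (cinner n T) = (\<integral>t. indicator (- G) t * (t - s) \<partial>?m)" .
  have int: "integrable ?m (\<lambda>t. indicator A t * (t - s))" if "A \<in> sets borel" for A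
    using integrable_real_mult_indicator[OF _ resolution_form_shifted(2)[OF xy, of s], of A] that
    by (simp add: sets_scalar[OF resolution_pvm] mult.commute)
  have "r * (norm x)\<^sup>2 = (\<integral>t. r \<partial>?m)"
    using measure_scalar_UNIV[OF resolution_pvm, of x] space_scalar[OF resolution_pvm, of x] by simp
  also have "\<dots> \<le> (\<integral>t. \<bar>t - s\<bar> \<partial>?m)"
    using AE_scalar[OF resolution_pvm C x] resolution_form_shifted(2)[OF xy, of s] r
    by (intro integral_mono_AE) auto
  also have "\<dots> = (\<integral>t. indicator G t * (t - s) - indicator (- G) t * (t - s) \<partial>?m)"
    by (intro Bochner_Integration.integral_cong) (auto simp: indicator_def G_def)
  also have "\<dots> = Re (cinner (p - n) T)"
    by (subst Bochner_Integration.integral_diff[OF int[OF G] int[OF G']])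
      (simp add: pT nT cinner_diff_left)
  also have "\<dots> \<le> norm (cinner (p - n) T)" by (rule complex_Re_le_cmod)
  also have "\<dots> \<le> norm (p - n) * norm T" by (rule cinner_cauchy_schwarz)
  also have "norm (p - n) = norm x"
  proof -
    have "cinner p n = 0" "cinner n p = 0"
      using P(3)[of x n] P'(3)[of x p] pvm_disjoint[OF resolution_pvm G G', of x]
        pvm_disjoint[OF resolution_pvm G' G, of x] by (simp_all add: p_def n_def)
    then have "cinner (p - n) (p - n) = cinner x x"
      by (simp add: pn cinner_simps)
    then have "(norm (p - n))\<^sup>2 = (norm x)\<^sup>2" unfolding cinner_self by (metis of_real_eq_iff)
    then show ?thesis by simp
  qed
  finally show ?thesis using False by (simp add: T_def power2_eq_square mult.left_commute)
qed simp

end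

section \<open>Uniqueness of the spectral resolution\<close>

context
  fixes H :: "'h::complex_inner operator"
  assumes sa: "selfadjoint H"
begin

text \<open>On the range of the spectral projection for \<open>[s - r, s + r]\<close> the operator \<open>H - s\<close> contracts by
  \<open>r\<close>, while on the part of the other resolution outside the larger interval it expands by \<open>q > r\<close>.\<close>

lemma resolution_separation:
  assumes E: "spectral_resolution H E" and F: "spectral_resolution H F"
    and r: "0 \<le> r" "r < q" and y: "E {s - r..s + r} y = y"
  shows "F {t. q \<le> \<bar>t - s\<bar>} y = 0"
proof -
  define B C where "B = {s - r..s + r}" and "C = {t. q \<le> \<bar>t - s\<bar>}"
  have B: "B \<in> sets borel" and C: "C \<in> sets borel" by (auto simp: B_def C_def)
  note P = orthogonal_projectionD[OF pvm_proj[OF resolution_pvm[OF sa E] B]]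
  note Q = orthogonal_projectionD[OF pvm_proj[OF resolution_pvm[OF sa F] C]]
  \<comment> \<open>Since \<open>H - s\<close> maps the range of \<open>E B\<close> into itself and
    commutes with \<open>F C\<close>, the comparison of the two rates can be iterated, and each
    round gains a factor \<open>r / q\<close>.\<close>
  have "norm (F C x) \<le> (r / q) ^ k * norm x" if "E B x = x" for x k
    using that
  proof (induction k arbitrary: x)
    case 0
    then show ?case using Q(5) by simp
  next
    case (Suc k)
    have "\<bar>t\<bar> \<le> \<bar>s\<bar> + r" if "t \<in> B" for t using that by (auto simp: B_def)
    from resolution_bounded_domain[OF sa E B this Suc.prems] obtain h where h: "(x, h) \<in> H" by auto
    define w where "w = h - of_real s *\<^sub>C x"
    have Bw: "E B w = w"
      unfolding w_def using resolution_invariant[OF sa E B h Suc.prems] Suc.prems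
      by (simp add: clinear_diff[OF P(1)] clinear_scaleC[OF P(1)])
    have nw: "norm w \<le> r * norm x"
      unfolding w_def by (rule resolution_upper_bound[OF sa E B _ h Suc.prems]) (auto simp: B_def)
    have "q * norm (F C x) \<le> norm (F C h - of_real s *\<^sub>C F C x)"
      by (rule resolution_lower_bound[OF sa F C _ resolution_commutes[OF sa F C h] Q(2)])
        (auto simp: C_def)
    also have "F C h - of_real s *\<^sub>C F C x = F C w"
      by (simp add: w_def clinear_diff[OF Q(1)] clinear_scaleC[OF Q(1)])
    also have "norm (F C w) \<le> (r / q) ^ k * norm w" by (rule Suc.IH[OF Bw])
    also have "\<dots> \<le> (r / q) ^ k * (r * norm x)"
      using r nw by (intro mult_left_mono) auto
    finally show ?case using r by (simp add: field_simps)
  qed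
  then have le: "norm (F C y) \<le> (r / q) ^ k * norm y" for k using y by (simp add: B_def)
  have "(\<lambda>k. (r / q) ^ k * norm y) \<longlonglongrightarrow> 0 * norm y"
    using r by (intro tendsto_mult tendsto_const LIMSEQ_power_zero) auto
  then have "norm (F C y) \<le> 0 * norm y"
    by (rule LIMSEQ_le_const) (use le in auto)
  then show ?thesis by (simp add: C_def)
qed

text \<open>With \<open>s\<close> the midpoint and \<open>r\<close> half the length, the complement
  of the interval is a countable union of sets at distance at least \<open>r + 1 / (n + 1)\<close>
  from \<open>s\<close>, each a null set for the second resolution by separation.\<close>

lemma resolution_interval_le:
  assumes E: "spectral_resolution H E" and F: "spectral_resolution H F"
  shows "F {a..b} (E {a..b} x) = E {a..b} x"
proof (cases "a \<le> b")
  case True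
  define s r where "s = (a + b) / 2" and "r = (b - a) / 2"
  have r: "0 \<le> r" and ab: "{a..b} = {s - r..s + r}"
    using True by (auto simp: s_def r_def field_simps)
  define y where "y = E {s - r..s + r} x"
  have y: "E {s - r..s + r} y = y"
    unfolding y_def by (rule orthogonal_projectionD(2)[OF pvm_proj[OF resolution_pvm[OF sa E]]]) simp
  let ?m = "scalar_spectral_measure F y"
  note Fp = resolution_pvm[OF sa F]
  have "- {s - r..s + r} = (\<Union>n::nat. {t. r + 1 / real (Suc n) \<le> \<bar>t - s\<bar>})"
  proof (intro equalityI subsetI)
    fix t assume "t \<in> - {s - r..s + r}"
    then have "\<bar>t - s\<bar> - r > 0" by auto
    then obtain n :: nat where "1 / real (Suc n) < \<bar>t - s\<bar> - r"
      using nat_approx_posE by blast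
    then show "t \<in> (\<Union>n::nat. {t. r + 1 / real (Suc n) \<le> \<bar>t - s\<bar>})" by (auto intro!: exI[of _ n])
  next
    fix t assume "t \<in> (\<Union>n::nat. {t. r + 1 / real (Suc n) \<le> \<bar>t - s\<bar>})"
    then obtain n :: nat where "r + 1 / real (Suc n) \<le> \<bar>t - s\<bar>" by auto
    moreover have "1 / real (Suc n) > 0" by simp
    ultimately have "\<bar>t - s\<bar> > r" by linarith
    then show "t \<in> - {s - r..s + r}" by auto
  qed
  moreover have "emeasure ?m (\<Union>n::nat. {t. r + 1 / real (Suc n) \<le> \<bar>t - s\<bar>}) = 0"
  proof (rule emeasure_UN_eq_0)
    fix n :: nat
    have "F {t. r + 1 / real (Suc n) \<le> \<bar>t - s\<bar>} y = 0"
      by (rule resolution_separation[OF E F r _ y]) simp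
    then show "emeasure ?m {t. r + 1 / real (Suc n) \<le> \<bar>t - s\<bar>} = 0"
      by (subst emeasure_scalar[OF Fp]) auto
  qed (auto simp: sets_scalar[OF Fp])
  ultimately have "emeasure ?m (- {s - r..s + r}) = 0" by simp
  then have "F (- {s - r..s + r}) y = 0"
    by (subst (asm) emeasure_scalar[OF Fp]) auto
  then have "F {s - r..s + r} y = y" by (subst (asm) pvm_compl[OF Fp]) auto
  then show ?thesis by (simp add: ab y_def)
next
  case False
  then show ?thesis using pvm_empty[OF resolution_pvm[OF sa E]] pvm_empty[OF resolution_pvm[OF sa F]] by simp
qed

text \<open>On intervals each projection fixes the range of the other, and taking adjoints forces
  equality. Intervals determine the scalar measures, and these determine the projections by
  polarization.\<close>

lemma resolution_unique:
  assumes E: "spectral_resolution H E" and F: "spectral_resolution H F" and A: "A \<in> sets borel"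
  shows "E A = F A"
proof -
  note Ep = resolution_pvm[OF sa E] and Fp = resolution_pvm[OF sa F]
  have int: "E {a..b} x = F {a..b} x" for a b x
  proof (rule cinner_ext)
    fix u
    note P = orthogonal_projectionD[OF pvm_proj[OF Ep, of "{a..b}"]]
    note Q = orthogonal_projectionD[OF pvm_proj[OF Fp, of "{a..b}"]]
    have "cinner u (E {a..b} x) = cinner u (F {a..b} (E {a..b} x))"
      by (simp add: resolution_interval_le[OF E F])
    also have "\<dots> = cinner (E {a..b} (F {a..b} u)) x" using P(3) Q(3) by simp
    also have "\<dots> = cinner u (F {a..b} x)"
      using Q(3) by (simp add: resolution_interval_le[OF F E])
    finally show "cinner u (E {a..b} x) = cinner u (F {a..b} x)" .
  qed
  have "scalar_spectral_measure E x = scalar_spectral_measure F x" for x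
  proof (rule measure_eqI_generator_eq[where E = "range (\<lambda>(a, b). {a..b::real})" and \<Omega> = UNIV
        and A = "\<lambda>n. {- real n..real n}"])
    show "Int_stable (range (\<lambda>(a, b). {a..b::real}))"
      by (auto simp: Int_stable_def)
    show "sets (scalar_spectral_measure E x) = sigma_sets UNIV (range (\<lambda>(a, b). {a..b}))"
      "sets (scalar_spectral_measure F x) = sigma_sets UNIV (range (\<lambda>(a, b). {a..b}))"
      by (simp_all add: sets_scalar[OF Ep] sets_scalar[OF Fp] borel_eq_atLeastAtMost)
    show "(\<Union>n::nat. {- real n..real n}) = UNIV"
      by (auto intro!: real_arch_simple simp: abs_le_iff[symmetric] minus_le_iff)
        (metis abs_ge_self abs_le_iff real_arch_simple)
    show "emeasure (scalar_spectral_measure E x) X = emeasure (scalar_spectral_measure F x) X"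
      if "X \<in> range (\<lambda>(a, b). {a..b})" for X
      using that int by (auto simp: emeasure_scalar[OF Ep] emeasure_scalar[OF Fp])
    show "emeasure (scalar_spectral_measure E x) {- real n..real n} \<noteq> \<infinity>" for n
      by (simp add: emeasure_scalar[OF Ep])
  qed auto
  then have "cinner x (E A x) = cinner x (F A x)" for x
    using emeasure_scalar[OF Ep A, of x] emeasure_scalar[OF Fp A, of x]
    by (simp add: orthogonal_projectionD(4)[OF pvm_proj[OF Ep A]]
        orthogonal_projectionD(4)[OF pvm_proj[OF Fp A]] power_mono_iff)
  then show ?thesis
    by (intro ext quadratic_form_determines orthogonal_projectionD(1) pvm_proj[OF Ep] pvm_proj[OF Fp] A)
qed

lemma spectral_projection_eq:
  assumes E: "spectral_resolution H E" and A: "A \<in> sets borel"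
  shows "spectral_projection H A = E A"
  unfolding spectral_projection_def
proof (rule the_equality)
  show "\<exists>E'. spectral_resolution H E' \<and> E A = E' A" using E by blast
  show "\<And>P. \<exists>E'. spectral_resolution H E' \<and> P = E' A \<Longrightarrow> P = E A"
    using resolution_unique[OF _ E A] by blast
qed

end

section \<open>Unitary conjugation and reducing subspaces\<close>

lemma unitary_conjugate_iff:
  assumes "unitary_pair U V"
  shows "(x, y) \<in> unitary_conjugate U H \<longleftrightarrow> (V x, V y) \<in> H"
proof -
  have "y = U z \<longleftrightarrow> z = V y" for z
    using unitary_pairD(3,4)[OF assms] by metis
  then show ?thesis
    by (auto simp: unitary_conjugate_def cadjoint_unitary_pair[OF assms])
qed

text \<open>Used both for the translations in the stationarity relation and for the reflection in a
  reducing subspace.\<close>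

lemma spectral_resolution_conjugate:
  assumes up: "unitary_pair U V" and res: "spectral_resolution H E"
  shows "spectral_resolution (unitary_conjugate U H) (\<lambda>A x. U (E A (V x)))"
proof -
  note UV = unitary_pairD[OF up]
  have pvm: "projection_valued_measure E" using res by (simp add: spectral_resolution_def)
  have bl: "bounded_linear U" by (rule clinear_bounded_linear[of _ 1]) (simp_all add: UV)
  have "projection_valued_measure (\<lambda>A x. U (E A (V x)))"
    unfolding projection_valued_measure_def
  proof (intro conjI ballI allI impI)
    fix A :: "real set" assume "A \<in> sets borel"
    note P = orthogonal_projectionD[OF pvm_proj[OF pvm this]]
    show "orthogonal_projection (\<lambda>x. U (E A (V x)))"
      unfolding orthogonal_projection_def clinear_def
      by (simp add: UV P(2,3) clinear_add[OF UV(1)] clinear_add[OF UV(2)] clinear_add[OF P(1)]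
          clinear_scaleC[OF UV(1)] clinear_scaleC[OF UV(2)] clinear_scaleC[OF P(1)])
  next
    show "U (E UNIV (V x)) = x" for x by (simp add: pvm_UNIV[OF pvm] UV)
    show "(\<lambda>n. U (E (A n) (V x))) sums U (E (\<Union>n. A n) (V x))"
      if "range A \<subseteq> sets borel" "disjoint_family A" for A :: "nat \<Rightarrow> real set" and x
      by (rule bounded_linear.sums[OF bl pvm_sums[OF pvm that]])
  qed
  moreover have ssm: "scalar_spectral_measure (\<lambda>A x. U (E A (V x))) x = scalar_spectral_measure E (V x)" for x
    by (simp add: scalar_spectral_measure_def UV(5))
  moreover have "x \<in> Domain (unitary_conjugate U H) \<longleftrightarrow> V x \<in> Domain H" for x
    using UV(4) by (auto simp: Domain_iff unitary_conjugate_iff[OF up]) metis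
  moreover have "cinner x y = of_real (\<integral>t. t \<partial>scalar_spectral_measure E (V x))"
    if "(x, y) \<in> unitary_conjugate U H" for x y
  proof -
    have "(V x, V y) \<in> H" using that by (simp add: unitary_conjugate_iff[OF up])
    then have "cinner (V x) (V y) = of_real (\<integral>t. t \<partial>scalar_spectral_measure E (V x))"
      using res by (auto simp: spectral_resolution_def)
    then show ?thesis by (simp add: UV(5)[symmetric] UV(3))
  qed
  ultimately show ?thesis
    using res by (auto simp: spectral_resolution_def)
qed

lemma spectral_projection_conjugate:
  assumes up: "unitary_pair U V" and sa: "selfadjoint H" "selfadjoint (unitary_conjugate U H)"
    and res: "spectral_resolution H E" and A: "A \<in> sets borel"
  shows "spectral_projection (unitary_conjugate U H) A x = U (spectral_projection H A (V x))"
  using spectral_projection_eq[OF sa(2) spectral_resolution_conjugate[OF up res] A]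
    spectral_projection_eq[OF sa(1) res A] by simp

section \<open>Spectral projections on a reducing subspace and the spectrum of the
  restriction\<close>

context
  fixes H :: "'h::chilbert_space operator" and E :: "real set \<Rightarrow> 'h \<Rightarrow> 'h" and M :: "'h set"
  assumes sa: "selfadjoint H" and res: "spectral_resolution H E" and red: "reduces M H"
begin

text \<open>The reflection \<open>2 P - 1\<close> in a reducing subspace is a unitary operator commuting with \<open>H\<close>.\<close>

lemma resolution_reducing:
  assumes B: "B \<in> sets borel"
  shows "E B (proj_onto M x) = proj_onto M (E B x)"
proof -
  have M: "closed_csubspace M" using red by (simp add: reduces_def)
  define P where "P = proj_onto M"
  note P = orthogonal_projectionD[OF orthogonal_projection_proj_onto[OF M], folded P_def]
  note Q = orthogonal_projectionD[OF pvm_proj[OF resolution_pvm[OF sa res] B]]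
  define W where "W x = P x + P x - x" for x
  have WW: "W (W x) = x" for x
    by (simp add: W_def clinear_add[OF P(1)] clinear_diff[OF P(1)] P(2))
  have up: "unitary_pair W W"
    unfolding unitary_pair_def
  proof (intro conjI allI WW)
    show "clinear W" "clinear W"
      unfolding clinear_def W_def
      by (simp_all add: clinear_add[OF P(1)] clinear_scaleC[OF P(1)] scaleC_add_right scaleC_diff_right)
    show "cinner x (W y) = cinner (W x) y" for x y
      by (simp add: W_def cinner_simps P(3))
  qed
  have W_H: "(W a, W b) \<in> H" if "(a, b) \<in> H" for a b
    unfolding W_def P_def
    by (intro selfadjoint_add[OF sa] selfadjoint_diff[OF sa] reduces_proj[OF sa red] that)
  have "(x, y) \<in> unitary_conjugate W H \<longleftrightarrow> (x, y) \<in> H" for x y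
    using W_H[of x y] W_H[of "W x" "W y"] by (auto simp: unitary_conjugate_iff[OF up] WW)
  then have "unitary_conjugate W H = H" by auto
  \<comment> \<open>The conjugated family resolves the same operator, so uniqueness makes
    \<open>E B\<close> commute with the reflection.\<close>
  then have "(\<lambda>A x. W (E A (W x))) B = E B"
    using spectral_resolution_conjugate[OF up res] by (intro resolution_unique[OF sa _ res B]) simp
  then have "W (E B (W x)) = E B x" by metis
  then have "E B (W x) = W (E B x)" using WW[of "E B (W x)"] by simp
  then have "E B (P x) + E B (P x) = P (E B x) + P (E B x)"
    by (simp add: W_def clinear_add[OF Q(1)] clinear_diff[OF Q(1)])
  then have "2 *\<^sub>R E B (P x) = 2 *\<^sub>R P (E B x)" by (simp only: scaleR_2)
  then show ?thesis by (simp add: P_def)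
qed

lemma resolution_mem_reducing:
  assumes "B \<in> sets borel" and "x \<in> M"
  shows "E B x \<in> M"
proof -
  have M: "closed_csubspace M" using red by (simp add: reduces_def)
  have "E B x = proj_onto M (E B x)"
    using resolution_reducing[OF assms(1), of x] proj_onto_id[OF M assms(2)] by simp
  then show ?thesis using proj_onto_mem[OF M, of "E B x"] by metis
qed

text \<open>A real \<open>s\<close> is its own conjugate, so the lower bound also excludes the
  adjoint kernel, and surjectivity comes with it.\<close>

lemma real_resolvent_set_iff:
  "complex_of_real s \<in> resolvent_set_in M (restriction H M) \<longleftrightarrow>
     (\<exists>C. \<forall>x w. (x, w) \<in> H \<longrightarrow> x \<in> M \<longrightarrow> norm x \<le> C * norm (w - of_real s *\<^sub>C x))"
proof
  assume "complex_of_real s \<in> resolvent_set_in M (restriction H M)"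
  then show "\<exists>C. \<forall>x w. (x, w) \<in> H \<longrightarrow> x \<in> M \<longrightarrow> norm x \<le> C * norm (w - of_real s *\<^sub>C x)"
    unfolding resolvent_set_in_def restriction_def by blast
next
  assume "\<exists>C. \<forall>x w. (x, w) \<in> H \<longrightarrow> x \<in> M \<longrightarrow> norm x \<le> C * norm (w - of_real s *\<^sub>C x)"
  then obtain C where C: "\<And>x w. (x, w) \<in> H \<Longrightarrow> x \<in> M \<Longrightarrow> norm x \<le> C * norm (w - of_real s *\<^sub>C x)"
    by blast
  have M: "closed_csubspace M" using red by (simp add: reduces_def)
  have ker: "x = 0" if "(x, of_real s *\<^sub>C x) \<in> H" "x \<in> M" for x
    using C[OF that] by simp
  have "\<exists>!x. (x, y + of_real s *\<^sub>C x) \<in> restriction H M" if y: "y \<in> M" for y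
  proof -
    obtain x where x: "x \<in> M" "(x, y + of_real s *\<^sub>C x) \<in> H"
      using bounded_below_imp_surj[OF sa red C _ y] ker by auto
    have "x' = x" if "x' \<in> M" "(x', y + of_real s *\<^sub>C x') \<in> H" for x'
    proof -
      have "(x' - x, of_real s *\<^sub>C (x' - x)) \<in> H"
        using selfadjoint_diff[OF sa that(2) x(2)] by (simp add: scaleC_diff_right)
      then have "x' - x = 0" by (rule ker) (rule closed_csubspaceD(4)[OF M that(1) x(1)])
      then show ?thesis by simp
    qed
    then show ?thesis
      using x unfolding restriction_def by (intro ex1I[of _ x]) blast+
  qed
  moreover have "\<exists>C. \<forall>(x, w)\<in>restriction H M. norm x \<le> C * norm (w - of_real s *\<^sub>C x)"
    using C by (auto simp: restriction_def)
  ultimately show "complex_of_real s \<in> resolvent_set_in M (restriction H M)"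
    by (simp add: resolvent_set_in_def)
qed

lemma real_resolvent_setE:
  assumes "complex_of_real s \<in> resolvent_set_in M (restriction H M)"
  obtains C where "0 < C" and "\<And>x w. (x, w) \<in> H \<Longrightarrow> x \<in> M \<Longrightarrow> norm x \<le> C * norm (w - of_real s *\<^sub>C x)"
proof -
  obtain C where C: "\<And>x w. (x, w) \<in> H \<Longrightarrow> x \<in> M \<Longrightarrow> norm x \<le> C * norm (w - of_real s *\<^sub>C x)"
    using assms unfolding real_resolvent_set_iff by blast
  have "norm x \<le> (\<bar>C\<bar> + 1) * norm (w - of_real s *\<^sub>C x)" if "(x, w) \<in> H" "x \<in> M" for x w
    using C[OF that] by (rule order_trans) (intro mult_right_mono, auto)
  then show thesis using that[of "\<bar>C\<bar> + 1"] by simp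
qed

text \<open>A bound with constant \<open>C\<close> at \<open>s\<close> survives with constant
  \<open>2 * C\<close> within distance \<open>1 / (2 * C)\<close>. Closedness makes \<Sigma> Borel,
  without which its spectral projection has no meaning.\<close>

lemma closed_real_spectrum: "closed {s. complex_of_real s \<in> spectrum_in M (restriction H M)}"
proof -
  have "open {s. complex_of_real s \<in> resolvent_set_in M (restriction H M)}"
    unfolding open_dist
  proof (intro ballI)
    fix s assume "s \<in> {s. complex_of_real s \<in> resolvent_set_in M (restriction H M)}"
    then obtain C where C: "0 < C" "\<And>x w. (x, w) \<in> H \<Longrightarrow> x \<in> M \<Longrightarrow> norm x \<le> C * norm (w - of_real s *\<^sub>C x)"
      using real_resolvent_setE[of s] by auto
    have "complex_of_real s' \<in> resolvent_set_in M (restriction H M)" if s': "dist s' s < 1 / (2 * C)" for s'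
      unfolding real_resolvent_set_iff
    proof (intro exI[of _ "2 * C"] allI impI)
      fix x w assume xw: "(x, w) \<in> H" "x \<in> M"
      have "w - of_real s *\<^sub>C x = (w - of_real s' *\<^sub>C x) + of_real (s' - s) *\<^sub>C x"
        by (simp add: scaleC_diff_left)
      then have "norm (w - of_real s *\<^sub>C x) \<le> norm (w - of_real s' *\<^sub>C x) + \<bar>s' - s\<bar> * norm x"
        using norm_triangle_ineq[of "w - of_real s' *\<^sub>C x" "of_real (s' - s) *\<^sub>C x"]
        by (simp only: norm_scaleC norm_of_real)
      also have "\<bar>s' - s\<bar> * norm x \<le> 1 / (2 * C) * norm x"
        using s' by (intro mult_right_mono) (auto simp: dist_real_def)
      finally have "C * norm (w - of_real s *\<^sub>C x) \<le> C * (norm (w - of_real s' *\<^sub>C x) + 1 / (2 * C) * norm x)"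
        using C(1) by simp
      then have "norm x \<le> C * norm (w - of_real s' *\<^sub>C x) + norm x / 2"
        using C(2)[OF xw] C(1) by (simp add: distrib_left)
      then show "norm x \<le> 2 * C * norm (w - of_real s' *\<^sub>C x)" by linarith
    qed
    then show "\<exists>e>0. \<forall>s'. dist s' s < e \<longrightarrow> s' \<in> {s. complex_of_real s \<in> resolvent_set_in M (restriction H M)}"
      using C(1) by (intro exI[of _ "1 / (2 * C)"]) auto
  qed
  then show ?thesis
    by (simp add: closed_def spectrum_in_def Collect_neg_eq[symmetric])
qed

text \<open>On the range of the projection for radius \<open>1 / (2 * C)\<close> the operator
  \<open>H - s\<close> shrinks norms to at most half of what the resolvent bound permits, so that
  range meets \<open>M\<close> only in zero.\<close>

lemma resolution_zero_near_resolvent_set: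
  assumes "complex_of_real s \<in> resolvent_set_in M (restriction H M)"
  shows "\<exists>S. open S \<and> s \<in> S \<and> (\<forall>m\<in>M. E S m = 0)"
proof -
  obtain C where C: "0 < C" "\<And>x w. (x, w) \<in> H \<Longrightarrow> x \<in> M \<Longrightarrow> norm x \<le> C * norm (w - of_real s *\<^sub>C x)"
    using real_resolvent_setE[OF assms] by blast
  define r where "r = 1 / (2 * C)"
  define S where "S = {s - r<..<s + r}"
  have S: "S \<in> sets borel" by (simp add: S_def)
  have "E S m = 0" if m: "m \<in> M" for m
  proof -
    define x where "x = E S m"
    have x: "E S x = x"
      unfolding x_def by (rule orthogonal_projectionD(2)[OF pvm_proj[OF resolution_pvm[OF sa res] S]])
    have "\<bar>t\<bar> \<le> \<bar>s\<bar> + r" if "t \<in> S" for t using that by (auto simp: S_def)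
    from resolution_bounded_domain[OF sa res S this x] obtain w where w: "(x, w) \<in> H" by auto
    have "norm x \<le> C * norm (w - of_real s *\<^sub>C x)"
      by (rule C(2)[OF w]) (simp add: x_def resolution_mem_reducing[OF S m])
    also have "norm (w - of_real s *\<^sub>C x) \<le> r * norm x"
      by (rule resolution_upper_bound[OF sa res S _ w x]) (auto simp: S_def)
    finally have "norm x \<le> norm x / 2" using C(1) by (simp add: r_def)
    then show ?thesis by (simp add: x_def)
  qed
  then show ?thesis using C(1) by (intro exI[of _ S]) (auto simp: S_def r_def)
qed

theorem resolution_nonzero_on_spectrum:
  assumes \<Sigma>: "complex_of_real ` \<Sigma> = spectrum_in M (restriction H M)"
    and l: "l \<in> \<Sigma>" "l \<in> interior I" and I: "closed I"
  shows "\<Sigma> \<inter> I \<in> sets borel" and "\<exists>x. E (\<Sigma> \<inter> I) x \<noteq> 0"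
proof -
  have Sig: "\<Sigma> = {s. complex_of_real s \<in> spectrum_in M (restriction H M)}"
    unfolding \<Sigma>[symmetric] by auto
  have "closed \<Sigma>" unfolding Sig by (rule closed_real_spectrum)
  then show A: "\<Sigma> \<inter> I \<in> sets borel" using I by auto
  note pvm = resolution_pvm[OF sa res]
  show "\<exists>x. E (\<Sigma> \<inter> I) x \<noteq> 0"
  proof (rule ccontr)
    assume "\<not> (\<exists>x. E (\<Sigma> \<inter> I) x \<noteq> 0)"
    then have zero: "E (\<Sigma> \<inter> I) x = 0" for x by blast
    obtain d where d: "d > 0" "ball l d \<subseteq> I"
      using l(2) by (auto simp: mem_interior)
    define F where "F = {S. open S \<and> (\<forall>m\<in>M. E S m = 0)}"
    obtain F' where F': "F' \<subseteq> F" "countable F'" "\<Union>F' = \<Union>F"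
      using Lindelof[of F] by (auto simp: F_def)
    have cover: "ball l d \<subseteq> \<Sigma> \<inter> I \<union> \<Union>F'"
    proof
      fix s assume s: "s \<in> ball l d"
      show "s \<in> \<Sigma> \<inter> I \<union> \<Union>F'"
      proof (cases "s \<in> \<Sigma>")
        case True
        then show ?thesis using s d by auto
      next
        case False
        then have "complex_of_real s \<in> resolvent_set_in M (restriction H M)"
          by (simp add: Sig spectrum_in_def)
        then show ?thesis
          using resolution_zero_near_resolvent_set[of s] F'(3) by (auto simp: F_def)
      qed
    qed
    have ball0: "E (ball l d) m = 0" if m: "m \<in> M" for m
    proof -
      let ?\<mu> = "scalar_spectral_measure E m"
      have "\<Sigma> \<inter> I \<in> null_sets ?\<mu>"
        using A zero by (auto simp: null_sets_def sets_scalar[OF pvm] emeasure_scalar[OF pvm])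
      moreover have "(\<Union>S\<in>F'. S) \<in> null_sets ?\<mu>"
      proof (rule null_sets_UN'[OF F'(2)])
        fix S assume "S \<in> F'"
        then have "open S" "E S m = 0" using F'(1) m by (auto simp: F_def)
        then show "S \<in> null_sets ?\<mu>"
          by (auto simp: null_sets_def sets_scalar[OF pvm] emeasure_scalar[OF pvm])
      qed
      ultimately have "\<Sigma> \<inter> I \<union> \<Union>F' \<in> null_sets ?\<mu>" by auto
      then have "ball l d \<in> null_sets ?\<mu>"
        by (rule null_sets_subset[OF _ _ cover]) (simp add: sets_scalar[OF pvm])
      then show ?thesis by (auto simp: null_sets_def emeasure_scalar[OF pvm])
    qed
    have B: "- ball l d \<in> sets borel" by auto
    have "complex_of_real l \<in> resolvent_set_in M (restriction H M)"
      unfolding real_resolvent_set_iff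
    proof (intro exI[of _ "1 / d"] allI impI)
      fix x w assume xw: "(x, w) \<in> H" "x \<in> M"
      \<comment> \<open>Every vector of \<open>M\<close> is now spectrally at distance at least
        \<open>d\<close> from \<open>l\<close>, which gives a resolvent bound with constant
        \<open>1 / d\<close>.\<close>
      have "E (- ball l d) x = x"
        using ball0[OF xw(2)] by (simp add: pvm_compl[OF pvm])
      then have "d * norm x \<le> norm (w - of_real l *\<^sub>C x)"
        by (intro resolution_lower_bound[OF sa res B _ xw(1)]) (auto simp: dist_real_def abs_minus_commute)
      then show "norm x \<le> 1 / d * norm (w - of_real l *\<^sub>C x)"
        using d(1) by (simp add: field_simps)
    qed
    then show False using l(1) by (simp add: Sig spectrum_in_def)
  qed
qed

end

section \<open>Moment measures of a unitary operator\<close>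

lemma clinear_funpow: "clinear U \<Longrightarrow> clinear (U ^^ n)"
  by (induction n) (auto simp: clinear_def)

lemma unitary_pair_funpow:
  assumes "unitary_pair U V"
  shows "unitary_pair (U ^^ n) (V ^^ n)"
proof -
  note UV = unitary_pairD[OF assms]
  have 1: "(U ^^ n) ((V ^^ n) x) = x" "(V ^^ n) ((U ^^ n) x) = x"
    "cinner x ((U ^^ n) y) = cinner ((V ^^ n) x) y" for x y
    by (induction n arbitrary: x y) (simp_all add: UV funpow_swap1)
  then show ?thesis
    by (simp add: unitary_pair_def clinear_funpow UV)
qed

lemma unitary_pair_commute:
  assumes "unitary_pair U V"
  shows "(V ^^ n) (U x) = U ((V ^^ n) x)"
proof (induction n)
  case (Suc n)
  then show ?case using unitary_pairD(3,4)[OF assms] by simp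
qed simp

lemma integral_cis_full_period:
  fixes j :: int
  shows "(\<integral>t. indicator {0..2 * pi} t *\<^sub>R cis (of_int j * t) \<partial>lborel) = (if j = 0 then 2 * pi else 0)"
proof (cases "j = 0")
  case True
  then show ?thesis by (simp add: scaleR_conv_of_real)
next
  case False
  define F where "F t = cis (of_int j * t) / (\<i> * of_int j)" for t :: real
  have "(F has_vector_derivative cis (of_int j * t)) (at t within {0..2 * pi})" for t
  proof -
    have "((\<lambda>z. exp (\<i> * of_int j * z) / (\<i> * of_int j)) has_field_derivative
        exp (\<i> * of_int j * of_real t)) (at (of_real t))"
      using False by (auto intro!: derivative_eq_intros)
    from has_vector_derivative_real_field[OF this, of "{0..2 * pi}"] show ?thesis
      by (simp add: F_def[abs_def] cis_conv_exp mult.assoc)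
  qed
  moreover have "continuous_on {0..2 * pi} (\<lambda>t. cis (of_int j * t))"
    unfolding cis_conv_exp by (intro continuous_intros)
  ultimately have "(\<integral>t. indicator {0..2 * pi} t *\<^sub>R cis (of_int j * t) \<partial>lborel) = F (2 * pi) - F 0"
    by (intro integral_FTC_Icc) auto
  also have "cis (of_int j * (2 * pi)) = 1"
    using cis_multiple_2pi[of "of_int j"] by (simp add: mult.commute)
  then have "F (2 * pi) - F 0 = 0" by (simp add: F_def)
  finally show ?thesis using False by simp
qed

text \<open>Correlations of the sequence \<open>U^n x\<close> depend only on the lag; this gives the
  Fejer densities below the right moments.\<close>

lemma funpow_correlation:
  assumes "unitary_pair U V"
  shows "cinner ((U ^^ n) x) ((U ^^ (n + k)) x) = cinner x ((U ^^ k) x)"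
  using unitary_pairD[OF unitary_pair_funpow[OF assms, of n]] by (simp add: funpow_add)

text \<open>The periodogram of the stationary sequence \<open>U^n x\<close> on one period. It is
  nonnegative by form, and its Fourier coefficients are the correlations with the triangular Fejer
  weights \<open>(N - k) / N\<close>.\<close>

definition fejer_density :: "('h::complex_inner \<Rightarrow> 'h) \<Rightarrow> 'h \<Rightarrow> nat \<Rightarrow> real \<Rightarrow> real" where
  "fejer_density U x N t = indicator {0..2 * pi} t *
     ((norm (\<Sum>n<N. cis (- real n * t) *\<^sub>C (U ^^ n) x))\<^sup>2 / (2 * pi * real N))"

lemma fejer_density_nonneg: "0 \<le> fejer_density U x N t"
  by (simp add: fejer_density_def indicator_def)

lemma fejer_density_cis:
  "of_real (fejer_density U x N t) * cis (real k * t) =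
     (\<Sum>n<N. \<Sum>m<N. (cinner ((U ^^ n) x) ((U ^^ m) x) / (2 * pi * real N)) *
        (indicator {0..2 * pi} t *\<^sub>R cis (of_int (int k + int n - int m) * t)))"
proof -
  have e: "cis (real n * t) * cis (- real m * t) * cis (real k * t) =
      cis (of_int (int k + int n - int m) * t)" for n m
    by (simp add: cis_mult algebra_simps)
  let ?v = "\<Sum>n<N. cis (- real n * t) *\<^sub>C (U ^^ n) x"
  have "complex_of_real ((norm ?v)\<^sup>2) = cinner ?v ?v" by (rule cinner_self[symmetric])
  also have "\<dots> = (\<Sum>m<N. \<Sum>n<N. cis (real n * t) * cis (- real m * t) *
      cinner ((U ^^ n) x) ((U ^^ m) x))"
    by (simp add: cinner_sum_left cinner_sum_right cinner_simps cis_cnj sum_distrib_left mult_ac)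
  also have "\<dots> = (\<Sum>n<N. \<Sum>m<N. cis (real n * t) * cis (- real m * t) *
      cinner ((U ^^ n) x) ((U ^^ m) x))"
    by (rule sum.swap)
  finally have "complex_of_real ((norm ?v)\<^sup>2) * cis (real k * t) =
      (\<Sum>n<N. \<Sum>m<N. cinner ((U ^^ n) x) ((U ^^ m) x) *
        (cis (real n * t) * cis (- real m * t) * cis (real k * t)))"
    by (simp add: sum_distrib_right sum_distrib_left mult_ac)
  then have "complex_of_real ((norm ?v)\<^sup>2) * cis (real k * t) =
      (\<Sum>n<N. \<Sum>m<N. cinner ((U ^^ n) x) ((U ^^ m) x) * cis (of_int (int k + int n - int m) * t))"
    unfolding e .
  then have "of_real (fejer_density U x N t) * cis (real k * t) = indicator {0..2 * pi} t *
      (\<Sum>n<N. \<Sum>m<N. cinner ((U ^^ n) x) ((U ^^ m) x) * cis (of_int (int k + int n - int m) * t))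
        / (2 * pi * real N)"
    by (simp add: fejer_density_def indicator_def)
  also have "\<dots> = (\<Sum>n<N. \<Sum>m<N. (cinner ((U ^^ n) x) ((U ^^ m) x) / (2 * pi * real N)) *
        (indicator {0..2 * pi} t *\<^sub>R cis (of_int (int k + int n - int m) * t)))"
    by (simp add: indicator_def sum_divide_distrib)
  finally show ?thesis .
qed

lemma integrable_cis: "integrable lborel (\<lambda>t. indicator {0..2 * pi} t *\<^sub>R cis (r * t))"
proof -
  have "continuous_on {0..2 * pi} (\<lambda>t. cis (r * t))"
    unfolding cis_conv_exp by (intro continuous_intros)
  from borel_integrable_atLeastAtMost'[OF this] show ?thesis
    by (simp add: set_integrable_def)
qed

lemma fejer_density_moment:
  assumes up: "unitary_pair U V" and N: "N > 0"
  shows "integrable lborel (\<lambda>t. of_real (fejer_density U x N t) * cis (real k * t))"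
    and "(\<integral>t. of_real (fejer_density U x N t) * cis (real k * t) \<partial>lborel) =
      of_real (real (N - k) / real N) * cinner x ((U ^^ k) x)"
proof -
  let ?c = "\<lambda>n m. cinner ((U ^^ n) x) ((U ^^ m) x) / (2 * pi * real N)"
  let ?e = "\<lambda>n m t. indicator {0..2 * pi} t *\<^sub>R cis (of_int (int k + int n - int m) * t) :: complex"
  show "integrable lborel (\<lambda>t. of_real (fejer_density U x N t) * cis (real k * t))"
    unfolding fejer_density_cis
    by (intro Bochner_Integration.integrable_sum integrable_mult_right integrable_cis)
  have int: "integrable lborel (\<lambda>t. ?c n m * ?e n m t)" for n m
    by (intro integrable_mult_right integrable_cis)
  have "(\<integral>t. of_real (fejer_density U x N t) * cis (real k * t) \<partial>lborel)
      = (\<Sum>n<N. \<integral>t. (\<Sum>m<N. ?c n m * ?e n m t) \<partial>lborel)"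
    unfolding fejer_density_cis
    by (intro Bochner_Integration.integral_sum Bochner_Integration.integrable_sum int)
  also have "\<dots> = (\<Sum>n<N. \<Sum>m<N. \<integral>t. ?c n m * ?e n m t \<partial>lborel)"
    by (intro sum.cong refl Bochner_Integration.integral_sum int)
  also have "\<dots> = (\<Sum>n<N. \<Sum>m<N. ?c n m * (\<integral>t. ?e n m t \<partial>lborel))"
    by (intro sum.cong refl integral_mult_right_zero)
  also have "\<dots> = (\<Sum>n<N. \<Sum>m<N. if m = n + k then cinner x ((U ^^ k) x) / real N else 0)"
  proof (intro sum.cong refl)
    fix n m
    have "int k + int n - int m = 0 \<longleftrightarrow> m = n + k" by auto
    then show "?c n m * (\<integral>t. ?e n m t \<partial>lborel) = (if m = n + k then cinner x ((U ^^ k) x) / real N else 0)"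
      unfolding integral_cis_full_period using funpow_correlation[OF up, of n x k] by auto
  qed
  \<comment> \<open>The pairs with \<open>m = n + k < N\<close> are counted by \<open>N - k\<close>;
    truncated subtraction yields zero when \<open>k\<close> is at least \<open>N\<close>.\<close>
  also have "\<dots> = (\<Sum>n<N. if n < N - k then cinner x ((U ^^ k) x) / real N else 0)"
    by (intro sum.cong refl) (auto simp: sum.delta)
  also have "\<dots> = (\<Sum>n\<in>{..<N - k}. cinner x ((U ^^ k) x) / real N)"
    by (rule sum.mono_neutral_cong_right) auto
  also have "\<dots> = of_real (real (N - k) / real N) * cinner x ((U ^^ k) x)"
    by simp
  finally show "(\<integral>t. of_real (fejer_density U x N t) * cis (real k * t) \<partial>lborel) =
      of_real (real (N - k) / real N) * cinner x ((U ^^ k) x)" .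
qed

text \<open>For a unit vector the densities have total mass one, so tightness yields a weakly
  convergent subsequence. The moments are characteristic functions at integers and therefore
  converge along it, while the Fejer weights tend to one.\<close>

lemma moment_measure_unit_vector:
  assumes up: "unitary_pair U V" and x: "norm x = 1"
  shows "\<exists>M. real_distribution M \<and> (\<forall>k. (\<integral>t. (cis t) ^ k \<partial>M) = cinner x ((U ^^ k) x))"
proof -
  define d where "d n = fejer_density U x (Suc n)" for n
  define \<mu> where "\<mu> n = density lborel (\<lambda>t. ennreal (d n t))" for n
  have d0: "0 \<le> d n t" for n t by (simp add: d_def fejer_density_nonneg)
  have dint: "integrable lborel (d n)" and d1: "(\<integral>t. d n t \<partial>lborel) = 1" for n
  proof -
    have i: "integrable lborel (\<lambda>t. complex_of_real (d n t))"
      and e: "(\<integral>t. complex_of_real (d n t) \<partial>lborel) = 1"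
      using fejer_density_moment[OF up, of "Suc n" x 0] x by (simp_all add: d_def cinner_self)
    show "integrable lborel (d n)" using integrable_Re[OF i] by simp
    show "(\<integral>t. d n t \<partial>lborel) = 1" using integral_Re[OF i] e by simp
  qed
  have [measurable]: "d n \<in> borel_measurable borel" for n
    using borel_measurable_integrable[OF dint] by simp
  \<comment> \<open>A half-open interval around \<open>[0, 2 pi]\<close>, in the shape that
    tightness asks for; \<open>2 pi < 7\<close>.\<close>
  have supp: "d n t * indicator {-1<..7} t = d n t" for n t
    using pi_less_4 pi_gt_zero pi_approx by (auto simp: d_def fejer_density_def indicator_def)
  have total: "(\<integral>\<^sup>+t. ennreal (d n t) \<partial>lborel) = 1" for n
    using nn_integral_eq_integral[OF dint[of n]] d0 by (simp add: d1)
  have dist: "real_distribution (\<mu> n)" for n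
  proof -
    have "prob_space (\<mu> n)"
      by (rule prob_spaceI) (simp add: \<mu>_def emeasure_density total)
    then show ?thesis
      by (simp add: real_distribution_def real_distribution_axioms_def \<mu>_def)
  qed
  have "measure (\<mu> n) {-1<..7} = 1" for n
  proof -
    have "emeasure (\<mu> n) {-1<..7} = (\<integral>\<^sup>+t. ennreal (d n t * indicator {-1<..7} t) \<partial>lborel)"
      unfolding \<mu>_def by (subst emeasure_density) (auto simp: d0 ennreal_mult' ennreal_indicator)
    then show ?thesis by (simp add: supp total measure_def)
  qed
  then have "tight \<mu>"
    unfolding tight_def using dist by (intro conjI allI impI exI[of _ "-1"] exI[of _ 7]) simp_all
  from tight_imp_convergent_subsubsequence[OF this strict_mono_id]
  obtain r M where r: "strict_mono r" and M: "real_distribution M" and conv: "weak_conv_m (\<mu> \<circ> r) M"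
    by (auto simp: comp_def id_def)
  have "(\<integral>t. (cis t) ^ k \<partial>M) = cinner x ((U ^^ k) x)" for k
  proof -
    have "char (\<mu> n) (real k) = of_real (real (Suc n - k) / real (Suc n)) * cinner x ((U ^^ k) x)" for n
    proof -
      have "char (\<mu> n) (real k) = (\<integral>t. d n t *\<^sub>R exp (\<i> * of_real (real k * t)) \<partial>lborel)"
        unfolding char_def \<mu>_def by (subst integral_density) (auto simp: d0)
      also have "\<dots> = (\<integral>t. of_real (d n t) * cis (real k * t) \<partial>lborel)"
        by (simp add: cis_conv_exp scaleR_conv_of_real)
      finally show ?thesis
        unfolding d_def using fejer_density_moment(2)[OF up, of "Suc n" x k] by simp
    qed
    moreover have "(\<lambda>n. of_real (real (Suc n - k) / real (Suc n)) * cinner x ((U ^^ k) x))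
        \<longlonglongrightarrow> of_real 1 * cinner x ((U ^^ k) x)"
    proof (intro tendsto_mult tendsto_of_real tendsto_const)
      have "(\<lambda>n. 1 - real k * inverse (real (Suc n))) \<longlonglongrightarrow> 1 - real k * 0"
        by (intro tendsto_diff tendsto_mult tendsto_const LIMSEQ_inverse_real_of_nat)
      then have lim1: "(\<lambda>n. 1 - real k * inverse (real (Suc n))) \<longlonglongrightarrow> 1" by simp
      have "1 - real k * inverse (real (Suc n)) = real (Suc n - k) / real (Suc n)" if "n \<ge> k" for n
        using that by (simp add: of_nat_diff field_simps)
      then have "\<forall>\<^sub>F n in sequentially. 1 - real k * inverse (real (Suc n)) = real (Suc n - k) / real (Suc n)"
        unfolding eventually_sequentially by blast
      then show "(\<lambda>n. real (Suc n - k) / real (Suc n)) \<longlonglongrightarrow> 1"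
        by (rule Lim_transform_eventually[OF lim1])
    qed
    ultimately have "(\<lambda>n. char (\<mu> n) (real k)) \<longlonglongrightarrow> cinner x ((U ^^ k) x)" by simp
    then have "(\<lambda>n. char ((\<mu> \<circ> r) n) (real k)) \<longlonglongrightarrow> cinner x ((U ^^ k) x)"
      using LIMSEQ_subseq_LIMSEQ[OF _ r] by (simp add: comp_def)
    moreover have "(\<lambda>n. char ((\<mu> \<circ> r) n) (real k)) \<longlonglongrightarrow> char M (real k)"
      by (rule levy_continuity1) (use dist M conv in \<open>auto simp: comp_def\<close>)
    ultimately have "char M (real k) = cinner x ((U ^^ k) x)"
      using LIMSEQ_unique by blast
    moreover have "exp (\<i> * of_real (real k * t)) = cis t ^ k" for t
      using Complex.DeMoivre[of t k] cis_conv_exp[of "real k * t"] by metis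
    ultimately show ?thesis by (simp only: char_def)
  qed
  then show ?thesis using M by blast
qed

text \<open>Reduction to unit vectors by scaling; the zero vector cannot be normalized and gets the
  null measure.\<close>

lemma moment_measure_exists:
  assumes up: "unitary_pair U V"
  shows "\<exists>M. finite_measure M \<and> sets M = sets borel \<and>
    (\<forall>k. (\<integral>t. (cis t) ^ k \<partial>M) = cinner x ((U ^^ k) x))"
proof (cases "x = 0")
  case True
  have "clinear (U ^^ k)" for k by (rule clinear_funpow[OF unitary_pairD(1)[OF up]])
  moreover have "(\<integral>t. (cis t) ^ k \<partial>null_measure borel) = 0" for k
    by (rule integral_eq_zero_AE) (rule AE_I[where N = UNIV], auto)
  ultimately show ?thesis
    using True by (intro exI[of _ "null_measure borel"])
      (auto simp: clinear_zero intro!: finite_measureI)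
next
  case False
  define e where "e = of_real (1 / norm x) *\<^sub>C x"
  have xe: "x = of_real (norm x) *\<^sub>C e" using False by (simp add: e_def scaleC_scaleC)
  have "norm e = 1" using False by (simp add: e_def norm_scaleC norm_divide)
  from moment_measure_unit_vector[OF up this] obtain M
    where M: "real_distribution M" "\<And>k. (\<integral>t. (cis t) ^ k \<partial>M) = cinner e ((U ^^ k) e)" by blast
  interpret M: real_distribution M by (rule M)
  have [measurable_cong]: "sets M = sets borel" by simp
  let ?N = "density M (\<lambda>_. ennreal ((norm x)\<^sup>2))"
  have "finite_measure ?N"
    by (rule finite_measureI) (simp add: emeasure_density M.emeasure_space_1[simplified] ennreal_mult_eq_top_iff)
  moreover have "(\<integral>t. (cis t) ^ k \<partial>?N) = cinner x ((U ^^ k) x)" for k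
  proof -
    have "(\<integral>t. (cis t) ^ k \<partial>?N) = (\<integral>t. ((norm x)\<^sup>2) *\<^sub>R (cis t) ^ k \<partial>M)"
      by (rule integral_density) (auto simp: cis_conv_exp)
    also have "\<dots> = of_real ((norm x)\<^sup>2) * cinner e ((U ^^ k) e)"
      by (simp add: M(2) scaleR_conv_of_real)
    also have "\<dots> = cinner x ((U ^^ k) x)"
      by (subst (2 3) xe)
        (simp add: clinear_scaleC[OF clinear_funpow[OF unitary_pairD(1)[OF up]]] cinner_simps
          power2_eq_square)
    finally show ?thesis .
  qed
  ultimately show ?thesis by (intro exI[of _ ?N]) auto
qed

section \<open>Trigonometric polynomials of a unitary operator\<close>

text \<open>Pairs a polynomial in \<open>u\<close> and its conjugate with the operator obtained by
  substituting \<open>U\<close> and \<open>V\<close>. It is a relation and not a map because symbols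
  that differ off the unit circle, such as \<open>1\<close> and \<open>u * cnj u\<close>, give the
  same operator.\<close>

inductive trig :: "('h::complex_inner \<Rightarrow> 'h) \<Rightarrow> ('h \<Rightarrow> 'h) \<Rightarrow> (complex \<Rightarrow> complex) \<Rightarrow> ('h \<Rightarrow> 'h) \<Rightarrow> bool"
  for U V where
  trig_one: "trig U V (\<lambda>u. 1) (\<lambda>x. x)"
| trig_U: "trig U V f F \<Longrightarrow> trig U V (\<lambda>u. u * f u) (\<lambda>x. U (F x))"
| trig_V: "trig U V f F \<Longrightarrow> trig U V (\<lambda>u. cnj u * f u) (\<lambda>x. V (F x))"
| trig_add: "trig U V f F \<Longrightarrow> trig U V g G \<Longrightarrow> trig U V (\<lambda>u. f u + g u) (\<lambda>x. F x + G x)"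
| trig_scale: "trig U V f F \<Longrightarrow> trig U V (\<lambda>u. c * f u) (\<lambda>x. c *\<^sub>C F x)"

lemma trig_mult:
  assumes "trig U V f F" and "trig U V g G"
  shows "trig U V (\<lambda>u. f u * g u) (\<lambda>x. F (G x))"
  using assms(1)
proof (induction rule: trig.induct)
  case (trig_add f F g' G')
  then show ?case by (simp add: distrib_right trig.trig_add)
qed (auto simp: mult.assoc intro: trig.intros assms(2))

lemma trig_diff:
  assumes "trig U V f F" and "trig U V g G"
  shows "trig U V (\<lambda>u. f u - g u) (\<lambda>x. F x - G x)"
  using trig_add[OF assms(1) trig_scale[OF assms(2), of "- 1"]] by (simp add: scaleC_minus_one)

lemma trig_const: "trig U V (\<lambda>u. c) (\<lambda>x. c *\<^sub>C x)"
  using trig_scale[OF trig_one, of U V c] by simp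

lemma trig_power: "trig U V f F \<Longrightarrow> trig U V (\<lambda>u. f u ^ n) (F ^^ n)"
proof (induction n)
  case 0
  then show ?case using trig_one by (simp add: id_def)
next
  case (Suc n)
  from trig_mult[OF Suc.prems Suc.IH[OF Suc.prems]] show ?case by (simp add: comp_def)
qed

lemma trig_sum:
  fixes n :: nat
  assumes "\<And>k. trig U V (f k) (F k)"
  shows "trig U V (\<lambda>u. \<Sum>k<n. f k u) (\<lambda>x. \<Sum>k<n. F k x)"
proof (induction n)
  case 0
  then show ?case using trig_const[of U V 0] by simp
next
  case (Suc n)
  from trig_add[OF Suc.IH assms[of n]] show ?case by simp
qed

lemma trig_measurable: "trig U V f F \<Longrightarrow> f \<in> borel_measurable borel"
proof (induction rule: trig.induct)
  case (trig_V f F)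
  have "cnj \<in> borel_measurable borel"
    by (intro borel_measurable_continuous_onI continuous_intros)
  then show ?case
    using trig_V by (intro borel_measurable_times) (auto intro: measurable_compose)
qed auto

lemma trig_bounded: "trig U V f F \<Longrightarrow> \<exists>K. \<forall>u. norm u = 1 \<longrightarrow> norm (f u) \<le> K"
proof (induction rule: trig.induct)
  case (trig_add f F g G)
  then obtain K L where "\<And>u. norm u = 1 \<Longrightarrow> norm (f u) \<le> K" "\<And>u. norm u = 1 \<Longrightarrow> norm (g u) \<le> L"
    by blast
  then have "norm u = 1 \<longrightarrow> norm (f u + g u) \<le> K + L" for u
    using norm_triangle_mono by blast
  then show ?case by blast
next
  case (trig_scale f F c)
  then obtain K where "\<And>u. norm u = 1 \<Longrightarrow> norm (f u) \<le> K" by blast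
  then have "norm u = 1 \<longrightarrow> norm (c * f u) \<le> norm c * K" for u
    by (simp add: norm_mult mult_left_mono)
  then show ?case by blast
qed (auto simp: norm_mult)

context
  fixes U V :: "'h::complex_inner \<Rightarrow> 'h"
  assumes up: "unitary_pair U V"
begin

lemma trig_clinear: "trig U V f F \<Longrightarrow> clinear F"
proof (induction rule: trig.induct)
  case (trig_U f F)
  then show ?case using unitary_pairD(1)[OF up] by (auto simp: clinear_def)
next
  case (trig_V f F)
  then show ?case using unitary_pairD(2)[OF up] by (auto simp: clinear_def)
qed (auto simp: clinear_def scaleC_add_right scaleC_scaleC mult.commute)

text \<open>Adjoints reverse the order of factors, so the new factor goes to the right of
  \<open>F'\<close> by \<open>trig_mult\<close>; on symbols the order is immaterial.\<close>

lemma trig_adjoint: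
  "trig U V f F \<Longrightarrow> \<exists>F'. trig U V (\<lambda>u. cnj (f u)) F' \<and> (\<forall>x y. cinner x (F y) = cinner (F' x) y)"
proof (induction rule: trig.induct)
  case trig_one
  then show ?case using trig.trig_one[of U V] by auto
next
  case (trig_U f F)
  then obtain F' where F': "trig U V (\<lambda>u. cnj (f u)) F'" "\<And>x y. cinner x (F y) = cinner (F' x) y"
    by blast
  have "trig U V (\<lambda>u. cnj (u * f u)) (\<lambda>x. F' (V x))"
    using trig_mult[OF F'(1) trig_V[OF trig_one]] by (simp add: mult.commute)
  then show ?case using F'(2) unitary_pairD(5)[OF up]
    by (intro exI[of _ "\<lambda>x. F' (V x)"]) simp
next
  case (trig_V f F)
  then obtain F' where F': "trig U V (\<lambda>u. cnj (f u)) F'" "\<And>x y. cinner x (F y) = cinner (F' x) y"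
    by blast
  have "trig U V (\<lambda>u. cnj (cnj u * f u)) (\<lambda>x. F' (U x))"
    using trig_mult[OF F'(1) trig.trig_U[OF trig_one]] by (simp add: mult.commute)
  then show ?case using F'(2) unitary_pairD(6)[OF up]
    by (intro exI[of _ "\<lambda>x. F' (U x)"]) (simp add: unitary_pairD(6)[OF up, symmetric])
next
  case (trig_add f F g G)
  then obtain F' G' where F': "trig U V (\<lambda>u. cnj (f u)) F'" "\<And>x y. cinner x (F y) = cinner (F' x) y"
    and G': "trig U V (\<lambda>u. cnj (g u)) G'" "\<And>x y. cinner x (G y) = cinner (G' x) y"
    by blast
  show ?case
    using trig.trig_add[OF F'(1) G'(1)] F'(2) G'(2)
    by (intro exI[of _ "\<lambda>x. F' x + G' x"]) (simp add: cinner_simps)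
next
  case (trig_scale f F c)
  then obtain F' where F': "trig U V (\<lambda>u. cnj (f u)) F'" "\<And>x y. cinner x (F y) = cinner (F' x) y"
    by blast
  show ?case
    using trig.trig_scale[OF F'(1), of "cnj c"] F'(2)
    by (intro exI[of _ "\<lambda>x. cnj c *\<^sub>C F' x"]) (simp add: cinner_simps)
qed

text \<open>The unimodular function \<open>w\<close> stays abstract because the calculus is applied
  twice: with \<open>cis\<close> to measures of angles and with \<open>cay\<close> to measures on
  the line.\<close>

context
  fixes N :: "'b measure" and w :: "'b \<Rightarrow> complex" and x :: 'h
  assumes fin: "finite_measure N" and w_meas: "w \<in> borel_measurable N"
    and w_norm: "\<And>t. norm (w t) = 1" and moments: "\<And>k. (\<integral>t. w t ^ k \<partial>N) = cinner x ((U ^^ k) x)"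
begin

lemma trig_integrable:
  assumes "trig U V f F"
  shows "integrable N (\<lambda>t. f (w t))"
proof -
  interpret finite_measure N by (rule fin)
  obtain K where "\<And>u. norm u = 1 \<Longrightarrow> norm (f u) \<le> K" using trig_bounded[OF assms] by blast
  then show ?thesis
    using measurable_compose[OF w_meas trig_measurable[OF assms]] w_norm
    by (intro integrable_const_bound[where B = K]) auto
qed

lemma trig_monomial: "trig U V (\<lambda>u. u ^ m * (cnj u ^ n * 1)) (\<lambda>x. (U ^^ m) ((V ^^ n) x))"
proof -
  have "trig U V (\<lambda>u. u ^ m) (U ^^ m)" "trig U V (\<lambda>u. cnj u ^ n) (V ^^ n)"
    using trig_power[OF trig_U[OF trig_one], where n = m] trig_power[OF trig_V[OF trig_one], where n = n]
    by simp_all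
  from trig_mult[OF this] show ?thesis by simp
qed

text \<open>The hypothesis covers nonnegative powers only. The induction carries an arbitrary prefix
  \<open>U^m V^n\<close> to absorb new factors; at the bottom the prefix cancels to a power of
  \<open>U\<close>, or to a power of \<open>V\<close>, whose moment is a conjugate.\<close>

lemma trig_integral:
  assumes "trig U V f F"
  shows "(\<integral>t. f (w t) \<partial>N) = cinner x (F x)"
proof -
  have w1: "w t * cnj (w t) = 1" for t
    using w_norm[of t] complex_norm_square[of "w t"] by simp
  have "(\<integral>t. w t ^ m * cnj (w t) ^ n * f (w t) \<partial>N) = cinner x ((U ^^ m) ((V ^^ n) (F x)))" for m n
    using assms
  proof (induction arbitrary: m n rule: trig.induct)
    case trig_one
    show ?case
    proof (cases "n \<le> m")
      case True
      then obtain k where k: "m = k + n" using le_iff_add add.commute by metis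
      have "w t ^ m * cnj (w t) ^ n = w t ^ k" for t
        using w1[of t] by (simp add: k power_add mult.assoc power_mult_distrib[symmetric])
      moreover have "(U ^^ m) ((V ^^ n) x) = (U ^^ k) x"
        using unitary_pairD(3)[OF unitary_pair_funpow[OF up, of n]] by (simp add: k funpow_add)
      ultimately show ?thesis by (simp add: moments)
    next
      case False
      then obtain k where k: "n = m + k" using le_iff_add nat_le_linear by metis
      have "w t ^ m * cnj (w t) ^ n = cnj (w t ^ k)" for t
        using w1[of t]
        by (simp add: k power_add mult.assoc[symmetric] power_mult_distrib[symmetric])
      moreover have "(U ^^ m) ((V ^^ n) x) = (V ^^ k) x"
        using unitary_pairD(3)[OF unitary_pair_funpow[OF up, of m]] by (simp add: k funpow_add)
      moreover have "cinner x ((V ^^ k) x) = cnj (cinner x ((U ^^ k) x))"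
        using unitary_pairD(6)[OF unitary_pair_funpow[OF up, of k], of x x]
          cinner_commute[of "(U ^^ k) x" x] by simp
      ultimately show ?thesis
        by (simp add: Bochner_Integration.integral_cnj moments del: complex_cnj_power)
    qed
  next
    case (trig_U f F)
    have eq: "w t ^ m * cnj (w t) ^ n * (w t * f (w t)) = w t ^ Suc m * cnj (w t) ^ n * f (w t)" for t
      by (simp add: mult_ac)
    show ?case
      unfolding eq trig_U.IH[of "Suc m" n]
      by (simp only: unitary_pair_commute[OF up] funpow_Suc_right comp_def)
  next
    case (trig_V f F)
    have eq: "w t ^ m * cnj (w t) ^ n * (cnj (w t) * f (w t)) = w t ^ m * cnj (w t) ^ Suc n * f (w t)" for t
      by (simp add: mult_ac)
    show ?case
      unfolding eq trig_V.IH[of m "Suc n"] by (simp only: funpow_Suc_right comp_def)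
  next
    case (trig_add f F g G)
    have "integrable N (\<lambda>t. w t ^ m * cnj (w t) ^ n * f (w t))"
      "integrable N (\<lambda>t. w t ^ m * cnj (w t) ^ n * g (w t))"
      using trig_integrable[OF trig_mult[OF trig_monomial trig_add.hyps(1)]]
        trig_integrable[OF trig_mult[OF trig_monomial trig_add.hyps(2)]] by simp_all
    then show ?case
      using trig_add.IH clinear_add[OF trig_clinear[OF trig_monomial]]
      by (simp add: distrib_left cinner_add_right)
  next
    case (trig_scale f F c)
    have eq: "w t ^ m * cnj (w t) ^ n * (c * f (w t)) = c * (w t ^ m * cnj (w t) ^ n * f (w t))" for t
      by (simp add: mult_ac)
    show ?case
      unfolding eq using trig_scale.IH clinear_scaleC[OF trig_clinear[OF trig_monomial]]
      by (simp add: cinner_scaleC_right)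
  qed
  from this[of 0 0] show ?thesis by simp
qed

text \<open>The squared modulus of \<open>f\<close> is the symbol of the adjoint composed with
  \<open>F\<close>. This isometry turns strong convergence of operators into mean square convergence
  of symbols.\<close>

lemma trig_norm:
  assumes "trig U V f F"
  shows "(norm (F x))\<^sup>2 = (\<integral>t. (norm (f (w t)))\<^sup>2 \<partial>N)"
proof -
  obtain F' where F': "trig U V (\<lambda>u. cnj (f u)) F'" "\<And>x y. cinner x (F y) = cinner (F' x) y"
    using trig_adjoint[OF assms] by blast
  have "complex_of_real ((norm (F x))\<^sup>2) = cinner (F' (F x)) x"
    by (simp only: cinner_self[symmetric] F'(2))
  also have "\<dots> = cnj (\<integral>t. cnj (f (w t)) * f (w t) \<partial>N)"
    unfolding trig_integral[OF trig_mult[OF F'(1) assms]] by (rule cinner_commute)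
  also have "(\<lambda>t. cnj (f (w t)) * f (w t)) = (\<lambda>t. complex_of_real ((norm (f (w t)))\<^sup>2))"
    using complex_norm_square by (auto simp: mult.commute)
  finally have "complex_of_real ((norm (F x))\<^sup>2) = of_real (\<integral>t. (norm (f (w t)))\<^sup>2 \<partial>N)"
    by (simp only: integral_complex_of_real complex_cnj_complex_of_real)
  then show ?thesis using of_real_eq_iff by blast
qed

text \<open>Mean ergodic theorem: if \<open>1 - U\<close> has dense range then the Cesaro means of \<open>U\<^sup>k x\<close> tend to zero,
  so the moment measure of \<open>x\<close> does not charge \<open>w = 1\<close>.\<close>

lemma moment_measure_no_atom:
  assumes dense: "closure (range (\<lambda>y. y - U y)) = UNIV"
  shows "AE t in N. w t \<noteq> 1"
proof -
  interpret finite_measure N by (rule fin)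
  define A where "A m y = of_real (1 / real m) *\<^sub>C (\<Sum>k<m. (U ^^ k) y)" for m y
  define a where "a m u = of_real (1 / real m) * (\<Sum>k<m. u ^ k)" for m and u :: complex
  have trig_A: "trig U V (a m) (A m)" for m
  proof -
    have "trig U V (\<lambda>u. u ^ k) (U ^^ k)" for k
      using trig_power[OF trig_U[OF trig_one]] by simp
    from trig_scale[OF trig_sum[OF this, where n = m], where c = "of_real (1 / real m)"] show ?thesis
      by (simp add: A_def[abs_def] a_def[abs_def])
  qed
  have normU: "norm ((U ^^ k) y) = norm y" for k y
    using unitary_pairD(7)[OF unitary_pair_funpow[OF up]] .
  have normA: "norm (A m y) \<le> norm y" for m y
  proof (cases "m = 0")
    case False
    have "norm (\<Sum>k<m. (U ^^ k) y) \<le> real m * norm y"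
      using sum_norm_le[of "{..<m}" "\<lambda>k. (U ^^ k) y" "\<lambda>_. norm y"] by (simp add: normU)
    then show ?thesis using False by (simp add: A_def norm_scaleC norm_divide field_simps)
  qed (simp add: A_def)
  \<comment> \<open>On the range of \<open>1 - U\<close> the sums telescope, so the means decay like
    \<open>1 / m\<close>; contractivity extends the decay to the closure.\<close>
  have teles: "norm (A m (y - U y)) \<le> 2 * norm y / real m" for m y
  proof -
    have "(U ^^ k) (y - U y) = (U ^^ k) y - (U ^^ Suc k) y" for k
      using clinear_diff[OF clinear_funpow[OF unitary_pairD(1)[OF up]]] by (simp add: funpow_swap1)
    then have "(\<Sum>k<m. (U ^^ k) (y - U y)) = (\<Sum>k<m. (U ^^ k) y - (U ^^ Suc k) y)"
      by (intro sum.cong refl)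
    also have "\<dots> = y - (U ^^ m) y"
      by (subst sum_lessThan_telescope') simp
    finally have "(\<Sum>k<m. (U ^^ k) (y - U y)) = y - (U ^^ m) y" .
    then have "norm (\<Sum>k<m. (U ^^ k) (y - U y)) \<le> 2 * norm y"
      using norm_triangle_ineq4[of y "(U ^^ m) y"] by (simp add: normU)
    then show ?thesis by (simp add: A_def norm_scaleC norm_divide divide_right_mono)
  qed
  have lim: "(\<lambda>m. norm (A m x)) \<longlonglongrightarrow> 0"
  proof (rule LIMSEQ_I)
    fix e :: real assume e: "e > 0"
    have "\<forall>d>0. \<exists>z\<in>range (\<lambda>y. y - U y). dist z x < d"
      using dense unfolding closure_approachable[symmetric] by simp
    then obtain y where "dist (y - U y) x < e / 2"
      using half_gt_zero[OF e] by blast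
    then have y: "norm (x - (y - U y)) < e / 2"
      by (simp only: dist_norm norm_minus_commute)
    obtain m0 :: nat where m0: "4 * norm y / e < real m0" using reals_Archimedean2 by blast
    have "norm (A m x) < e" if m: "m \<ge> m0" "m > 0" for m
    proof -
      have "A m x = A m (x - (y - U y)) + A m (y - U y)"
        using clinear_add[OF trig_clinear[OF trig_A], of m "x - (y - U y)" "y - U y"] by simp
      then have "norm (A m x) \<le> norm (x - (y - U y)) + 2 * norm y / real m"
        using norm_triangle_mono[OF normA teles] by metis
      also have "2 * norm y / real m < e / 2"
      proof -
        have "4 * norm y / e < real m" using m m0 by (meson less_le_trans of_nat_mono)
        then show ?thesis using e m by (simp add: field_simps)
      qed
      finally show ?thesis using y by simp
    qed
    then show "\<exists>no. \<forall>n\<ge>no. norm (norm (A n x) - 0) < e"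
      by (intro exI[of _ "Suc m0"]) auto
  qed
  have S: "{t \<in> space N. w t = 1} \<in> sets N"
    using w_meas by measurable
  \<comment> \<open>The averaged symbol equals 1 where \<open>w t = 1\<close>, so its squared
    modulus dominates the indicator of that set. The index \<open>Suc m\<close> keeps the
    denominator nonzero.\<close>
  have le: "measure N {t \<in> space N. w t = 1} \<le> (norm (A (Suc m) x))\<^sup>2" for m
  proof -
    have "measure N {t \<in> space N. w t = 1} = (\<integral>t. indicator {t \<in> space N. w t = 1} t \<partial>N)"
      using S by simp
    also have "\<dots> \<le> (\<integral>t. (norm (a (Suc m) (w t)))\<^sup>2 \<partial>N)"
    proof (rule integral_mono)
      show "integrable N (indicator {t \<in> space N. w t = 1} :: 'b \<Rightarrow> real)"
        using S by (simp add: emeasure_eq_measure)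
      obtain F' where "trig U V (\<lambda>u. cnj (a (Suc m) u)) F'" using trig_adjoint[OF trig_A] by blast
      from trig_integrable[OF trig_mult[OF this trig_A]]
      have "integrable N (\<lambda>t. cnj (a (Suc m) (w t)) * a (Suc m) (w t))" .
      moreover have "(\<lambda>t. cnj (a (Suc m) (w t)) * a (Suc m) (w t))
          = (\<lambda>t. complex_of_real ((norm (a (Suc m) (w t)))\<^sup>2))"
        using complex_norm_square by (auto simp: mult.commute)
      ultimately show "integrable N (\<lambda>t. (norm (a (Suc m) (w t)))\<^sup>2)"
        using integrable_Re[of N "\<lambda>t. complex_of_real ((norm (a (Suc m) (w t)))\<^sup>2)"]
        by (simp only: Re_complex_of_real)
      fix t
      have "a (Suc m) 1 = 1" by (simp add: a_def del: of_nat_Suc)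
      then show "indicator {t \<in> space N. w t = 1} t \<le> (norm (a (Suc m) (w t)))\<^sup>2"
        by (auto simp: indicator_def)
    qed
    also have "\<dots> = (norm (A (Suc m) x))\<^sup>2" using trig_norm[OF trig_A] by simp
    finally show ?thesis .
  qed
  have "(\<lambda>m. (norm (A (Suc m) x))\<^sup>2) \<longlonglongrightarrow> 0\<^sup>2"
    using lim by (intro tendsto_power) (rule LIMSEQ_Suc)
  then have "measure N {t \<in> space N. w t = 1} \<le> 0\<^sup>2"
    by (rule LIMSEQ_le_const) (use le in auto)
  then have "emeasure N {t \<in> space N. w t = 1} = 0"
    by (simp add: emeasure_eq_measure measure_le_0_iff)
  then show ?thesis
    by (intro AE_I[OF _ _ S]) auto
qed

end

end

subclass (in chilbert_space) banach ..

section \<open>Spectral measures on the line\<close>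

text \<open>The symbol of \<open>cayley H\<close> in the spectral parameter: the Cayley map of the
  real line onto the unit circle without 1, the point that corresponds to infinity.\<close>

definition cay :: "real \<Rightarrow> complex" where
  "cay t = (of_real t - \<i>) / (of_real t + \<i>)"

lemma one_plus_square_pos: "0 < 1 + t\<^sup>2" for t :: real
  by (rule add_pos_nonneg) auto

lemma of_real_plus_i_nonzero: "complex_of_real t + \<i> \<noteq> 0" "complex_of_real t - \<i> \<noteq> 0"
  by (simp_all add: complex_eq_iff)

lemma norm_cay [simp]: "norm (cay t) = 1"
proof -
  have "norm (complex_of_real t - \<i>) = norm (complex_of_real t + \<i>)"
    by (simp add: cmod_def)
  then show ?thesis using of_real_plus_i_nonzero[of t] by (simp add: cay_def norm_divide)
qed

lemma cay_measurable [measurable]: "cay \<in> borel_measurable borel"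
  unfolding cay_def[abs_def]
  by (intro borel_measurable_continuous_onI continuous_intros) (simp add: of_real_plus_i_nonzero)

lemma one_minus_cay: "1 - cay t = 2 * \<i> / (of_real t + \<i>)"
  using of_real_plus_i_nonzero[of t] by (simp add: cay_def field_simps)

lemma cnj_cay_minus_one: "cnj (cay t) - 1 = 2 * \<i> / (of_real t - \<i>)"
  using of_real_plus_i_nonzero[of t] by (simp add: cay_def field_simps)

text \<open>\<open>1 - U\<close> is \<open>2 \<i> (H + \<i>)^-1\<close>, so its range contains the
  dense domain of \<open>H\<close>.\<close>

lemma cayley_dense_range:
  fixes H :: "'h::chilbert_space operator"
  assumes sa: "selfadjoint H"
  shows "closure (range (\<lambda>y. y - cayley H y)) = UNIV"
proof -
  have "Domain H \<subseteq> range (\<lambda>y. y - cayley H y)"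
  proof
    fix x assume "x \<in> Domain H"
    then obtain h where h: "(x, h) \<in> H" by blast
    define y where "y = (1 / (2 * \<i>)) *\<^sub>C (h + \<i> *\<^sub>C x)"
    have "resolvent H (- \<i>) (h + \<i> *\<^sub>C x) = x"
      by (rule resolvent_eqI[OF sa]) (simp_all add: h scaleC_minus_left)
    then have "resolvent H (- \<i>) y = (1 / (2 * \<i>)) *\<^sub>C x"
      using clinear_scaleC[OF clinear_resolvent[OF sa, of "- \<i>"]] by (simp add: y_def)
    then have "x = y - cayley H y"
      by (simp add: cayley_def scaleC_scaleC)
    then show "x \<in> range (\<lambda>y. y - cayley H y)" by blast
  qed
  then show ?thesis
    using closure_mono[of "Domain H"] selfadjoint_dense[OF sa] by auto
qed

text \<open>The circle measure is pushed forward by the inverse Cayley map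
  \<open>\<i> (1 + u) / (1 - u)\<close>. Absence of an atom at 1 means that no mass is lost at
  infinity.\<close>

lemma cayley_moment_measure_exists:
  fixes H :: "'h::chilbert_space operator"
  assumes sa: "selfadjoint H"
  shows "\<exists>M. finite_measure M \<and> sets M = sets borel \<and>
    (\<forall>k. (\<integral>t. cay t ^ k \<partial>M) = cinner x ((cayley H ^^ k) x))"
proof -
  note up = unitary_pair_cayley[OF sa]
  obtain N where fin: "finite_measure N" and sets_N [measurable_cong]: "sets N = sets borel"
    and mom: "\<And>k. (\<integral>t. (cis t) ^ k \<partial>N) = cinner x ((cayley H ^^ k) x)"
    using moment_measure_exists[OF up, of x] by blast
  interpret finite_measure N by (rule fin)
  have cis_meas: "cis \<in> borel_measurable N"
    unfolding measurable_cong_sets[OF sets_N refl] cis_conv_exp[abs_def]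
    by (intro borel_measurable_continuous_onI continuous_intros)
  have no_atom: "AE t in N. cis t \<noteq> 1"
    by (rule moment_measure_no_atom[OF up fin cis_meas _ mom cayley_dense_range[OF sa]]) simp
  \<comment> \<open>The quotient is already real on the circle away from 1, so \<open>Re\<close>
    only adjusts the type; its value at 1 concerns a null set.\<close>
  define T where "T t = Re (\<i> * (1 + cis t) / (1 - cis t))" for t
  have T [measurable]: "T \<in> borel_measurable N"
    unfolding T_def using cis_meas by measurable
  have cay_T: "cay (T t) = cis t" if "cis t \<noteq> 1" for t
  proof -
    define u where "u = cis t"
    have u: "u \<noteq> 1" "u \<noteq> 0" "cnj u = 1 / u"
      using that by (auto simp: u_def cis_cnj cis_divide[of 0 t, simplified])
    define z where "z = \<i> * (1 + u) / (1 - u)"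
    have nz: "1 - u \<noteq> 0" "u - 1 \<noteq> 0" using u by auto
    have "cnj z = - \<i> * (1 + 1 / u) / (1 - 1 / u)" by (simp add: z_def u(3))
    also have "\<dots> = z"
    proof -
      have "1 - 1 / u \<noteq> 0" using u by auto
      then show ?thesis using u nz by (simp add: z_def divide_simps) (simp add: algebra_simps)
    qed
    finally have "complex_of_real (Re z) = z" by (simp add: complex_eq_iff)
    then have "cay (T t) = (z - \<i>) / (z + \<i>)" by (simp add: cay_def T_def z_def u_def)
    also have "z - \<i> = 2 * \<i> * u / (1 - u)" using nz by (simp add: z_def field_simps)
    also have "z + \<i> = 2 * \<i> / (1 - u)" using nz by (simp add: z_def field_simps)
    finally show ?thesis using nz by (simp add: u_def)
  qed
  have "finite_measure (distr N borel T)" by (rule finite_measure_distr) simp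
  moreover have "(\<integral>t. cay t ^ k \<partial>distr N borel T) = cinner x ((cayley H ^^ k) x)" for k
  proof -
    have "(\<integral>t. cay t ^ k \<partial>distr N borel T) = (\<integral>t. cay (T t) ^ k \<partial>N)"
      by (rule integral_distr) measurable
    also have "\<dots> = (\<integral>t. (cis t) ^ k \<partial>N)"
    proof (rule integral_cong_AE)
      show "AE t in N. cay (T t) ^ k = cis t ^ k"
        using no_atom by eventually_elim (simp add: cay_T)
    qed (use cis_meas in measurable)
    finally show ?thesis by (simp add: mom)
  qed
  ultimately show ?thesis by (intro exI[of _ "distr N borel T"]) auto
qed

section \<open>Approximation of half-lines\<close>

text \<open>The real trigonometric polynomial \<open>1 / 2 + (t - a) / ((1 + 2 \<bar>a\<bar>) (1 + t\<^sup>2))\<close> takes values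
  in \<open>[0, 1]\<close>, and it is below \<open>1 / 2\<close> exactly for \<open>t < a\<close>. The polynomials \<open>(1 - s^k)^(k 2^k)\<close> sharpen it to
  the indicator function of the half-line.\<close>

definition halfline_symbol :: "real \<Rightarrow> complex \<Rightarrow> complex" where
  "halfline_symbol a u = 1 / 2 + of_real (1 / (1 + 2 * \<bar>a\<bar>)) *
     ((\<i> / 4) * (u - cnj u) - of_real (a / 4) * (2 - u - cnj u))"

definition halfline_op :: "('h::complex_inner \<Rightarrow> 'h) \<Rightarrow> ('h \<Rightarrow> 'h) \<Rightarrow> real \<Rightarrow> 'h \<Rightarrow> 'h" where
  "halfline_op U V a x = (1 / 2) *\<^sub>C x + of_real (1 / (1 + 2 * \<bar>a\<bar>)) *\<^sub>C
     ((\<i> / 4) *\<^sub>C (U x - V x) - of_real (a / 4) *\<^sub>C (2 *\<^sub>C x - U x - V x))"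

definition halfline_approx :: "('h::complex_inner \<Rightarrow> 'h) \<Rightarrow> ('h \<Rightarrow> 'h) \<Rightarrow> real \<Rightarrow> nat \<Rightarrow> 'h \<Rightarrow> 'h" where
  "halfline_approx U V a k = (\<lambda>y. y - (halfline_op U V a ^^ k) y) ^^ (k * 2 ^ k)"

definition halfline_fun :: "real \<Rightarrow> real \<Rightarrow> real" where
  "halfline_fun a t = 1 / 2 + (1 / (1 + 2 * \<bar>a\<bar>)) * ((t - a) / (1 + t\<^sup>2))"

lemma trig_halfline_op: "trig U V (halfline_symbol a) (halfline_op U V a)"
proof -
  have "trig U V (\<lambda>u. u) U" "trig U V cnj V"
    using trig_U[OF trig_one, of U V] trig_V[OF trig_one, of U V] by simp_all
  then show ?thesis
    unfolding halfline_symbol_def[abs_def] halfline_op_def[abs_def]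
    by (intro trig_add trig_scale trig_diff trig_const)
qed

lemma trig_halfline_approx:
  "trig U V (\<lambda>u. (1 - halfline_symbol a u ^ k) ^ (k * 2 ^ k)) (halfline_approx U V a k)"
  unfolding halfline_approx_def
  by (intro trig_power trig_diff trig_one trig_halfline_op)

text \<open>At \<open>u = cay t\<close> the terms \<open>(\<i> / 4) * (u - cnj u)\<close> and
  \<open>(2 - u - cnj u) / 4\<close> become \<open>t / (1 + t^2)\<close> and
  \<open>1 / (1 + t^2)\<close>.\<close>

lemma halfline_symbol_cay: "halfline_symbol a (cay t) = of_real (halfline_fun a t)"
proof -
  have p: "1 + t\<^sup>2 \<noteq> 0" using one_plus_square_pos[of t] by simp
  have den: "(of_real t + \<i>) * (of_real t - \<i>) = complex_of_real (1 + t\<^sup>2)"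
    by (simp add: algebra_simps power2_eq_square)
  have 1: "2 - cay t - cnj (cay t) = 4 / of_real (1 + t\<^sup>2)"
  proof -
    have "2 - cay t - cnj (cay t) = 2 * \<i> / (of_real t + \<i>) - 2 * \<i> / (of_real t - \<i>)"
      using one_minus_cay[of t] cnj_cay_minus_one[of t] by (simp add: algebra_simps)
    also have "\<dots> = 4 / ((of_real t + \<i>) * (of_real t - \<i>))"
      using of_real_plus_i_nonzero[of t] by (simp add: divide_simps) (simp add: algebra_simps)
    finally show ?thesis by (simp only: den)
  qed
  have 2: "cay t - cnj (cay t) = - (4 * \<i> * of_real t) / of_real (1 + t\<^sup>2)"
  proof -
    have "cay t - cnj (cay t) = - (2 * \<i> / (of_real t + \<i>) + 2 * \<i> / (of_real t - \<i>))"
      using one_minus_cay[of t] cnj_cay_minus_one[of t] by (simp add: algebra_simps)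
    also have "\<dots> = - (4 * \<i> * of_real t) / ((of_real t + \<i>) * (of_real t - \<i>))"
      using of_real_plus_i_nonzero[of t] by (simp add: divide_simps) (simp add: algebra_simps)
    finally show ?thesis by (simp only: den)
  qed
  have "(\<i> / 4) * (cay t - cnj (cay t)) - of_real (a / 4) * (2 - cay t - cnj (cay t))
      = of_real ((t - a) / (1 + t\<^sup>2))"
    unfolding 1 2 using p by (simp add: diff_divide_distrib)
  then show ?thesis
    unfolding halfline_symbol_def halfline_fun_def by simp
qed

text \<open>The normalization rests on
  \<open>2 |t - a| <= 2 |t| + 2 |a| <= (1 + 2 |a|) (1 + t^2)\<close>, which confines the deviation
  from 1/2 to at most 1/2.\<close>

lemma halfline_fun_bounds: "0 \<le> halfline_fun a t" "halfline_fun a t \<le> 1"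
  and halfline_fun_less: "halfline_fun a t < 1 / 2 \<longleftrightarrow> t < a"
proof -
  have p: "0 < 1 + t\<^sup>2" by (rule one_plus_square_pos)
  have k: "0 < 1 + 2 * \<bar>a\<bar>" by (rule add_pos_nonneg) auto
  have "\<bar>t - a\<bar> * 2 \<le> (1 + 2 * \<bar>a\<bar>) * (1 + t\<^sup>2)"
  proof -
    have "2 * \<bar>t\<bar> \<le> 1 + t\<^sup>2" using sum_squares_bound[of 1 "\<bar>t\<bar>"] by simp
    moreover have "0 \<le> \<bar>a\<bar> * t\<^sup>2" by simp
    moreover have "\<bar>t - a\<bar> \<le> \<bar>t\<bar> + \<bar>a\<bar>" by simp
    moreover have "(1 + 2 * \<bar>a\<bar>) * (1 + t\<^sup>2) = 1 + t\<^sup>2 + 2 * \<bar>a\<bar> + 2 * (\<bar>a\<bar> * t\<^sup>2)"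
      by (simp add: algebra_simps)
    ultimately show ?thesis by linarith
  qed
  then have "\<bar>t - a\<bar> / ((1 + 2 * \<bar>a\<bar>) * (1 + t\<^sup>2)) \<le> 1 / 2"
    using p k by (simp add: divide_simps mult.commute)
  then have "\<bar>(1 / (1 + 2 * \<bar>a\<bar>)) * ((t - a) / (1 + t\<^sup>2))\<bar> \<le> 1 / 2"
    using p k by (simp add: abs_mult abs_divide)
  then show "0 \<le> halfline_fun a t" "halfline_fun a t \<le> 1"
    unfolding halfline_fun_def by linarith+
  have "(1 / (1 + 2 * \<bar>a\<bar>)) * ((t - a) / (1 + t\<^sup>2)) < 0 \<longleftrightarrow> t < a"
    using p k by (simp add: mult_less_0_iff divide_less_0_iff zero_less_divide_iff)
  then show "halfline_fun a t < 1 / 2 \<longleftrightarrow> t < a" unfolding halfline_fun_def by linarith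
qed

text \<open>Below 1/2, Bernoulli's inequality bounds the value from below by
  \<open>1 - k (2 s)^k\<close>. From 1/2 on, \<open>1 - s^k <= exp (- (1/2)^k)\<close> bounds it by
  \<open>exp (- k)\<close>. The extra factor \<open>k\<close> in the exponent forces the limit 0 at
  the threshold itself, so the open half-line results.\<close>

lemma sharpening_tendsto:
  fixes s :: real
  assumes s: "0 \<le> s" "s \<le> 1"
  shows "(\<lambda>k. (1 - s ^ k) ^ (k * 2 ^ k)) \<longlonglongrightarrow> (if s < 1 / 2 then 1 else 0)"
proof -
  have pow: "0 \<le> s ^ k" "s ^ k \<le> 1" for k using s by (auto intro: power_le_one)
  show ?thesis
  proof (cases "s < 1 / 2")
    case True
    have "(\<lambda>k. 1 - real k * (2 * s) ^ k) \<longlonglongrightarrow> 1 - 0"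
      using True s by (intro tendsto_diff tendsto_const powser_times_n_limit_0) simp
    then have lower: "(\<lambda>k. 1 - real k * (2 * s) ^ k) \<longlonglongrightarrow> 1" by simp
    have "(\<lambda>k. (1 - s ^ k) ^ (k * 2 ^ k)) \<longlonglongrightarrow> 1"
    proof (rule tendsto_sandwich[OF _ _ lower tendsto_const[of 1]])
      have "1 - real k * (2 * s) ^ k \<le> (1 - s ^ k) ^ (k * 2 ^ k)" for k
        using Bernoulli_inequality[of "- (s ^ k)" "k * 2 ^ k"] pow[of k]
        by (simp add: power_mult_distrib mult_ac)
      then show "\<forall>\<^sub>F k in sequentially. 1 - real k * (2 * s) ^ k \<le> (1 - s ^ k) ^ (k * 2 ^ k)"
        by (intro always_eventually allI)
      show "\<forall>\<^sub>F k in sequentially. (1 - s ^ k) ^ (k * 2 ^ k) \<le> 1"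
        using pow by (intro always_eventually allI power_le_one) auto
    qed
    then show ?thesis using True by simp
  next
    case False
    have upper: "(\<lambda>k. exp (- 1) ^ k) \<longlonglongrightarrow> (0 :: real)"
      by (rule LIMSEQ_power_zero) simp
    have "(\<lambda>k. (1 - s ^ k) ^ (k * 2 ^ k)) \<longlonglongrightarrow> 0"
    proof (rule tendsto_sandwich[OF _ _ tendsto_const[of 0] upper])
      show "\<forall>\<^sub>F k in sequentially. 0 \<le> (1 - s ^ k) ^ (k * 2 ^ k)"
        using pow by (intro always_eventually allI zero_le_power) auto
      have "(1 - s ^ k) ^ (k * 2 ^ k) \<le> exp (- 1) ^ k" for k
      proof -
        have "(1 / 2) ^ k \<le> s ^ k" using False by (intro power_mono) auto
        moreover have "1 + (- ((1 / 2) ^ k)) \<le> exp (- ((1 / 2) ^ k :: real))"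
          by (rule exp_ge_add_one_self)
        ultimately have "1 - s ^ k \<le> exp (- ((1 / 2) ^ k))" by linarith
        then have "(1 - s ^ k) ^ (k * 2 ^ k) \<le> exp (- ((1 / 2) ^ k)) ^ (k * 2 ^ k)"
          using pow by (intro power_mono) auto
        also have "\<dots> = exp (real k * (real (2 ^ k) * (- ((1 / 2) ^ k))))"
          by (simp only: exp_of_nat_mult[symmetric] of_nat_mult mult.assoc)
        also have "real (2 ^ k) * (- ((1 / 2) ^ k)) = - 1"
          by (simp add: power_one_over)
        also have "exp (real k * (- 1)) = exp (- 1) ^ k"
          by (rule exp_of_nat_mult)
        finally show ?thesis .
      qed
      then show "\<forall>\<^sub>F k in sequentially. (1 - s ^ k) ^ (k * 2 ^ k) \<le> exp (- 1) ^ k"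
        by (intro always_eventually allI)
    qed
    then show ?thesis using False by simp
  qed
qed

definition halfline_seq :: "real \<Rightarrow> nat \<Rightarrow> real \<Rightarrow> real" where
  "halfline_seq a k t = (1 - halfline_fun a t ^ k) ^ (k * 2 ^ k)"

lemma halfline_seq:
  shows halfline_seq_symbol: "(1 - halfline_symbol a (cay t) ^ k) ^ (k * 2 ^ k) = of_real (halfline_seq a k t)"
    and halfline_seq_bounds: "0 \<le> halfline_seq a k t" "halfline_seq a k t \<le> 1"
    and halfline_seq_tendsto: "(\<lambda>k. halfline_seq a k t) \<longlonglongrightarrow> indicator {..<a} t"
    and halfline_seq_measurable [measurable]: "halfline_seq a k \<in> borel_measurable borel"
proof -
  note b = halfline_fun_bounds[of a t]
  show "(1 - halfline_symbol a (cay t) ^ k) ^ (k * 2 ^ k) = of_real (halfline_seq a k t)"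
    by (simp add: halfline_symbol_cay halfline_seq_def)
  have "0 \<le> 1 - halfline_fun a t ^ k" "1 - halfline_fun a t ^ k \<le> 1"
    using b by (auto intro: power_le_one)
  then show "0 \<le> halfline_seq a k t" "halfline_seq a k t \<le> 1"
    unfolding halfline_seq_def by (auto intro: power_le_one)
  show "(\<lambda>k. halfline_seq a k t) \<longlonglongrightarrow> indicator {..<a} t"
    using sharpening_tendsto[OF b, unfolded halfline_fun_less]
    by (cases "t < a") (simp_all add: halfline_seq_def)
  show "halfline_seq a k \<in> borel_measurable borel"
    unfolding halfline_seq_def[abs_def] halfline_fun_def[abs_def] by measurable
qed

section \<open>Existence of the spectral resolution\<close>

text \<open>Idempotence is read off from quadratic forms:
  \<open><x, P P x> = <P x, P x> = <x, P x>\<close>.\<close>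

lemma orthogonal_projectionI:
  assumes lin: "clinear P" and sym: "\<And>x y. cinner (P x) y = cinner x (P y)"
    and norm: "\<And>x. cinner x (P x) = of_real ((norm (P x))\<^sup>2)"
  shows "orthogonal_projection P"
proof -
  have "P (P x) = P x" for x
  proof (rule quadratic_form_determines[OF _ lin])
    show "clinear (\<lambda>x. P (P x))" using lin by (auto simp: clinear_def)
    show "cinner x (P (P x)) = cinner x (P x)" for x
      by (simp add: norm sym[symmetric] cinner_self)
  qed
  then show ?thesis using lin sym by (simp add: orthogonal_projection_def)
qed

lemma clinear_limit:
  assumes F: "\<And>k. clinear (F k)" and lim: "\<And>x. (\<lambda>k::nat. F k x) \<longlonglongrightarrow> P x"
  shows "clinear P"
  unfolding clinear_def
proof (intro conjI allI)
  fix x y c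
  have "(\<lambda>k. F k (x + y)) \<longlonglongrightarrow> P x + P y"
    unfolding clinear_add[OF F] by (intro tendsto_add lim)
  then show "P (x + y) = P x + P y" using LIMSEQ_unique lim by blast
  have "(\<lambda>k. F k (c *\<^sub>C x)) \<longlonglongrightarrow> c *\<^sub>C P x"
    unfolding clinear_scaleC[OF F] by (intro tendsto_scaleC lim)
  then show "P (c *\<^sub>C x) = c *\<^sub>C P x" using LIMSEQ_unique lim by blast
qed

lemma Cauchy_of_square_bound:
  fixes f :: "nat \<Rightarrow> 'a::real_normed_vector"
  assumes "\<And>k l. (norm (f k - f l))\<^sup>2 \<le> 2 * e k + 2 * e l" and "e \<longlonglongrightarrow> (0::real)"
  shows "Cauchy f"
proof (rule CauchyI)
  fix d :: real assume d: "d > 0"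
  then have "\<forall>\<^sub>F k in sequentially. e k < d\<^sup>2 / 4"
    using assms(2) by (intro order_tendstoD) auto
  then obtain K where K: "\<And>k. k \<ge> K \<Longrightarrow> e k < d\<^sup>2 / 4"
    by (auto simp: eventually_sequentially)
  have "norm (f k - f l) < d" if "k \<ge> K" "l \<ge> K" for k l
  proof -
    have "(norm (f k - f l))\<^sup>2 < d\<^sup>2"
      using assms(1)[of k l] K[OF that(1)] K[OF that(2)] by linarith
    then show ?thesis using d by (simp add: power2_less_imp_less)
  qed
  then show "\<exists>M. \<forall>m\<ge>M. \<forall>n\<ge>M. norm (f m - f n) < d" by blast
qed

lemma square_diff_bound: "(a - b)\<^sup>2 \<le> 2 * (a - c)\<^sup>2 + 2 * (b - c)\<^sup>2" for a b c :: real
proof -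
  have "0 \<le> ((a - c) + (b - c))\<^sup>2" by simp
  then show ?thesis by (simp add: power2_eq_square algebra_simps)
qed

lemma borel_sigma_halflines: "sets borel = sigma_sets UNIV (range (\<lambda>a::real. {..<a}))"
  by (simp add: borel_Iio)

lemma Int_stable_halflines: "Int_stable (range (\<lambda>a::real. {..<a}))"
proof -
  have "{..<a} \<inter> {..<b} = {..<min a b}" for a b :: real by auto
  then show ?thesis by (auto simp: Int_stable_def)
qed

lemma resolvent_symbol:
  "(1 / (2 * \<i>)) * (1 - cay t) = 1 / (of_real t + \<i>)"
  "(1 / (2 * \<i>)) * (cnj (cay t) - 1) = 1 / (of_real t - \<i>)"
  by (simp_all add: one_minus_cay cnj_cay_minus_one)

lemma resolvent_symbol_mult: "1 / (of_real t - \<i>) * (1 / (of_real t + \<i>)) = complex_of_real (1 / (1 + t\<^sup>2))"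
proof -
  have "(of_real t - \<i>) * (of_real t + \<i>) = complex_of_real (1 + t\<^sup>2)"
    by (simp add: algebra_simps power2_eq_square)
  then show ?thesis by (metis mult_1 of_real_1 of_real_divide times_divide_times_eq)
qed

lemma damping_bounds: "0 \<le> 1 / (1 + t\<^sup>2)" "1 / (1 + t\<^sup>2) \<le> 1" for t :: real
  using one_plus_square_pos[of t] by (auto simp: divide_simps)

text \<open>The measures are chosen for each vector separately, so every relation between
  \<open>\<mu> x\<close> and \<open>\<mu> y\<close> has to be obtained through the
  operators.\<close>

context
  fixes H :: "'h::chilbert_space operator" and \<mu> :: "'h \<Rightarrow> real measure"
  assumes sa: "selfadjoint H" and fin: "\<And>x. finite_measure (\<mu> x)"
    and sets_mu [measurable_cong]: "\<And>x. sets (\<mu> x) = sets borel"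
    and mom: "\<And>x k. (\<integral>t. cay t ^ k \<partial>\<mu> x) = cinner x ((cayley H ^^ k) x)"
begin

abbreviation (input) "trigH \<equiv> trig (cayley H) (cayley_inv H)"

lemma space_mu: "space (\<mu> x) = UNIV"
  using sets_eq_imp_space_eq[OF sets_mu] by simp

lemma cayley_pair: "unitary_pair (cayley H) (cayley_inv H)"
  by (rule unitary_pair_cayley[OF sa])

lemma cay_measurable_mu: "cay \<in> borel_measurable (\<mu> x)"
  by measurable

lemmas trigH_integrable = trig_integrable[OF cayley_pair fin cay_measurable_mu norm_cay mom]
lemmas trigH_integral = trig_integral[OF cayley_pair fin cay_measurable_mu norm_cay mom]
lemmas trigH_norm = trig_norm[OF cayley_pair fin cay_measurable_mu norm_cay mom]
lemmas trigH_clinear = trig_clinear[OF cayley_pair]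

lemma measure_mu_UNIV: "measure (\<mu> x) UNIV = (norm x)\<^sup>2"
proof -
  have "complex_of_real (measure (\<mu> x) UNIV) = of_real ((norm x)\<^sup>2)"
    using mom[of x 0] by (simp add: space_mu cinner_self scaleR_conv_of_real)
  then show ?thesis using of_real_eq_iff by blast
qed

text \<open>A symbol that is real along \<open>cay\<close> agrees there with its conjugate, so the
  operator and its adjoint have the same quadratic form.\<close>

lemma trigH_real_selfadjoint:
  assumes f: "trigH f F" and real: "\<And>t. f (cay t) = of_real (g t)"
  shows "cinner (F x) y = cinner x (F y)"
proof -
  obtain F' where F': "trigH (\<lambda>u. cnj (f u)) F'" "\<And>x y. cinner x (F y) = cinner (F' x) y"
    using trig_adjoint[OF cayley_pair f] by blast
  have "F' z = F z" for z
  proof (rule quadratic_form_determines[OF trigH_clinear[OF F'(1)] trigH_clinear[OF f]])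
    show "cinner x (F' x) = cinner x (F x)" for x
      unfolding trigH_integral[OF F'(1), symmetric] trigH_integral[OF f, symmetric] by (simp add: real)
  qed
  then show ?thesis using F'(2) by metis
qed

lemma integral_real_limit:
  fixes g :: "nat \<Rightarrow> real \<Rightarrow> real"
  assumes [measurable]: "\<And>k. g k \<in> borel_measurable borel" "h \<in> borel_measurable borel"
    and b: "integrable (\<mu> x) b" "\<And>k t. \<bar>g k t\<bar> \<le> b t" and lim: "\<And>t. (\<lambda>k. g k t) \<longlonglongrightarrow> h t"
  shows "(\<lambda>k. \<integral>t. g k t \<partial>\<mu> x) \<longlonglongrightarrow> (\<integral>t. h t \<partial>\<mu> x)"
  by (rule integral_dominated_convergence[where w = b]) (use b lim in \<open>auto\<close>)

text \<open>The symbols converge in mean square, so the operators converge strongly by the isometry.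
  An indicator equals its square, so the limiting form and the limiting squared norm are the same
  measure, which makes the limit a projection.\<close>

lemma trigH_indicator_limit:
  assumes f: "\<And>k. trigH (f k) (F k)" and g: "\<And>k t. f k (cay t) = of_real (g k t)"
    and [measurable]: "\<And>k. g k \<in> borel_measurable borel" "A \<in> sets borel"
    and bounds: "\<And>k t. 0 \<le> g k t" "\<And>k t. g k t \<le> 1"
    and lim: "\<And>t. (\<lambda>k. g k t) \<longlonglongrightarrow> indicator A t"
  shows "\<exists>P. orthogonal_projection P \<and> (\<forall>x. (\<lambda>k. F k x) \<longlonglongrightarrow> P x) \<and>
    (\<forall>x. cinner x (P x) = of_real (measure (\<mu> x) A))"
proof -
  have one: "integrable (\<mu> x) (\<lambda>t. 1 :: real)" for x
    using finite_measure.integrable_const[OF fin] .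
  have int: "integrable (\<mu> x) (\<lambda>t. h t :: real)"
    if "h \<in> borel_measurable borel" "\<And>t. \<bar>h t\<bar> \<le> 1" for h x
    by (rule Bochner_Integration.integrable_bound[OF one]) (use that in auto)
  have sq: "\<bar>r\<^sup>2\<bar> \<le> 1" if "\<bar>r\<bar> \<le> 1" for r :: real
    using that by (simp add: abs_square_le_1)
  have dev: "\<bar>g k t - indicator A t\<bar> \<le> 1" "\<bar>g k t - g l t\<bar> \<le> 1" for k l t
    using bounds[of k t] bounds[of l t] by (auto simp: indicator_def)
  define e where "e x k = (\<integral>t. (g k t - indicator A t)\<^sup>2 \<partial>\<mu> x)" for x k
  have e: "e x \<longlonglongrightarrow> 0" for x
  proof -
    have "(\<lambda>k. (g k t - indicator A t)\<^sup>2) \<longlonglongrightarrow> 0" for t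
      using tendsto_power[OF LIM_zero[OF lim[of t]], of 2] by simp
    then have "(\<lambda>k. \<integral>t. (g k t - indicator A t)\<^sup>2 \<partial>\<mu> x) \<longlonglongrightarrow> (\<integral>t. 0 \<partial>\<mu> x)"
      using dev by (intro integral_real_limit[OF _ _ one] sq) auto
    then show ?thesis by (simp add: e_def[abs_def])
  qed
  have "Cauchy (\<lambda>k. F k x)" for x
  proof (rule Cauchy_of_square_bound[OF _ e[of x]])
    fix k l
    have "(norm (F k x - F l x))\<^sup>2 = (\<integral>t. (norm (f k (cay t) - f l (cay t)))\<^sup>2 \<partial>\<mu> x)"
      by (rule trigH_norm[OF trig_diff[OF f f]])
    also have "\<dots> = (\<integral>t. (g k t - g l t)\<^sup>2 \<partial>\<mu> x)"
      by (simp add: g of_real_diff[symmetric] del: of_real_diff)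
    also have "\<dots> \<le> (\<integral>t. 2 * (g k t - indicator A t)\<^sup>2 + 2 * (g l t - indicator A t)\<^sup>2 \<partial>\<mu> x)"
      using dev by (intro integral_mono Bochner_Integration.integrable_add integrable_mult_right
          int sq square_diff_bound) auto
    also have "\<dots> = 2 * e x k + 2 * e x l"
      unfolding e_def using dev
      by (subst Bochner_Integration.integral_add) (auto intro!: integrable_mult_right int sq)
    finally show "(norm (F k x - F l x))\<^sup>2 \<le> 2 * e x k + 2 * e x l" .
  qed
  then have "\<forall>x. \<exists>p. (\<lambda>k. F k x) \<longlonglongrightarrow> p"
    using Cauchy_convergent convergent_def by blast
  then obtain P where P: "\<And>x. (\<lambda>k. F k x) \<longlonglongrightarrow> P x" by metis
  have form: "cinner x (P x) = of_real (measure (\<mu> x) A)" for x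
  proof (rule LIMSEQ_unique)
    show "(\<lambda>k. cinner x (F k x)) \<longlonglongrightarrow> cinner x (P x)"
      by (intro tendsto_cinner tendsto_const P)
    have "(\<lambda>k. \<integral>t. g k t \<partial>\<mu> x) \<longlonglongrightarrow> (\<integral>t. indicator A t \<partial>\<mu> x)"
      using bounds by (intro integral_real_limit[OF _ _ one] lim) auto
    then have "(\<lambda>k. complex_of_real (\<integral>t. g k t \<partial>\<mu> x)) \<longlonglongrightarrow> of_real (measure (\<mu> x) A)"
      by (intro tendsto_of_real) (simp add: space_mu)
    moreover have "cinner x (F k x) = of_real (\<integral>t. g k t \<partial>\<mu> x)" for k
      using trigH_integral[OF f[of k], of x] by (simp add: g)
    ultimately show "(\<lambda>k. cinner x (F k x)) \<longlonglongrightarrow> of_real (measure (\<mu> x) A)" by simp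
  qed
  have norm: "(norm (P x))\<^sup>2 = measure (\<mu> x) A" for x
  proof (rule LIMSEQ_unique)
    show "(\<lambda>k. (norm (F k x))\<^sup>2) \<longlonglongrightarrow> (norm (P x))\<^sup>2"
      by (intro tendsto_intros P)
    have "(\<lambda>k. (g k t)\<^sup>2) \<longlonglongrightarrow> indicator A t" for t
    proof -
      have "(indicator A t)\<^sup>2 = (indicator A t :: real)" by (simp add: indicator_def)
      then show ?thesis using tendsto_power[OF lim[of t], of 2] by simp
    qed
    then have "(\<lambda>k. \<integral>t. (g k t)\<^sup>2 \<partial>\<mu> x) \<longlonglongrightarrow> (\<integral>t. indicator A t \<partial>\<mu> x)"
      using bounds by (intro integral_real_limit[OF _ _ one] sq) auto
    then show "(\<lambda>k. (norm (F k x))\<^sup>2) \<longlonglongrightarrow> measure (\<mu> x) A"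
      unfolding trigH_norm[OF f] by (simp add: g space_mu)
  qed
  have "orthogonal_projection P"
  proof (rule orthogonal_projectionI)
    show "clinear P" by (rule clinear_limit[OF trigH_clinear[OF f] P])
    fix x y
    have "(\<lambda>k. cinner (F k x) y) \<longlonglongrightarrow> cinner (P x) y" "(\<lambda>k. cinner x (F k y)) \<longlonglongrightarrow> cinner x (P y)"
      by (intro tendsto_cinner tendsto_const P)+
    then show "cinner (P x) y = cinner x (P y)"
      unfolding trigH_real_selfadjoint[OF f g] using LIMSEQ_unique by blast
    show "cinner x (P x) = of_real ((norm (P x))\<^sup>2)" by (simp add: form norm)
  qed
  then show ?thesis using P form by blast
qed

section \<open>Extension of the projections from half-lines to Borel sets\<close>

definition spectral_proj :: "real set \<Rightarrow> ('h \<Rightarrow> 'h) \<Rightarrow> bool" where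
  "spectral_proj A P \<longleftrightarrow> orthogonal_projection P \<and> (\<forall>x. cinner x (P x) = of_real (measure (\<mu> x) A))"

lemma spectral_projD:
  assumes "spectral_proj A P"
  shows "orthogonal_projection P" "(norm (P x))\<^sup>2 = measure (\<mu> x) A"
proof -
  show P: "orthogonal_projection P" using assms by (simp add: spectral_proj_def)
  have "complex_of_real ((norm (P x))\<^sup>2) = of_real (measure (\<mu> x) A)"
    using assms orthogonal_projectionD(4)[OF P, of x] by (simp add: spectral_proj_def)
  then show "(norm (P x))\<^sup>2 = measure (\<mu> x) A" using of_real_eq_iff by blast
qed

lemma spectral_projI:
  "orthogonal_projection P \<Longrightarrow> (\<And>x. (norm (P x))\<^sup>2 = measure (\<mu> x) A) \<Longrightarrow> spectral_proj A P"
  using orthogonal_projectionD(4)[of P] by (simp add: spectral_proj_def)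

lemma spectral_proj_unique:
  assumes "spectral_proj A P" "spectral_proj A Q"
  shows "P x = Q x"
  using assms orthogonal_projectionD(1) by (intro quadratic_form_determines) (auto simp: spectral_proj_def)

text \<open>Apply additivity of the measure at the vector \<open>Q x\<close>: its whole mass already
  sits on \<open>B\<close>.\<close>

lemma spectral_proj_disjoint:
  assumes "spectral_proj A P" "spectral_proj B Q" "A \<in> sets borel" "B \<in> sets borel" "A \<inter> B = {}"
  shows "P (Q x) = 0"
proof -
  interpret finite_measure "\<mu> y" for y by (rule fin)
  have "measure (\<mu> (Q x)) A + measure (\<mu> (Q x)) B = measure (\<mu> (Q x)) (A \<union> B)"
    using assms by (intro finite_measure_Union[symmetric]) (auto simp: sets_mu)
  also have "\<dots> \<le> measure (\<mu> (Q x)) UNIV"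
    using assms by (intro finite_measure_mono) (auto simp: sets_mu)
  finally have "(norm (P (Q x)))\<^sup>2 + (norm (Q (Q x)))\<^sup>2 \<le> (norm (Q x))\<^sup>2"
    by (simp add: spectral_projD(2)[OF assms(1)] spectral_projD(2)[OF assms(2)] measure_mu_UNIV)
  then show ?thesis
    by (simp add: orthogonal_projectionD(2)[OF spectral_projD(1)[OF assms(2)]])
qed

text \<open>The summands are mutually orthogonal, so squared norms of blocks of the series are sums
  of masses of the \<open>A n\<close>; countable additivity of the measure makes these small and
  identifies the limit.\<close>

lemma spectral_proj_union:
  fixes A :: "nat \<Rightarrow> real set"
  assumes P: "\<And>n. spectral_proj (A n) (P n)" and A: "\<And>n. A n \<in> sets borel" and disj: "disjoint_family A"
  shows "\<exists>Q. spectral_proj (\<Union>n. A n) Q \<and> (\<forall>x. (\<lambda>n. P n x) sums Q x)"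
proof -
  note Pn = orthogonal_projectionD[OF spectral_projD(1)[OF P]]
  interpret finite_measure "\<mu> y" for y by (rule fin)
  have orth: "cinner (P n x) (P m y) = 0" if "n \<noteq> m" for n m x y
    using spectral_proj_disjoint[OF P P A A, of n m y] disj that
    by (simp add: Pn(3) disjoint_family_on_def)
  have norm_sum: "(norm (\<Sum>n\<in>S. P n x))\<^sup>2 = (\<Sum>n\<in>S. measure (\<mu> x) (A n))" if "finite S" for S x
  proof -
    have "cinner (\<Sum>n\<in>S. P n x) (\<Sum>n\<in>S. P n x) = (\<Sum>n\<in>S. \<Sum>m\<in>S. cinner (P m x) (P n x))"
      by (simp add: cinner_sum_left cinner_sum_right)
    also have "\<dots> = (\<Sum>n\<in>S. \<Sum>m\<in>S. if m = n then of_real (measure (\<mu> x) (A n)) else 0)"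
      by (intro sum.cong refl)
        (auto simp: orth cinner_self spectral_projD(2)[OF P, symmetric])
    also have "\<dots> = of_real (\<Sum>n\<in>S. measure (\<mu> x) (A n))"
      using that by (simp add: sum.delta)
    finally show ?thesis unfolding cinner_self using of_real_eq_iff by blast
  qed
  have meas: "(\<lambda>n. measure (\<mu> x) (A n)) sums measure (\<mu> x) (\<Union>n. A n)" for x
    using A disj by (intro finite_measure_UNION) (auto simp: sets_mu)
  have "summable (\<lambda>n. P n x)" for x
    unfolding summable_Cauchy
  proof (intro allI impI)
    fix e :: real assume e: "e > 0"
    then obtain N where N: "\<And>m n. m \<ge> N \<Longrightarrow> norm (\<Sum>k = m..<n. measure (\<mu> x) (A k)) < e\<^sup>2"
      using sums_summable[OF meas[of x]] unfolding summable_Cauchy by (meson zero_less_power)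
    have "norm (\<Sum>k = m..<n. P k x) < e" if "m \<ge> N" for m n
    proof -
      have "(norm (\<Sum>k = m..<n. P k x))\<^sup>2 < e\<^sup>2"
        using N[OF that, of n] by (simp add: norm_sum)
      then show ?thesis using e by (simp add: power2_less_imp_less)
    qed
    then show "\<exists>N. \<forall>m\<ge>N. \<forall>n. norm (\<Sum>k = m..<n. P k x) < e" by blast
  qed
  then obtain Q where Q: "\<And>x. (\<lambda>n. P n x) sums Q x"
    unfolding summable_def by metis
  then have lim: "\<And>x. (\<lambda>k. \<Sum>n<k. P n x) \<longlonglongrightarrow> Q x" by (simp add: sums_def)
  have norm: "(norm (Q x))\<^sup>2 = measure (\<mu> x) (\<Union>n. A n)" for x
  proof (rule LIMSEQ_unique)
    show "(\<lambda>k. (norm (\<Sum>n<k. P n x))\<^sup>2) \<longlonglongrightarrow> (norm (Q x))\<^sup>2"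
      by (intro tendsto_intros lim)
    show "(\<lambda>k. (norm (\<Sum>n<k. P n x))\<^sup>2) \<longlonglongrightarrow> measure (\<mu> x) (\<Union>n. A n)"
      using meas[of x] by (simp add: norm_sum sums_def)
  qed
  have "orthogonal_projection Q"
  proof (rule orthogonal_projectionI)
    have "clinear (\<lambda>x. \<Sum>n<k. P n x)" for k
      unfolding clinear_def
      by (induction k) (simp_all add: clinear_add[OF Pn(1)] clinear_scaleC[OF Pn(1)] scaleC_add_right)
    then show "clinear Q" by (rule clinear_limit[OF _ lim])
    fix x y
    have "(\<lambda>k. cinner (\<Sum>n<k. P n x) y) \<longlonglongrightarrow> cinner (Q x) y"
      "(\<lambda>k. cinner x (\<Sum>n<k. P n y)) \<longlonglongrightarrow> cinner x (Q y)"
      by (intro tendsto_cinner tendsto_const lim)+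
    then show "cinner (Q x) y = cinner x (Q y)"
      unfolding cinner_sum_left cinner_sum_right Pn(3) using LIMSEQ_unique by blast
    have "(\<lambda>k. cinner x (\<Sum>n<k. P n x)) \<longlonglongrightarrow> cinner x (Q x)"
      by (intro tendsto_cinner tendsto_const lim)
    moreover have "cinner x (\<Sum>n<k. P n x) = of_real (\<Sum>n<k. measure (\<mu> x) (A n))" for k
      using P by (simp add: cinner_sum_right spectral_proj_def)
    moreover have "(\<lambda>k. complex_of_real (\<Sum>n<k. measure (\<mu> x) (A n))) \<longlonglongrightarrow> of_real (measure (\<mu> x) (\<Union>n. A n))"
      using meas[of x] unfolding sums_def by (rule tendsto_of_real)
    ultimately have "cinner x (Q x) = of_real (measure (\<mu> x) (\<Union>n. A n))"
      using LIMSEQ_unique by force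
    then show "cinner x (Q x) = of_real ((norm (Q x))\<^sup>2)" by (simp add: norm)
  qed
  then have "spectral_proj (\<Union>n. A n) Q" by (rule spectral_projI) (rule norm)
  then show ?thesis using Q by blast
qed

lemma halfline_projection:
  "\<exists>P. spectral_proj {..<a} P \<and> (\<forall>x. (\<lambda>k. halfline_approx (cayley H) (cayley_inv H) a k x) \<longlonglongrightarrow> P x)"
proof -
  have "\<exists>P. orthogonal_projection P \<and>
      (\<forall>x. (\<lambda>k. halfline_approx (cayley H) (cayley_inv H) a k x) \<longlonglongrightarrow> P x) \<and>
      (\<forall>x. cinner x (P x) = of_real (measure (\<mu> x) {..<a}))"
    by (rule trigH_indicator_limit[OF trig_halfline_approx halfline_seq_symbol halfline_seq_measurable
          _ halfline_seq_bounds halfline_seq_tendsto]) simp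
  then show ?thesis by (auto simp: spectral_proj_def)
qed

text \<open>Half-lines are stable under intersection, so closure under complements and disjoint
  unions is enough.\<close>

lemma spectral_proj_exists:
  assumes "A \<in> sets borel"
  shows "\<exists>P. spectral_proj A P"
proof -
  have "A \<in> sigma_sets UNIV (range (\<lambda>a::real. {..<a}))"
    using assms by (simp add: borel_sigma_halflines)
  with Int_stable_halflines subset_UNIV[of "range (\<lambda>a::real. {..<a})", folded Pow_UNIV] show ?thesis
  proof (induction rule: sigma_sets_induct_disjoint[consumes 3])
    case (basic A)
    then show ?case using halfline_projection by blast
  next
    case empty
    have "orthogonal_projection (\<lambda>x::'h. 0)"
      by (simp add: orthogonal_projection_def clinear_def)
    then show ?case by (auto simp: spectral_proj_def intro!: exI[of _ "\<lambda>x. 0"])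
  next
    case (compl A)
    then obtain P where P: "spectral_proj A P" by blast
    note PD = spectral_projD[OF P]
    have A: "A \<in> sets borel" using compl by (simp add: borel_sigma_halflines)
    have "(norm (x - P x))\<^sup>2 = measure (\<mu> x) (UNIV - A)" for x
    proof -
      have "measure (\<mu> x) (UNIV - A) = (norm x)\<^sup>2 - (norm (P x))\<^sup>2"
        using finite_measure.finite_measure_compl[OF fin, of A x] A
        by (simp add: space_mu sets_mu measure_mu_UNIV PD(2))
      then show ?thesis using norm_projection_pythagoras[OF PD(1), of x] by simp
    qed
    then have "spectral_proj (UNIV - A) (\<lambda>x. x - P x)"
      by (intro spectral_projI orthogonal_projection_complement PD(1))
    then show ?case by blast
  next
    case (union A)
    then obtain P where P: "\<And>n. spectral_proj (A n) (P n)" by metis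
    have "A n \<in> sets borel" for n using union by (auto simp: borel_sigma_halflines)
    from spectral_proj_union[OF P this union(1)] show ?case by blast
  qed
qed

lemma spectral_resolution_candidate:
  "\<exists>E. projection_valued_measure E \<and> (\<forall>x. scalar_spectral_measure E x = \<mu> x) \<and>
    (\<forall>a x. (\<lambda>k. halfline_approx (cayley H) (cayley_inv H) a k x) \<longlonglongrightarrow> E {..<a} x)"
proof -
  \<comment> \<open>The values are chosen independently of each other; uniqueness makes the choices
    compatible with countable additivity.\<close>
  define E where "E A = (SOME P. spectral_proj A P)" for A
  have E: "spectral_proj A (E A)" if "A \<in> sets borel" for A
    unfolding E_def using someI_ex[OF spectral_proj_exists[OF that]] .
  have pvm: "projection_valued_measure E"
    unfolding projection_valued_measure_def
  proof (intro conjI ballI allI impI)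
    show "orthogonal_projection (E A)" if "A \<in> sets borel" for A
      using spectral_projD(1)[OF E[OF that]] .
    have "spectral_proj UNIV (\<lambda>x. x)"
      by (rule spectral_projI) (simp_all add: orthogonal_projection_def clinear_def measure_mu_UNIV)
    then show "E UNIV x = x" for x
      by (intro spectral_proj_unique[OF E]) simp_all
    fix A :: "nat \<Rightarrow> real set" and x
    assume A: "range A \<subseteq> sets borel" "disjoint_family A"
    then have An: "A n \<in> sets borel" for n by auto
    obtain Q where Q: "spectral_proj (\<Union>n. A n) Q" "\<And>x. (\<lambda>n. E (A n) x) sums Q x"
      using spectral_proj_union[OF E[OF An] An A(2)] by blast
    have "Q x = E (\<Union>n. A n) x"
      using An by (intro spectral_proj_unique[OF Q(1)] E) auto
    then show "(\<lambda>n. E (A n) x) sums E (\<Union>n. A n) x" using Q(2)[of x] by simp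
  qed
  moreover have "scalar_spectral_measure E x = \<mu> x" for x
  proof (rule measure_eqI)
    show "emeasure (scalar_spectral_measure E x) A = emeasure (\<mu> x) A"
      if "A \<in> sets (scalar_spectral_measure E x)" for A
      using that by (simp add: sets_scalar[OF pvm] emeasure_scalar[OF pvm] spectral_projD(2)[OF E]
          finite_measure.emeasure_eq_measure[OF fin])
  qed (simp add: sets_scalar[OF pvm] sets_mu)
  moreover have "(\<lambda>k. halfline_approx (cayley H) (cayley_inv H) a k x) \<longlonglongrightarrow> E {..<a} x" for a x
  proof -
    obtain P where P: "spectral_proj {..<a} P"
      "\<And>x. (\<lambda>k. halfline_approx (cayley H) (cayley_inv H) a k x) \<longlonglongrightarrow> P x"
      using halfline_projection by blast
    have "P x = E {..<a} x" by (rule spectral_proj_unique[OF P(1) E]) simp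
    then show ?thesis using P(2)[of x] by simp
  qed
  ultimately show ?thesis by blast
qed

section \<open>The domain and the form of \<open>H\<close> in terms of the measures\<close>

lemma resolvent_eq_cayley:
  "resolvent H (- \<i>) y = (1 / (2 * \<i>)) *\<^sub>C (y - cayley H y)"
  "resolvent H \<i> y = (1 / (2 * \<i>)) *\<^sub>C (cayley_inv H y - y)"
  by (simp_all add: cayley_def cayley_inv_def scaleC_scaleC)

lemma trigH_resolvent:
  "trigH (\<lambda>u. (1 / (2 * \<i>)) * (1 - u)) (resolvent H (- \<i>))"
  "trigH (\<lambda>u. (1 / (2 * \<i>)) * (cnj u - 1)) (resolvent H \<i>)"
proof -
  have UV: "trigH (\<lambda>u. u) (cayley H)" "trigH (\<lambda>u. cnj u) (cayley_inv H)"
    using trig_U[OF trig_one, of "cayley H" "cayley_inv H"] trig_V[OF trig_one, of "cayley H" "cayley_inv H"]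
    by simp_all
  show "trigH (\<lambda>u. (1 / (2 * \<i>)) * (1 - u)) (resolvent H (- \<i>))"
    unfolding resolvent_eq_cayley[abs_def] by (rule trig_scale[OF trig_diff[OF trig_one UV(1)]])
  show "trigH (\<lambda>u. (1 / (2 * \<i>)) * (cnj u - 1)) (resolvent H \<i>)"
    unfolding resolvent_eq_cayley[abs_def] by (rule trig_scale[OF trig_diff[OF UV(2) trig_one]])
qed

text \<open>For a half-line approximant \<open>F\<close>, the form at \<open>(H + \<i>)^-1 y\<close>
  is that of \<open>(H - \<i>)^-1 F (H + \<i>)^-1\<close> at \<open>y\<close>, whose symbol carries
  the extra factor \<open>1 / (1 + t^2)\<close>. In the limit this fixes the masses of half-lines,
  hence the measure.\<close>

lemma scalar_resolvent:
  "\<mu> (resolvent H (- \<i>) y) = density (\<mu> y) (\<lambda>t. ennreal (1 / (1 + t\<^sup>2)))"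
proof -
  define x where "x = resolvent H (- \<i>) y"
  have one: "integrable (\<mu> z) (\<lambda>t. 1 :: real)" for z
    using finite_measure.integrable_const[OF fin] .
  have half: "measure (\<mu> x) {..<a} = (\<integral>t. indicator {..<a} t / (1 + t\<^sup>2) \<partial>\<mu> y)" for a
  proof (rule LIMSEQ_unique)
    let ?F = "halfline_approx (cayley H) (cayley_inv H) a"
    have "(\<lambda>k. \<integral>t. halfline_seq a k t \<partial>\<mu> x) \<longlonglongrightarrow> (\<integral>t. indicator {..<a} t \<partial>\<mu> x)"
      by (rule integral_real_limit[OF _ _ one]) (auto simp: halfline_seq_bounds halfline_seq_tendsto)
    then show "(\<lambda>k. \<integral>t. halfline_seq a k t \<partial>\<mu> x) \<longlonglongrightarrow> measure (\<mu> x) {..<a}"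
      by (simp add: space_mu)
    have "(\<integral>t. halfline_seq a k t \<partial>\<mu> x) = (\<integral>t. halfline_seq a k t / (1 + t\<^sup>2) \<partial>\<mu> y)" for k
    proof -
      have "complex_of_real (\<integral>t. halfline_seq a k t \<partial>\<mu> x) = cinner x (?F k x)"
        using trigH_integral[OF trig_halfline_approx[of _ _ a k], of x] by (simp add: halfline_seq_symbol)
      also have "\<dots> = cinner y (resolvent H \<i> (?F k (resolvent H (- \<i>) y)))"
        using resolvent_adjoint[OF sa, of \<i> y "?F k x"] by (simp add: x_def)
      also have "\<dots> = (\<integral>t. (1 / (of_real t - \<i>)) * (of_real (halfline_seq a k t) * (1 / (of_real t + \<i>))) \<partial>\<mu> y)"
        using trigH_integral[OF trig_mult[OF trigH_resolvent(2)
            trig_mult[OF trig_halfline_approx[of _ _ a k] trigH_resolvent(1)]], of y]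
        by (simp only: resolvent_symbol halfline_seq_symbol)
      also have "(\<lambda>t. (1 / (of_real t - \<i>)) * (of_real (halfline_seq a k t) * (1 / (of_real t + \<i>))))
          = (\<lambda>t. complex_of_real (halfline_seq a k t / (1 + t\<^sup>2)))"
      proof
        fix t
        have "(1 / (of_real t - \<i>)) * (of_real (halfline_seq a k t) * (1 / (of_real t + \<i>)))
            = of_real (halfline_seq a k t) * (1 / (of_real t - \<i>) * (1 / (of_real t + \<i>)))"
          by (simp add: mult_ac)
        also have "\<dots> = complex_of_real (halfline_seq a k t / (1 + t\<^sup>2))"
          unfolding resolvent_symbol_mult by simp
        finally show "(1 / (of_real t - \<i>)) * (of_real (halfline_seq a k t) * (1 / (of_real t + \<i>)))
            = complex_of_real (halfline_seq a k t / (1 + t\<^sup>2))" .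
      qed
      finally show ?thesis by (simp only: integral_complex_of_real of_real_eq_iff)
    qed
    moreover have "(\<lambda>k. \<integral>t. halfline_seq a k t / (1 + t\<^sup>2) \<partial>\<mu> y)
        \<longlonglongrightarrow> (\<integral>t. indicator {..<a} t / (1 + t\<^sup>2) \<partial>\<mu> y)"
    proof (rule integral_real_limit[OF _ _ one])
      show "\<bar>halfline_seq a k t / (1 + t\<^sup>2)\<bar> \<le> 1" for k t
      proof -
        have "halfline_seq a k t * (1 / (1 + t\<^sup>2)) \<le> 1 * 1"
          by (rule mult_mono[OF halfline_seq_bounds(2) damping_bounds(2)]) (simp_all add: damping_bounds(1))
        then show ?thesis using halfline_seq_bounds(1)[of a k t] by simp
      qed
      have "1 + t\<^sup>2 \<noteq> 0" for t :: real using one_plus_square_pos[of t] by simp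
      then show "(\<lambda>k. halfline_seq a k t / (1 + t\<^sup>2)) \<longlonglongrightarrow> indicator {..<a} t / (1 + t\<^sup>2)" for t
        by (intro tendsto_divide tendsto_const halfline_seq_tendsto)
    qed measurable
    ultimately show "(\<lambda>k. \<integral>t. halfline_seq a k t \<partial>\<mu> x) \<longlonglongrightarrow> (\<integral>t. indicator {..<a} t / (1 + t\<^sup>2) \<partial>\<mu> y)"
      by simp
  qed
  have "\<mu> x = density (\<mu> y) (\<lambda>t. ennreal (1 / (1 + t\<^sup>2)))"
  proof (rule measure_eqI_generator_eq[OF Int_stable_halflines, where \<Omega> = UNIV and A = "\<lambda>n. {..<real n}"])
    show "sets (\<mu> x) = sigma_sets UNIV (range lessThan)"
      "sets (density (\<mu> y) (\<lambda>t. ennreal (1 / (1 + t\<^sup>2)))) = sigma_sets UNIV (range lessThan)"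
      by (simp_all add: sets_mu borel_sigma_halflines)
    show "(\<Union>n. {..<real n}) = UNIV" by (auto simp: reals_Archimedean2)
    show "emeasure (\<mu> x) {..<real n} \<noteq> \<infinity>" for n
      using finite_measure.emeasure_finite[OF fin] by simp
    fix X assume "X \<in> range (lessThan :: real \<Rightarrow> _)"
    then obtain a where X: "X = {..<a}" by blast
    have "emeasure (density (\<mu> y) (\<lambda>t. ennreal (1 / (1 + t\<^sup>2)))) X
        = (\<integral>\<^sup>+t. ennreal (indicator {..<a} t / (1 + t\<^sup>2)) \<partial>\<mu> y)"
      unfolding X by (subst emeasure_density) (auto intro!: nn_integral_cong simp: sets_mu indicator_def)
    also have "\<dots> = ennreal (\<integral>t. indicator {..<a} t / (1 + t\<^sup>2) \<partial>\<mu> y)"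
    proof (rule nn_integral_eq_integral)
      show "integrable (\<mu> y) (\<lambda>t. indicator {..<a} t / (1 + t\<^sup>2))"
        by (rule Bochner_Integration.integrable_bound[OF one])
          (use damping_bounds in \<open>auto simp: indicator_def\<close>)
    qed (use damping_bounds(1) in \<open>auto simp: indicator_def\<close>)
    finally show "emeasure (\<mu> x) X = emeasure (density (\<mu> y) (\<lambda>t. ennreal (1 / (1 + t\<^sup>2)))) X"
      by (simp add: X half[symmetric] finite_measure.emeasure_eq_measure[OF fin])
  qed auto
  then show ?thesis by (simp add: x_def)
qed

text \<open>A domain vector is \<open>x = (H + \<i>)^-1 y\<close>, and the density
  \<open>1 / (1 + t^2)\<close> makes the second moment finite. Writing
  \<open>h = y - \<i> x\<close>, the symbol of the form is
  \<open>1 / (t - \<i>) - \<i> / (1 + t^2) = t / (1 + t^2)\<close>.\<close>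

lemma domain_square_integrable:
  assumes "(x, h) \<in> H"
  shows "integrable (\<mu> x) (\<lambda>t. t\<^sup>2)" and "cinner x h = of_real (\<integral>t. t \<partial>\<mu> x)"
proof -
  define y where "y = h + \<i> *\<^sub>C x"
  have x: "resolvent H (- \<i>) y = x"
    by (rule resolvent_eqI[OF sa]) (simp_all add: y_def assms scaleC_minus_left)
  have mu_x: "\<mu> x = density (\<mu> y) (\<lambda>t. ennreal (1 / (1 + t\<^sup>2)))"
    using scalar_resolvent[of y] by (simp add: x)
  have one: "integrable (\<mu> y) (\<lambda>t. 1 :: real)"
    using finite_measure.integrable_const[OF fin] .
  have "integrable (\<mu> y) (\<lambda>t. (1 / (1 + t\<^sup>2)) *\<^sub>R t\<^sup>2)"
  proof (rule Bochner_Integration.integrable_bound[OF one])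
    have "\<bar>(1 / (1 + t\<^sup>2)) * t\<^sup>2\<bar> \<le> 1" for t :: real
      using one_plus_square_pos[of t] by (simp add: divide_simps)
    then show "AE t in \<mu> y. norm ((1 / (1 + t\<^sup>2)) *\<^sub>R t\<^sup>2) \<le> norm (1 :: real)" by simp
  qed measurable
  then show "integrable (\<mu> x) (\<lambda>t. t\<^sup>2)"
    unfolding mu_x by (subst integrable_density) (auto simp: damping_bounds(1))
  have "cinner x h = cinner y (resolvent H \<i> y) - \<i> * cinner y (resolvent H \<i> (resolvent H (- \<i>) y))"
  proof -
    have "h = y - \<i> *\<^sub>C x" by (simp add: y_def)
    then have "cinner x h = cinner x y - \<i> * cinner x x" by (simp add: cinner_simps)
    moreover have "cinner x z = cinner y (resolvent H \<i> z)" for z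
      using resolvent_adjoint[OF sa, of \<i> y z] by (simp add: x)
    ultimately show ?thesis by (metis x)
  qed
  also have "\<dots> = (\<integral>t. 1 / (of_real t - \<i>) \<partial>\<mu> y) - \<i> * (\<integral>t. 1 / (of_real t - \<i>) * (1 / (of_real t + \<i>)) \<partial>\<mu> y)"
    using trigH_integral[OF trigH_resolvent(2), of y]
      trigH_integral[OF trig_mult[OF trigH_resolvent(2,1)], of y]
    by (simp only: resolvent_symbol)
  also have "\<dots> = (\<integral>t. 1 / (of_real t - \<i>) - \<i> * (1 / (of_real t - \<i>) * (1 / (of_real t + \<i>))) \<partial>\<mu> y)"
  proof -
    have "integrable (\<mu> y) (\<lambda>t. 1 / (of_real t - \<i>))"
      "integrable (\<mu> y) (\<lambda>t. 1 / (of_real t - \<i>) * (1 / (of_real t + \<i>)))"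
      using trigH_integrable[OF trigH_resolvent(2), of y]
        trigH_integrable[OF trig_mult[OF trigH_resolvent(2,1)], of y]
      by (simp_all only: resolvent_symbol)
    from Bochner_Integration.integral_diff[OF this(1) integrable_mult_right[OF this(2)]] show ?thesis
      by (simp only: integral_mult_right_zero)
  qed
  also have "(\<lambda>t. 1 / (of_real t - \<i>) - \<i> * (1 / (of_real t - \<i>) * (1 / (of_real t + \<i>))))
      = (\<lambda>t. complex_of_real ((1 / (1 + t\<^sup>2)) *\<^sub>R t))"
  proof
    fix t :: real
    have "1 / (of_real t - \<i>) - \<i> * (1 / (of_real t - \<i>) * (1 / (of_real t + \<i>)))
        = of_real t * (1 / (of_real t - \<i>) * (1 / (of_real t + \<i>)))"
      using of_real_plus_i_nonzero[of t] by (simp add: divide_simps)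
    also have "\<dots> = complex_of_real ((1 / (1 + t\<^sup>2)) *\<^sub>R t)"
      unfolding resolvent_symbol_mult by simp
    finally show "1 / (of_real t - \<i>) - \<i> * (1 / (of_real t - \<i>) * (1 / (of_real t + \<i>)))
        = complex_of_real ((1 / (1 + t\<^sup>2)) *\<^sub>R t)" .
  qed
  also have "(\<integral>t. complex_of_real ((1 / (1 + t\<^sup>2)) *\<^sub>R t) \<partial>\<mu> y) = of_real (\<integral>t. (1 / (1 + t\<^sup>2)) *\<^sub>R t \<partial>\<mu> y)"
    by (rule integral_complex_of_real)
  also have "(\<integral>t. (1 / (1 + t\<^sup>2)) *\<^sub>R t \<partial>\<mu> y) = (\<integral>t. t \<partial>\<mu> x)"
    unfolding mu_x by (rule integral_density[symmetric]) (auto simp: damping_bounds(1))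
  finally show "cinner x h = of_real (\<integral>t. t \<partial>\<mu> x)" .
qed

text \<open>With \<open>b(t) = 1 / (1 + t\<^sup>2)\<close>, the vectors \<open>(H - \<i>)\<^sup>-\<^sup>1 (1 + (1 - b(H)) + \<dots> + (1 - b(H))^(n - 1)) x\<close> approximate \<open>(H + \<i>) x\<close>:
  applying \<open>(H + \<i>)\<^sup>-\<^sup>1\<close> gives \<open>x - (1 - b(H))^n x\<close>.\<close>

lemma square_integrable_domain:
  assumes int: "integrable (\<mu> x) (\<lambda>t. t\<^sup>2)"
  shows "x \<in> Domain H"
proof -
  let ?R = "resolvent H (- \<i>)" and ?S = "resolvent H \<i>"
  define r s where "r u = (1 / (2 * \<i>)) * (1 - u)" and "s u = (1 / (2 * \<i>)) * (cnj u - 1)" for u :: complex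
  define b where "b t = 1 / (1 + t\<^sup>2)" for t :: real
  have tr: "trigH r ?R" "trigH s ?S"
    unfolding r_def[abs_def] s_def[abs_def] by (rule trigH_resolvent)+
  have rs: "r (cay t) = 1 / (of_real t + \<i>)" "s (cay t) = 1 / (of_real t - \<i>)" for t
    by (simp_all only: r_def s_def resolvent_symbol)
  have sr: "s (cay t) * r (cay t) = of_real (b t)" for t
    unfolding rs b_def by (rule resolvent_symbol_mult)
  have bb: "0 < b t" "b t \<le> 1" for t
    using damping_bounds(2)[of t] one_plus_square_pos[of t] by (auto simp: b_def)
  have b_inv: "1 / b t = 1 + t\<^sup>2" for t by (simp add: b_def)
  have b_meas [measurable]: "b \<in> borel_measurable borel" unfolding b_def[abs_def] by measurable
  define D where "D y = y - ?S (?R y)" for y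
  have tD: "trigH (\<lambda>u. 1 - s u * r u) D"
    unfolding D_def[abs_def] by (intro trig_diff trig_one trig_mult tr)
  define Z where "Z n y = ?S (\<Sum>k<n. (D ^^ k) y)" for n y
  have tZ: "trigH (\<lambda>u. s u * (\<Sum>k<n. (1 - s u * r u) ^ k)) (Z n)" for n
    unfolding Z_def[abs_def] by (intro trig_mult tr trig_sum trig_power tD)
  define g where "g n t = (1 - b t) ^ n" for n t
  have g: "0 \<le> g n t" "g n t \<le> 1" for n t
    using bb[of t] by (auto simp: g_def intro: power_le_one)
  have g_lim: "(\<lambda>n. g n t) \<longlonglongrightarrow> 0" for t
    unfolding g_def using bb[of t] by (intro LIMSEQ_power_zero) auto
  have g_meas [measurable]: "g n \<in> borel_measurable borel" for n
    unfolding g_def[abs_def] by measurable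
  have Z_symbol: "s (cay t) * (\<Sum>k<n. (1 - s (cay t) * r (cay t)) ^ k) = s (cay t) * of_real ((1 - g n t) / b t)" for n t
  proof -
    have "(\<Sum>k<n. (1 - b t) ^ k) = (1 - g n t) / b t"
      using bb[of t] by (subst sum_gp_strict) (simp add: g_def)
    then have "complex_of_real (\<Sum>k<n. (1 - b t) ^ k) = of_real ((1 - g n t) / b t)" by simp
    then show ?thesis by (simp add: sr)
  qed
  have norm_s: "(norm (s (cay t)))\<^sup>2 = b t" for t
  proof -
    have "cnj (s (cay t)) = r (cay t)" by (simp add: rs)
    then have "complex_of_real ((norm (s (cay t)))\<^sup>2) = of_real (b t)"
      unfolding complex_norm_square by (simp add: sr)
    then show ?thesis using of_real_eq_iff by blast
  qed
  have one: "integrable (\<mu> x) (\<lambda>t. 1 :: real)"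
    using finite_measure.integrable_const[OF fin] .
  have int1: "integrable (\<mu> x) (\<lambda>t. 1 + t\<^sup>2)" using one int by (rule Bochner_Integration.integrable_add)
  define e where "e n = (\<integral>t. (1 + t\<^sup>2) * (g n t)\<^sup>2 \<partial>\<mu> x)" for n
  have g2: "(g n t)\<^sup>2 \<le> 1" for n t using g[of n t] by (simp add: power_le_one)
  have b_e: "\<bar>(1 + t\<^sup>2) * (g n t)\<^sup>2\<bar> \<le> 1 + t\<^sup>2" for n t
    using mult_left_mono[OF g2[of n t], of "1 + t\<^sup>2"] by simp
  have e: "e \<longlonglongrightarrow> 0"
  proof -
    have "(\<lambda>n. (1 + t\<^sup>2) * (g n t)\<^sup>2) \<longlonglongrightarrow> (1 + t\<^sup>2) * 0\<^sup>2" for t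
      by (intro tendsto_mult tendsto_const tendsto_power g_lim)
    then have "(\<lambda>n. \<integral>t. (1 + t\<^sup>2) * (g n t)\<^sup>2 \<partial>\<mu> x) \<longlonglongrightarrow> (\<integral>t. 0 \<partial>\<mu> x)"
      by (intro integral_real_limit[OF _ _ int1 b_e]) auto
    then show ?thesis by (simp add: e_def[abs_def])
  qed
  have int_e: "integrable (\<mu> x) (\<lambda>t. (1 + t\<^sup>2) * (g n t)\<^sup>2)" for n
    by (rule Bochner_Integration.integrable_bound[OF int1]) (use b_e in auto)
  have "Cauchy (\<lambda>n. Z n x)"
  proof (rule Cauchy_of_square_bound[OF _ e])
    fix k l
    have "(norm (Z k x - Z l x))\<^sup>2 = (\<integral>t. (norm (s (cay t) * of_real ((1 - g k t) / b t)
        - s (cay t) * of_real ((1 - g l t) / b t)))\<^sup>2 \<partial>\<mu> x)"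
      using trigH_norm[OF trig_diff[OF tZ[of k] tZ[of l]], of x] by (simp only: Z_symbol)
    \<comment> \<open>Here the hypothesis enters: the factor \<open>|s|^2 / b^2\<close> equals
      \<open>1 / b = 1 + t^2\<close>, which the second moment makes integrable and
      dominating.\<close>
    also have "\<dots> = (\<integral>t. (1 + t\<^sup>2) * (g k t - g l t)\<^sup>2 \<partial>\<mu> x)"
    proof (rule Bochner_Integration.integral_cong[OF refl])
      fix t
      have "s (cay t) * of_real ((1 - g k t) / b t) - s (cay t) * of_real ((1 - g l t) / b t)
          = s (cay t) * of_real ((g l t - g k t) / b t)"
        using bb(1)[of t] by (simp add: field_simps)
      then have "(norm (s (cay t) * of_real ((1 - g k t) / b t) - s (cay t) * of_real ((1 - g l t) / b t)))\<^sup>2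
          = b t * ((g l t - g k t) / b t)\<^sup>2"
        by (simp only: norm_mult power_mult_distrib norm_s norm_of_real power2_abs)
      also have "\<dots> = (1 / b t) * (g k t - g l t)\<^sup>2"
        using bb(1)[of t] by (simp add: power2_eq_square field_simps)
      finally show "(norm (s (cay t) * of_real ((1 - g k t) / b t) - s (cay t) * of_real ((1 - g l t) / b t)))\<^sup>2
          = (1 + t\<^sup>2) * (g k t - g l t)\<^sup>2"
        by (simp only: b_inv)
    qed
    also have "\<dots> \<le> (\<integral>t. 2 * ((1 + t\<^sup>2) * (g k t)\<^sup>2) + 2 * ((1 + t\<^sup>2) * (g l t)\<^sup>2) \<partial>\<mu> x)"
    proof (rule integral_mono)
      show "integrable (\<mu> x) (\<lambda>t. 2 * ((1 + t\<^sup>2) * (g k t)\<^sup>2) + 2 * ((1 + t\<^sup>2) * (g l t)\<^sup>2))"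
        by (intro Bochner_Integration.integrable_add integrable_mult_right int_e)
      have le: "(1 + t\<^sup>2) * (g k t - g l t)\<^sup>2 \<le> 2 * ((1 + t\<^sup>2) * (g k t)\<^sup>2) + 2 * ((1 + t\<^sup>2) * (g l t)\<^sup>2)" for t
        using mult_left_mono[OF square_diff_bound[of "g k t" "g l t" 0], of "1 + t\<^sup>2"]
        by (simp add: algebra_simps)
      show "(1 + t\<^sup>2) * (g k t - g l t)\<^sup>2 \<le> 2 * ((1 + t\<^sup>2) * (g k t)\<^sup>2) + 2 * ((1 + t\<^sup>2) * (g l t)\<^sup>2)" for t
        by (rule le)
      show "integrable (\<mu> x) (\<lambda>t. (1 + t\<^sup>2) * (g k t - g l t)\<^sup>2)"
        by (rule Bochner_Integration.integrable_bound[where f = "\<lambda>t. 2 * ((1 + t\<^sup>2) * (g k t)\<^sup>2) + 2 * ((1 + t\<^sup>2) * (g l t)\<^sup>2)"])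
          (use le in \<open>auto intro!: Bochner_Integration.integrable_add integrable_mult_right int_e\<close>)
    qed
    also have "\<dots> = 2 * e k + 2 * e l"
      unfolding e_def by (subst Bochner_Integration.integral_add) (auto intro!: integrable_mult_right int_e)
    finally show "(norm (Z k x - Z l x))\<^sup>2 \<le> 2 * e k + 2 * e l" .
  qed
  then obtain y where y: "(\<lambda>n. Z n x) \<longlonglongrightarrow> y" by (meson Cauchy_convergent convergentD)
  have "(\<lambda>n. (norm (?R (Z n x) - x))\<^sup>2) \<longlonglongrightarrow> 0"
  proof -
    have "(norm (?R (Z n x) - x))\<^sup>2 = (\<integral>t. (g n t)\<^sup>2 \<partial>\<mu> x)" for n
    proof -
      have "(norm (?R (Z n x) - x))\<^sup>2 = (\<integral>t. (norm (r (cay t) * (s (cay t) * of_real ((1 - g n t) / b t)) - 1))\<^sup>2 \<partial>\<mu> x)"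
        using trigH_norm[OF trig_diff[OF trig_mult[OF tr(1) tZ[of n]] trig_one], of x]
        by (simp only: Z_symbol)
      also have "\<dots> = (\<integral>t. (g n t)\<^sup>2 \<partial>\<mu> x)"
      proof (rule Bochner_Integration.integral_cong[OF refl])
        fix t
        have "r (cay t) * (s (cay t) * of_real ((1 - g n t) / b t)) = of_real (b t) * of_real ((1 - g n t) / b t)"
          by (simp only: sr[symmetric] mult_ac)
        also have "\<dots> = of_real (1 - g n t)" using bb(1)[of t] by simp
        finally have "r (cay t) * (s (cay t) * of_real ((1 - g n t) / b t)) - 1 = - of_real (g n t)" by simp
        then show "(norm (r (cay t) * (s (cay t) * of_real ((1 - g n t) / b t)) - 1))\<^sup>2 = (g n t)\<^sup>2"
          by (simp only: norm_minus_cancel norm_of_real power2_abs)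
      qed
      finally show ?thesis .
    qed
    moreover have "(\<lambda>n. \<integral>t. (g n t)\<^sup>2 \<partial>\<mu> x) \<longlonglongrightarrow> (\<integral>t. 0 \<partial>\<mu> x)"
    proof (rule integral_real_limit[OF _ _ one])
      show "(\<lambda>n. (g n t)\<^sup>2) \<longlonglongrightarrow> 0" for t
        using tendsto_power[OF g_lim[of t], of 2] by simp
    qed (use g2 in auto)
    ultimately show ?thesis by simp
  qed
  then have "(\<lambda>n. sqrt ((norm (?R (Z n x) - x))\<^sup>2)) \<longlonglongrightarrow> sqrt 0"
    by (rule tendsto_real_sqrt)
  then have "(\<lambda>n. ?R (Z n x)) \<longlonglongrightarrow> x"
    by (simp add: tendsto_norm_zero_iff LIM_zero_iff)
  moreover have "(\<lambda>n. ?R (Z n x)) \<longlonglongrightarrow> ?R y"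
    by (rule clinear_tendsto[OF clinear_resolvent[OF sa] _ y, where C = 1])
      (use norm_resolvent[OF sa, of "- \<i>"] in auto)
  ultimately have "x = ?R y" by (rule LIMSEQ_unique)
  then show ?thesis using resolvent_mem[OF sa, of "- \<i>" y] by auto
qed

lemma spectral_resolution_of_measures:
  "\<exists>E. spectral_resolution H E \<and>
    (\<forall>a x. (\<lambda>k. halfline_approx (cayley H) (cayley_inv H) a k x) \<longlonglongrightarrow> E {..<a} x)"
proof -
  obtain E where "projection_valued_measure E" "\<And>x. scalar_spectral_measure E x = \<mu> x"
    "\<And>a x. (\<lambda>k. halfline_approx (cayley H) (cayley_inv H) a k x) \<longlonglongrightarrow> E {..<a} x"
    using spectral_resolution_candidate by blast
  moreover have "Domain H = {x. integrable (\<mu> x) (\<lambda>t. t\<^sup>2)}"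
    using domain_square_integrable(1) square_integrable_domain by blast
  ultimately show ?thesis
    using domain_square_integrable(2) by (intro exI[of _ E]) (auto simp: spectral_resolution_def)
qed

end

theorem spectral_resolution_exists:
  fixes H :: "'h::chilbert_space operator"
  assumes sa: "selfadjoint H"
  shows "\<exists>E. spectral_resolution H E \<and>
    (\<forall>a x. (\<lambda>k. halfline_approx (cayley H) (cayley_inv H) a k x) \<longlonglongrightarrow> E {..<a} x)"
proof -
  have "\<forall>x. \<exists>M. finite_measure M \<and> sets M = sets borel \<and>
      (\<forall>k. (\<integral>t. cay t ^ k \<partial>M) = cinner x ((cayley H ^^ k) x))"
    using cayley_moment_measure_exists[OF sa] by blast
  then obtain \<mu> where "\<And>x. finite_measure (\<mu> x)" "\<And>x. sets (\<mu> x) = sets borel"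
    "\<And>x k. (\<integral>t. cay t ^ k \<partial>\<mu> x) = cinner x ((cayley H ^^ k) x)"
    by metis
  then show ?thesis by (rule spectral_resolution_of_measures[OF sa])
qed

section \<open>The spectral projections of a selfadjoint operator\<close>

context
  fixes H :: "'h::chilbert_space operator"
  assumes sa: "selfadjoint H"
begin

lemma spectral_projection_resolution:
  obtains E where "spectral_resolution H E" "\<And>A. A \<in> sets borel \<Longrightarrow> spectral_projection H A = E A"
    "\<And>a x. (\<lambda>k. halfline_approx (cayley H) (cayley_inv H) a k x) \<longlonglongrightarrow> spectral_projection H {..<a} x"
proof -
  obtain E where E: "spectral_resolution H E"
    "\<And>a x. (\<lambda>k. halfline_approx (cayley H) (cayley_inv H) a k x) \<longlonglongrightarrow> E {..<a} x"
    using spectral_resolution_exists[OF sa] by blast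
  show thesis
    by (rule that[OF E(1) spectral_projection_eq[OF sa E(1)]])
      (simp_all add: spectral_projection_eq[OF sa E(1)] E(2))
qed

lemma spectral_projection_halfline:
  "(\<lambda>k. halfline_approx (cayley H) (cayley_inv H) a k x) \<longlonglongrightarrow> spectral_projection H {..<a} x"
  using spectral_projection_resolution by blast

lemma spectral_projection_proj:
  assumes "A \<in> sets borel"
  shows "orthogonal_projection (spectral_projection H A)"
proof (rule spectral_projection_resolution)
  fix E assume E: "spectral_resolution H E" "\<And>A. A \<in> sets borel \<Longrightarrow> spectral_projection H A = E A"
  show ?thesis unfolding E(2)[OF assms] by (rule pvm_proj[OF resolution_pvm[OF sa E(1)] assms])
qed

lemma spectral_projection_compl:
  assumes "A \<in> sets borel"
  shows "spectral_projection H (- A) x = x - spectral_projection H A x"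
proof (rule spectral_projection_resolution)
  fix E assume E: "spectral_resolution H E" "\<And>A. A \<in> sets borel \<Longrightarrow> spectral_projection H A = E A"
  have "- A \<in> sets borel" using assms by auto
  then show ?thesis
    using pvm_compl[OF resolution_pvm[OF sa E(1)] assms, of x] by (simp add: E(2) assms)
qed

lemma spectral_projection_empty: "spectral_projection H {} x = 0"
proof (rule spectral_projection_resolution)
  fix E assume E: "spectral_resolution H E" "\<And>A. A \<in> sets borel \<Longrightarrow> spectral_projection H A = E A"
  show ?thesis using pvm_empty[OF resolution_pvm[OF sa E(1)], of x] by (simp add: E(2))
qed

lemma spectral_projection_sums:
  assumes "range A \<subseteq> sets borel" "disjoint_family A"
  shows "(\<lambda>n. spectral_projection H (A n) x) sums spectral_projection H (\<Union>n. A n) x"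
proof (rule spectral_projection_resolution)
  fix E assume E: "spectral_resolution H E" "\<And>A. A \<in> sets borel \<Longrightarrow> spectral_projection H A = E A"
  have "A n \<in> sets borel" "(\<Union>n. A n) \<in> sets borel" for n using assms(1) by auto
  then show ?thesis
    using pvm_sums[OF resolution_pvm[OF sa E(1)] assms, of x] by (simp add: E(2))
qed

lemma spectral_projection_unitary_conjugate:
  assumes up: "unitary_pair U V" and sa': "selfadjoint (unitary_conjugate U H)" and A: "A \<in> sets borel"
  shows "spectral_projection (unitary_conjugate U H) A (U x) = U (spectral_projection H A x)"
proof (rule spectral_projection_resolution)
  fix E assume "spectral_resolution H E"
  from spectral_projection_conjugate[OF up sa sa' this A, of "U x"] show ?thesis
    by (simp add: unitary_pairD(4)[OF up])
qed

lemma spectral_projection_nonzero_on_spectrum: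
  assumes red: "reduces M H" and \<Sigma>: "complex_of_real ` \<Sigma> = spectrum_in M (restriction H M)"
    and l: "l \<in> \<Sigma>" "l \<in> interior I" and I: "closed I"
  shows "\<Sigma> \<inter> I \<in> sets borel" and "\<exists>x. spectral_projection H (\<Sigma> \<inter> I) x \<noteq> 0"
proof -
  obtain E where E: "spectral_resolution H E" "\<And>A. A \<in> sets borel \<Longrightarrow> spectral_projection H A = E A"
    by (rule spectral_projection_resolution, rule that)
  show A: "\<Sigma> \<inter> I \<in> sets borel" by (rule resolution_nonzero_on_spectrum(1)[OF sa E(1) red \<Sigma> l I])
  show "\<exists>x. spectral_projection H (\<Sigma> \<inter> I) x \<noteq> 0"
    unfolding E(2)[OF A] by (rule resolution_nonzero_on_spectrum(2)[OF sa E(1) red \<Sigma> l I])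
qed

end

section \<open>Measurability of the spectral projections\<close>

lemma borel_measurable_cnj:
  assumes "f \<in> borel_measurable M"
  shows "(\<lambda>x. cnj (f x)) \<in> borel_measurable M"
proof -
  have "cnj \<in> borel_measurable borel"
    by (intro borel_measurable_continuous_onI continuous_intros)
  then show ?thesis by (rule measurable_compose[OF assms])
qed

lemma resolvent_funpow_tendsto:
  assumes "selfadjoint (K :: 'h::chilbert_space operator)" "Im z \<noteq> 0" "f \<longlonglongrightarrow> v"
  shows "(\<lambda>n. (resolvent K z ^^ k) (f n)) \<longlonglongrightarrow> (resolvent K z ^^ k) v"
proof (induction k)
  case (Suc k)
  show ?case
    unfolding funpow.simps comp_def
    by (rule clinear_tendsto[OF clinear_resolvent[OF assms(1,2)] _ Suc.IH, where C = "1 / \<bar>Im z\<bar>"])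
      (use norm_resolvent[OF assms(1,2)] in simp)
qed (simp add: assms)

section \<open>Measurability of resolvent powers, of words in the Cayley transform and of spectral
  projections\<close>

context
  fixes P :: "'w measure" and H :: "'w \<Rightarrow> 'h::chilbert_space operator"
  assumes meas: "measurable_selfadjoint_family P H"
begin

lemma family_selfadjoint: "\<omega> \<in> space P \<Longrightarrow> selfadjoint (H \<omega>)"
  using meas by (simp add: measurable_selfadjoint_family_def)

lemma family_resolvent_measurable:
  assumes "Im z \<noteq> 0"
  shows "(\<lambda>\<omega>. cinner x (resolvent (H \<omega>) z y)) \<in> borel_measurable P"
proof -
  have "z \<notin> \<real>" using assms complex_is_Real_iff by blast
  then show ?thesis
    using meas by (auto simp: measurable_selfadjoint_family_def weakly_measurable_def)
qed

text \<open>Products of distinct resolvents are differences of resolvents, and powers are limits of such products.\<close>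

lemma resolvent_power_measurable:
  assumes z: "Im z \<noteq> 0"
  shows "(\<lambda>\<omega>. cinner x ((resolvent (H \<omega>) z ^^ k) y)) \<in> borel_measurable P"
proof -
  \<comment> \<open>The second conjunct, with one further resolvent at a different point, drives the
    induction: the next power is its limit as that point tends to \<open>z\<close>, and the
    resolvent identity then restores it for the next exponent.\<close>
  have "(\<forall>x y. (\<lambda>\<omega>. cinner x ((resolvent (H \<omega>) z ^^ k) y)) \<in> borel_measurable P) \<and>
    (\<forall>x y w. Im w \<noteq> 0 \<longrightarrow> w \<noteq> z \<longrightarrow>
      (\<lambda>\<omega>. cinner x ((resolvent (H \<omega>) z ^^ k) (resolvent (H \<omega>) w y))) \<in> borel_measurable P)"
  proof (induction k)
    case 0
    then show ?case by (simp add: family_resolvent_measurable)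
  next
    case (Suc k)
    have 1: "(\<lambda>\<omega>. cinner x ((resolvent (H \<omega>) z ^^ Suc k) y)) \<in> borel_measurable P" for x y
    proof (rule borel_measurable_LIMSEQ_metric)
      \<comment> \<open>A horizontal shift: never equal to \<open>z\<close>, but with the same
        imaginary part, as \<open>resolvent_tendsto\<close> requires.\<close>
      define w where "w n = z + of_real (inverse (real (Suc n)))" for n
      have w: "Im (w n) = Im z" "w n \<noteq> z" for n by (simp_all add: w_def del: of_nat_Suc)
      have "(\<lambda>n. z + of_real (inverse (real (Suc n)))) \<longlonglongrightarrow> z + of_real 0"
        by (intro tendsto_add tendsto_const tendsto_of_real LIMSEQ_inverse_real_of_nat)
      then have w_lim: "w \<longlonglongrightarrow> z" by (simp add: w_def[abs_def])
      show "(\<lambda>\<omega>. cinner x ((resolvent (H \<omega>) z ^^ k) (resolvent (H \<omega>) (w n) y))) \<in> borel_measurable P" for n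
        using Suc.IH z w by simp
      fix \<omega> assume "\<omega> \<in> space P"
      then have sa: "selfadjoint (H \<omega>)" by (rule family_selfadjoint)
      show "(\<lambda>n. cinner x ((resolvent (H \<omega>) z ^^ k) (resolvent (H \<omega>) (w n) y)))
          \<longlonglongrightarrow> cinner x ((resolvent (H \<omega>) z ^^ Suc k) y)"
        unfolding funpow_Suc_right comp_def
        by (intro tendsto_cinner tendsto_const resolvent_funpow_tendsto[OF sa z]
            resolvent_tendsto[OF sa z w_lim] w)
    qed
    have 2: "(\<lambda>\<omega>. cinner x ((resolvent (H \<omega>) z ^^ Suc k) (resolvent (H \<omega>) w y))) \<in> borel_measurable P"
      if w: "Im w \<noteq> 0" "w \<noteq> z" for x y w
    proof -
      have eq: "cinner x ((resolvent (H \<omega>) z ^^ Suc k) (resolvent (H \<omega>) w y)) =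
          (1 / (z - w)) * (cinner x ((resolvent (H \<omega>) z ^^ Suc k) y)
            - cinner x ((resolvent (H \<omega>) z ^^ k) (resolvent (H \<omega>) w y)))"
        if "\<omega> \<in> space P" for \<omega>
      proof -
        let ?R = "resolvent (H \<omega>) z"
        have sa: "selfadjoint (H \<omega>)" using that by (rule family_selfadjoint)
        have lin: "clinear (?R ^^ k)" by (rule clinear_funpow[OF clinear_resolvent[OF sa z]])
        have "?R (resolvent (H \<omega>) w y) = (1 / (z - w)) *\<^sub>C (?R y - resolvent (H \<omega>) w y)"
          using resolvent_identity[OF sa z w(1), of y] w(2) by (simp add: scaleC_scaleC)
        then show ?thesis
          unfolding funpow_Suc_right comp_def
          by (simp only: clinear_scaleC[OF lin] clinear_diff[OF lin] cinner_scaleC_right cinner_diff_right)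
      qed
      have "(\<lambda>\<omega>. cinner x ((resolvent (H \<omega>) z ^^ k) (resolvent (H \<omega>) w y))) \<in> borel_measurable P"
        using Suc.IH w by simp
      then have "(\<lambda>\<omega>. (1 / (z - w)) * (cinner x ((resolvent (H \<omega>) z ^^ Suc k) y)
          - cinner x ((resolvent (H \<omega>) z ^^ k) (resolvent (H \<omega>) w y)))) \<in> borel_measurable P"
        by (intro borel_measurable_times borel_measurable_diff borel_measurable_const 1)
      then show ?thesis by (simp only: measurable_cong[OF eq])
    qed
    show ?case using 1 2 by blast
  qed
  then show ?thesis by blast
qed

text \<open>Each factor \<open>1 - 2 \<i> R\<close> either disappears or adds one resolvent, so the
  induction carries an arbitrary power of the resolvent in front.\<close>

lemma cayley_power_measurable:
  "(\<lambda>\<omega>. cinner x ((cayley (H \<omega>) ^^ k) y)) \<in> borel_measurable P"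
proof -
  let ?R = "\<lambda>\<omega>. resolvent (H \<omega>) (- \<i>)"
  have "\<forall>j x y. (\<lambda>\<omega>. cinner x ((?R \<omega> ^^ j) ((cayley (H \<omega>) ^^ k) y))) \<in> borel_measurable P"
  proof (induction k)
    case 0
    then show ?case by (simp add: resolvent_power_measurable)
  next
    case (Suc k)
    show ?case
    proof (intro allI)
      fix j x y
      have eq: "cinner x ((?R \<omega> ^^ j) ((cayley (H \<omega>) ^^ Suc k) y)) =
          cinner x ((?R \<omega> ^^ j) ((cayley (H \<omega>) ^^ k) y))
            - (2 * \<i>) * cinner x ((?R \<omega> ^^ Suc j) ((cayley (H \<omega>) ^^ k) y))"
        if "\<omega> \<in> space P" for \<omega>
      proof -
        have sa: "selfadjoint (H \<omega>)" using that by (rule family_selfadjoint)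
        have lin: "clinear (?R \<omega> ^^ j)" by (rule clinear_funpow[OF clinear_resolvent[OF sa]]) simp
        show ?thesis
          unfolding funpow_Suc_right[of j] funpow.simps(2)[of k] comp_def cayley_def[of "H \<omega>" "(cayley (H \<omega>) ^^ k) y"]
          by (simp only: clinear_scaleC[OF lin] clinear_diff[OF lin] cinner_scaleC_right cinner_diff_right)
      qed
      have "(\<lambda>\<omega>. cinner x ((?R \<omega> ^^ i) ((cayley (H \<omega>) ^^ k) y))) \<in> borel_measurable P" for i
        using Suc.IH by blast
      then show "(\<lambda>\<omega>. cinner x ((?R \<omega> ^^ j) ((cayley (H \<omega>) ^^ Suc k) y))) \<in> borel_measurable P"
        by (subst measurable_cong[OF eq])
          (auto intro!: borel_measurable_times borel_measurable_diff simp del: funpow.simps)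
    qed
  qed
  from this[rule_format, of x 0] show ?thesis by simp
qed

text \<open>Measurability of \<open>F\<close> alone would not survive composition with the Cayley
  transform, so all prefixes \<open>U^m V^n\<close> are built into the property.\<close>

definition word_measurable :: "('w \<Rightarrow> 'h \<Rightarrow> 'h) \<Rightarrow> bool" where
  "word_measurable F \<longleftrightarrow> (\<forall>m n x y.
     (\<lambda>\<omega>. cinner x ((cayley (H \<omega>) ^^ m) ((cayley_inv (H \<omega>) ^^ n) (F \<omega> y)))) \<in> borel_measurable P)"

lemma family_unitary_pair: "\<omega> \<in> space P \<Longrightarrow> unitary_pair (cayley (H \<omega>)) (cayley_inv (H \<omega>))"
  by (rule unitary_pair_cayley[OF family_selfadjoint])

text \<open>The prefix cancels to a single power; a leftover power of the inverse is moved to the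
  other side as an adjoint.\<close>

lemma word_measurable_id: "word_measurable (\<lambda>\<omega> x. x)"
  unfolding word_measurable_def
proof (intro allI)
  fix m n x y
  show "(\<lambda>\<omega>. cinner x ((cayley (H \<omega>) ^^ m) ((cayley_inv (H \<omega>) ^^ n) y))) \<in> borel_measurable P"
  proof (cases "n \<le> m")
    case True
    then obtain k where k: "m = k + n" using le_iff_add add.commute by metis
    have eq: "cinner x ((cayley (H \<omega>) ^^ m) ((cayley_inv (H \<omega>) ^^ n) y)) = cinner x ((cayley (H \<omega>) ^^ k) y)"
      if "\<omega> \<in> space P" for \<omega>
      using unitary_pairD(3)[OF unitary_pair_funpow[OF family_unitary_pair[OF that], of n]]
      by (simp add: k funpow_add)
    show ?thesis by (subst measurable_cong[OF eq]) (simp_all add: cayley_power_measurable)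
  next
    case False
    then obtain k where k: "n = m + k" using le_iff_add nat_le_linear by metis
    have eq: "cinner x ((cayley (H \<omega>) ^^ m) ((cayley_inv (H \<omega>) ^^ n) y)) = cnj (cinner y ((cayley (H \<omega>) ^^ k) x))"
      if "\<omega> \<in> space P" for \<omega>
    proof -
      have "(cayley (H \<omega>) ^^ m) ((cayley_inv (H \<omega>) ^^ n) y) = (cayley_inv (H \<omega>) ^^ k) y"
        using unitary_pairD(3)[OF unitary_pair_funpow[OF family_unitary_pair[OF that], of m]]
        by (simp add: k funpow_add)
      moreover have "cinner x ((cayley_inv (H \<omega>) ^^ k) y) = cinner ((cayley (H \<omega>) ^^ k) x) y"
        using unitary_pairD(6)[OF unitary_pair_funpow[OF family_unitary_pair[OF that], of k], of x y] by simp
      ultimately show ?thesis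
        using cinner_commute[of "(cayley (H \<omega>) ^^ k) x" y] by simp
    qed
    show ?thesis
      by (subst measurable_cong[OF eq]) (simp_all add: borel_measurable_cnj cayley_power_measurable)
  qed
qed

lemma word_measurable_cong:
  assumes "word_measurable F" and "\<And>\<omega> x. \<omega> \<in> space P \<Longrightarrow> G \<omega> x = F \<omega> x"
  shows "word_measurable G"
  unfolding word_measurable_def
proof (intro allI)
  fix m n x y
  have eq: "cinner x ((cayley (H \<omega>) ^^ m) ((cayley_inv (H \<omega>) ^^ n) (G \<omega> y))) =
      cinner x ((cayley (H \<omega>) ^^ m) ((cayley_inv (H \<omega>) ^^ n) (F \<omega> y)))" if "\<omega> \<in> space P" for \<omega>
    using assms(2)[OF that] by simp
  show "(\<lambda>\<omega>. cinner x ((cayley (H \<omega>) ^^ m) ((cayley_inv (H \<omega>) ^^ n) (G \<omega> y)))) \<in> borel_measurable P"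
    using assms(1) by (subst measurable_cong[OF eq]) (simp_all add: word_measurable_def)
qed

lemma word_measurable_linear:
  assumes F: "word_measurable F" and G: "word_measurable G"
  shows "word_measurable (\<lambda>\<omega> x. c *\<^sub>C F \<omega> x + d *\<^sub>C G \<omega> x)"
  unfolding word_measurable_def
proof (intro allI)
  fix m n x y
  let ?W = "\<lambda>\<omega> v. (cayley (H \<omega>) ^^ m) ((cayley_inv (H \<omega>) ^^ n) v)"
  have eq: "cinner x (?W \<omega> (c *\<^sub>C F \<omega> y + d *\<^sub>C G \<omega> y)) =
      c * cinner x (?W \<omega> (F \<omega> y)) + d * cinner x (?W \<omega> (G \<omega> y))" if "\<omega> \<in> space P" for \<omega>
  proof -
    note UV = unitary_pairD[OF family_unitary_pair[OF that]]
    have lin: "clinear (?W \<omega>)"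
      using clinear_funpow[OF UV(1), of m] clinear_funpow[OF UV(2), of n] by (auto simp: clinear_def)
    show ?thesis by (simp add: clinear_add[OF lin] clinear_scaleC[OF lin] cinner_simps)
  qed
  show "(\<lambda>\<omega>. cinner x (?W \<omega> (c *\<^sub>C F \<omega> y + d *\<^sub>C G \<omega> y))) \<in> borel_measurable P"
    using F G unfolding word_measurable_def
    by (subst measurable_cong[OF eq]) (auto intro!: borel_measurable_add borel_measurable_times)
qed

lemma word_measurable_cayley:
  assumes F: "word_measurable F"
  shows "word_measurable (\<lambda>\<omega> x. cayley (H \<omega>) (F \<omega> x))" "word_measurable (\<lambda>\<omega> x. cayley_inv (H \<omega>) (F \<omega> x))"
proof -
  show "word_measurable (\<lambda>\<omega> x. cayley (H \<omega>) (F \<omega> x))"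
    unfolding word_measurable_def
  proof (intro allI)
    fix m n x y
    have eq: "cinner x ((cayley (H \<omega>) ^^ m) ((cayley_inv (H \<omega>) ^^ n) (cayley (H \<omega>) (F \<omega> y)))) =
        cinner x ((cayley (H \<omega>) ^^ Suc m) ((cayley_inv (H \<omega>) ^^ n) (F \<omega> y)))" if "\<omega> \<in> space P" for \<omega>
      by (simp only: unitary_pair_commute[OF family_unitary_pair[OF that]] funpow_Suc_right comp_def)
    show "(\<lambda>\<omega>. cinner x ((cayley (H \<omega>) ^^ m) ((cayley_inv (H \<omega>) ^^ n) (cayley (H \<omega>) (F \<omega> y))))) \<in> borel_measurable P"
      using F unfolding word_measurable_def by (subst measurable_cong[OF eq]) blast+
  qed
  show "word_measurable (\<lambda>\<omega> x. cayley_inv (H \<omega>) (F \<omega> x))"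
    unfolding word_measurable_def
  proof (intro allI)
    fix m n x y
    have eq: "(cayley_inv (H \<omega>) ^^ n) (cayley_inv (H \<omega>) (F \<omega> y)) = (cayley_inv (H \<omega>) ^^ Suc n) (F \<omega> y)" for \<omega>
      by (simp only: funpow_Suc_right comp_def)
    show "(\<lambda>\<omega>. cinner x ((cayley (H \<omega>) ^^ m) ((cayley_inv (H \<omega>) ^^ n) (cayley_inv (H \<omega>) (F \<omega> y))))) \<in> borel_measurable P"
      unfolding eq using F unfolding word_measurable_def by blast
  qed
qed

lemma word_measurable_diff:
  assumes "word_measurable F" "word_measurable G"
  shows "word_measurable (\<lambda>\<omega> x. F \<omega> x - G \<omega> x)"
  by (rule word_measurable_cong[OF word_measurable_linear[OF assms, of 1 "- 1"]])
    (simp add: scaleC_minus_one)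

lemma word_measurable_scale:
  assumes "word_measurable F"
  shows "word_measurable (\<lambda>\<omega> x. c *\<^sub>C F \<omega> x)"
  by (rule word_measurable_cong[OF word_measurable_linear[OF assms assms, of c 0]]) simp

lemma word_measurable_add:
  assumes "word_measurable F" "word_measurable G"
  shows "word_measurable (\<lambda>\<omega> x. F \<omega> x + G \<omega> x)"
  by (rule word_measurable_cong[OF word_measurable_linear[OF assms, of 1 1]]) simp

lemma word_measurable_halfline_op:
  assumes "word_measurable F"
  shows "word_measurable (\<lambda>\<omega> x. halfline_op (cayley (H \<omega>)) (cayley_inv (H \<omega>)) a (F \<omega> x))"
  unfolding halfline_op_def
  by (intro word_measurable_add word_measurable_diff word_measurable_scale word_measurable_cayley assms)

lemma word_measurable_halfline_approx:
  "word_measurable (\<lambda>\<omega>. halfline_approx (cayley (H \<omega>)) (cayley_inv (H \<omega>)) a k)"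
proof -
  let ?T = "\<lambda>\<omega>. halfline_op (cayley (H \<omega>)) (cayley_inv (H \<omega>)) a"
  have pow: "word_measurable (\<lambda>\<omega> x. (?T \<omega> ^^ n) (F \<omega> x))" if "word_measurable F" for n F
    using that
  proof (induction n)
    case (Suc n)
    from word_measurable_halfline_op[OF Suc.IH[OF Suc.prems], of a] show ?case by simp
  qed simp
  have "word_measurable (\<lambda>\<omega> x. ((\<lambda>y. y - (?T \<omega> ^^ k) y) ^^ n) x)" for n
  proof (induction n)
    case 0
    then show ?case by (simp add: word_measurable_id)
  next
    case (Suc n)
    from word_measurable_diff[OF Suc.IH pow[OF Suc.IH, of k]] show ?case by simp
  qed
  then show ?thesis unfolding halfline_approx_def by simp
qed

text \<open>Half-lines are handled by the pointwise limit of measurable polynomials; complements and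
  disjoint unions act linearly on the form.\<close>

lemma spectral_projection_measurable:
  assumes A: "A \<in> sets borel"
  shows "(\<lambda>\<omega>. cinner x (spectral_projection (H \<omega>) A x)) \<in> borel_measurable P"
proof -
  have "A \<in> sigma_sets UNIV (range (\<lambda>a::real. {..<a}))"
    using A by (simp add: borel_sigma_halflines)
  with Int_stable_halflines subset_UNIV[of "range (\<lambda>a::real. {..<a})", folded Pow_UNIV] show ?thesis
  proof (induction rule: sigma_sets_induct_disjoint[consumes 3])
    case (basic A)
    then obtain a where a: "A = {..<a}" by blast
    show ?case
      unfolding a
    proof (rule borel_measurable_LIMSEQ_metric)
      show "(\<lambda>\<omega>. cinner x (halfline_approx (cayley (H \<omega>)) (cayley_inv (H \<omega>)) a k x)) \<in> borel_measurable P" for k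
        using word_measurable_halfline_approx[of a k, unfolded word_measurable_def, rule_format, of x 0 0 x] by simp
      show "(\<lambda>k. cinner x (halfline_approx (cayley (H \<omega>)) (cayley_inv (H \<omega>)) a k x))
          \<longlonglongrightarrow> cinner x (spectral_projection (H \<omega>) {..<a} x)" if "\<omega> \<in> space P" for \<omega>
        by (intro tendsto_cinner tendsto_const spectral_projection_halfline family_selfadjoint that)
    qed
  next
    case empty
    have eq: "cinner x (spectral_projection (H \<omega>) {} x) = 0" if "\<omega> \<in> space P" for \<omega>
      using spectral_projection_empty[OF family_selfadjoint[OF that]] by simp
    show ?case by (subst measurable_cong[OF eq]) simp_all
  next
    case (compl A)
    have A: "A \<in> sets borel" using compl(1) by (simp add: borel_sigma_halflines)
    have eq: "cinner x (spectral_projection (H \<omega>) (UNIV - A) x) = cinner x x - cinner x (spectral_projection (H \<omega>) A x)"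
      if "\<omega> \<in> space P" for \<omega>
      using spectral_projection_compl[OF family_selfadjoint[OF that] A, of x]
      by (simp add: Compl_eq_Diff_UNIV[symmetric] cinner_diff_right)
    show ?case
      by (subst measurable_cong[OF eq]) (auto intro!: borel_measurable_diff compl(2))
  next
    case (union A)
    have A: "range A \<subseteq> sets borel" using union(2) by (simp add: borel_sigma_halflines)
    show ?case
    proof (rule borel_measurable_LIMSEQ_metric)
      show "(\<lambda>\<omega>. \<Sum>n<k. cinner x (spectral_projection (H \<omega>) (A n) x)) \<in> borel_measurable P" for k
        by (intro borel_measurable_sum union(3))
      fix \<omega> assume "\<omega> \<in> space P"
      from spectral_projection_sums[OF family_selfadjoint[OF this] A union(1), of x]
      show "(\<lambda>k. \<Sum>n<k. cinner x (spectral_projection (H \<omega>) (A n) x))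
          \<longlonglongrightarrow> cinner x (spectral_projection (H \<omega>) (\<Union> (range A)) x)"
        unfolding sums_def cinner_sum_right[symmetric] by (intro tendsto_cinner tendsto_const)
    qed
  qed
qed

lemma spectral_projection_form:
  assumes "A \<in> sets borel" and "\<omega> \<in> space P"
  shows "cinner x (spectral_projection (H \<omega>) A x) = 0 \<longleftrightarrow> spectral_projection (H \<omega>) A x = 0"
  using orthogonal_projectionD(4)[OF spectral_projection_proj[OF family_selfadjoint[OF assms(2)] assms(1)], of x]
  by simp

lemma spectral_projection_AE_zero:
  assumes A: "A \<in> sets borel"
    and zero: "(\<integral>\<^sup>+\<omega>. ennreal (Re (cinner x (spectral_projection (H \<omega>) A x))) \<partial>P) = 0"
  shows "AE \<omega> in P. spectral_projection (H \<omega>) A x = 0"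
proof -
  have "(\<lambda>\<omega>. ennreal (Re (cinner x (spectral_projection (H \<omega>) A x)))) \<in> borel_measurable P"
    using spectral_projection_measurable[OF A, of x] by measurable
  with zero have "AE \<omega> in P. ennreal (Re (cinner x (spectral_projection (H \<omega>) A x))) = 0"
    by (simp add: nn_integral_0_iff_AE)
  with AE_space show ?thesis
  proof eventually_elim
    fix \<omega> assume w: "\<omega> \<in> space P" and 0: "ennreal (Re (cinner x (spectral_projection (H \<omega>) A x))) = 0"
    have "(norm (spectral_projection (H \<omega>) A x))\<^sup>2 \<le> 0"
      using 0 orthogonal_projectionD(6)[OF spectral_projection_proj[OF family_selfadjoint[OF w] A], of x]
      by (simp add: ennreal_eq_0_iff)
    then show "spectral_projection (H \<omega>) A x = 0" by simp
  qed
qed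

end

text \<open>Conjugation turns the projection of \<open>H (T i \<omega>)\<close> at
  \<open>U i x\<close> into \<open>U i\<close> of the projection of \<open>H \<omega>\<close> at
  \<open>x\<close>. Hence the exceptional set for \<open>U i x\<close> has a null preimage under
  \<open>T i\<close>, and measure preservation makes the set itself null.\<close>

lemma stationary_AE_zero:
  fixes H :: "'w \<Rightarrow> 'h::chilbert_space operator"
  assumes st: "stationary_with P U H" and A: "A \<in> sets borel"
    and zero: "AE \<omega> in P. spectral_projection (H \<omega>) A x = 0"
  shows "AE \<omega> in P. spectral_projection (H \<omega>) A (U i x) = 0"
proof -
  have meas: "measurable_selfadjoint_family P H" and un: "unitary (U i)"
    using st by (auto simp: stationary_with_def)
  obtain T where mp: "measure_preserving_family P T"
    and HT: "\<forall>i. \<forall>\<omega>\<in>space P. H (T i \<omega>) = unitary_conjugate (U i) (H \<omega>)"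
    using st unfolding stationary_with_def by blast
  have T: "T i \<in> measurable P P" "\<And>A. A \<in> sets P \<Longrightarrow> emeasure P (T i -` A \<inter> space P) = emeasure P A"
    using mp by (auto simp: measure_preserving_family_def)
  have H: "H (T i \<omega>) = unitary_conjugate (U i) (H \<omega>)" if "\<omega> \<in> space P" for \<omega>
    using HT that by blast
  note up = unitary_pair_of_unitary[OF un]
  \<comment> \<open>Expressed by the quadratic form, whose measurability is available; for a
    projection it vanishes exactly when the vector is annihilated.\<close>
  define N where "N = {\<omega> \<in> space P. cinner (U i x) (spectral_projection (H \<omega>) A (U i x)) \<noteq> 0}"
  have N: "N \<in> sets P"
    unfolding N_def using spectral_projection_measurable[OF meas A, of "U i x"] by measurable
  have "emeasure P (T i -` N \<inter> space P) = 0"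
  proof (rule emeasure_eq_0_AE[of "\<lambda>\<omega>. \<omega> \<in> T i -` N" P, unfolded Collect_conj_eq Collect_mem_eq, THEN trans[rotated]])
    show "emeasure P (T i -` N \<inter> space P) = emeasure P (space P \<inter> T i -` N)" by (simp add: Int_commute)
    show "AE \<omega> in P. \<not> \<omega> \<in> T i -` N"
      using zero AE_space
    proof eventually_elim
      fix \<omega> assume 0: "spectral_projection (H \<omega>) A x = 0" and w: "\<omega> \<in> space P"
      have w': "T i \<omega> \<in> space P" using T(1) w by (rule measurable_space)
      have "spectral_projection (H (T i \<omega>)) A (U i x) = U i (spectral_projection (H \<omega>) A x)"
        unfolding H[OF w]
        using family_selfadjoint[OF meas w'] A
        by (intro spectral_projection_unitary_conjugate[OF family_selfadjoint[OF meas w] up]) (simp_all add: H[OF w])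
      also have "\<dots> = 0" using unitary_pairD(1)[OF up] by (simp add: 0 clinear_zero)
      finally show "\<not> \<omega> \<in> T i -` N" by (simp add: N_def)
    qed
  qed
  then have "emeasure P N = 0" using T(2)[OF N] by simp
  then have "AE \<omega> in P. \<omega> \<notin> N" using N by (intro AE_not_in) (simp add: null_sets_def)
  with AE_space show ?thesis
    by eventually_elim (simp add: N_def spectral_projection_form[OF meas A])
qed

text \<open>The common part of both models. A set of positive measure is nonempty, so one \<omega>
  already shows that \<open>\<Sigma> \<inter> I\<close> is Borel; only then is the almost sure
  statement about its spectral projection requested.\<close>

lemma positive_spectrum_contradiction:
  fixes H :: "'w \<Rightarrow> 'h::chilbert_space operator"
  assumes meas: "measurable_selfadjoint_family P H" and pos: "positive_spectrum P H \<Sigma>" and I: "closed I"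
    and zero: "\<Sigma> \<inter> I \<in> sets borel \<Longrightarrow> AE \<omega> in P. \<forall>x. spectral_projection (H \<omega>) (\<Sigma> \<inter> I) x = 0"
  shows "\<Sigma> \<inter> interior I = {}"
proof (rule ccontr)
  assume "\<Sigma> \<inter> interior I \<noteq> {}"
  then obtain l where l: "l \<in> \<Sigma>" "l \<in> interior I" by blast
  obtain M \<Omega> where red: "\<And>\<omega>. \<omega> \<in> space P \<Longrightarrow> reduces (M \<omega>) (H \<omega>)"
    and \<Omega>: "\<Omega> \<in> sets P" "measure P \<Omega> > 0"
    and spec: "\<And>\<omega>. \<omega> \<in> \<Omega> \<Longrightarrow> complex_of_real ` \<Sigma> = spectrum_in (M \<omega>) (restriction (H \<omega>) (M \<omega>))"
    using pos unfolding positive_spectrum_def by blast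
  have sub: "\<omega> \<in> space P" if "\<omega> \<in> \<Omega>" for \<omega> using \<Omega>(1) that sets.sets_into_space by blast
  note nz = spectral_projection_nonzero_on_spectrum[OF family_selfadjoint[OF meas sub] red[OF sub] spec l I]
  have "\<Omega> \<noteq> {}" using \<Omega>(2) by auto
  then have A: "\<Sigma> \<inter> I \<in> sets borel" using nz(1) by blast
  have "AE \<omega> in P. \<omega> \<notin> \<Omega>"
    using zero[OF A] by eventually_elim (use nz(2) in blast)
  then have "emeasure P \<Omega> = 0" using \<Omega>(1) by (simp add: AE_iff_null_sets[symmetric] null_setsD1)
  then show False using \<Omega>(2) by (simp add: measure_def)
qed

section \<open>The discrete model\<close>

lemma cinner_delta: "cinner (delta k) f = Rep_ell2 f k"
proof -
  have "cinner (delta k) f = (\<integral>n. (if n = k then Rep_ell2 f k else 0) \<partial>count_space UNIV)"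
    unfolding cinner_ell2.rep_eq L2_inner_def delta.rep_eq
    by (rule Bochner_Integration.integral_cong) auto
  also have "\<dots> = (\<Sum>n | n \<in> UNIV \<and> (if n = k then Rep_ell2 f k else 0) \<noteq> 0. if n = k then Rep_ell2 f k else 0)"
    by (rule lebesgue_integral_count_space_finite_support) (auto intro: finite_subset[of _ "{k}"])
  also have "\<dots> = (\<Sum>n\<in>{k}. if n = k then Rep_ell2 f k else 0)"
    by (rule sum.mono_neutral_left) auto
  finally show ?thesis by simp
qed

lemma ell2_translation_delta: "ell2_translation i (delta 0) = delta i"
  by (rule Rep_ell2_inject[THEN iffD1]) (auto simp: ell2_translation.rep_eq delta.rep_eq)

text \<open>The translates of \<open>delta 0\<close> are all the \<open>delta i\<close>, countably
  many. By symmetry of the projection the coordinates of \<open>E x\<close> are products of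
  \<open>E (delta i)\<close> with \<open>x\<close>.\<close>

lemma discrete_case:
  fixes P :: "'w measure" and H :: "'w \<Rightarrow> (int ^ 'd::finite) ell2 operator"
  assumes st: "stationary_with P ell2_translation H" and pos: "positive_spectrum P H \<Sigma>"
    and zero: "dos_discrete P H (\<Sigma> \<inter> I) = 0" and I: "closed I"
  shows "\<Sigma> \<inter> interior I = {}"
proof (rule positive_spectrum_contradiction[OF _ pos I])
  show meas: "measurable_selfadjoint_family P H" using st by (simp add: stationary_with_def)
  assume A: "\<Sigma> \<inter> I \<in> sets borel"
  let ?E = "\<lambda>\<omega>. spectral_projection (H \<omega>) (\<Sigma> \<inter> I)"
  have "AE \<omega> in P. ?E \<omega> (delta 0) = 0"
    using zero by (intro spectral_projection_AE_zero[OF meas A]) (simp add: dos_discrete_def)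
  from stationary_AE_zero[OF st A this] have "AE \<omega> in P. ?E \<omega> (delta i) = 0" for i
    by (simp add: ell2_translation_delta)
  then have "AE \<omega> in P. \<forall>i. ?E \<omega> (delta i) = 0" by (simp add: AE_all_countable)
  with AE_space show "AE \<omega> in P. \<forall>x. ?E \<omega> x = 0"
  proof eventually_elim
    fix \<omega> assume w: "\<omega> \<in> space P" and 0: "\<forall>i. ?E \<omega> (delta i) = 0"
    note Pr = orthogonal_projectionD[OF spectral_projection_proj[OF family_selfadjoint[OF meas w] A]]
    show "\<forall>x. ?E \<omega> x = 0"
    proof
      fix x
      have "Rep_ell2 (?E \<omega> x) i = 0" for i
        using Pr(3)[of "delta i" x] 0 by (simp add: cinner_delta[symmetric])
      then show "?E \<omega> x = 0"
        by (intro Rep_ell2_inject[THEN iffD1]) (auto simp: zero_ell2.rep_eq)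
    qed
  qed
qed

section \<open>Orthonormal bases\<close>

definition orthonormal :: "'h::complex_inner set \<Rightarrow> bool" where
  "orthonormal S \<longleftrightarrow> (\<forall>x\<in>S. \<forall>y\<in>S. cinner x y = (if x = y then 1 else 0))"

text \<open>\<open>positive_trace\<close> picks a basis by \<open>SOME\<close>. A vector orthogonal
  to a maximal orthonormal set could be normalized and added to it.\<close>

lemma orthonormal_basis_exists: "\<exists>S :: 'h::complex_inner set. orthonormal_basis S"
proof -
  have "\<exists>S\<in>Collect orthonormal. \<forall>X\<in>Collect orthonormal. S \<subseteq> X \<longrightarrow> X = (S :: 'h set)"
  proof (rule subset_Zorn')
    fix C :: "'h set set"
    assume "subset.chain (Collect orthonormal) C"
    then have C: "C \<subseteq> Collect orthonormal" "\<And>X Y. X \<in> C \<Longrightarrow> Y \<in> C \<Longrightarrow> X \<subseteq> Y \<or> Y \<subseteq> X"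
      by (auto simp: subset_chain_def)
    have "cinner x y = (if x = y then 1 else 0)" if "x \<in> \<Union>C" "y \<in> \<Union>C" for x y
    proof -
      from that obtain X Y where XY: "X \<in> C" "x \<in> X" "Y \<in> C" "y \<in> Y" by blast
      then obtain Z where "Z \<in> C" "x \<in> Z" "y \<in> Z" using C(2)[of X Y] by blast
      then show ?thesis using C(1) by (auto simp: orthonormal_def)
    qed
    then show "\<Union>C \<in> Collect orthonormal" by (simp add: orthonormal_def)
  qed
  then obtain S :: "'h set" where S: "orthonormal S" and max: "\<And>X. orthonormal X \<Longrightarrow> S \<subseteq> X \<Longrightarrow> X = S"
    by blast
  have "x = 0" if x: "\<forall>s\<in>S. cinner s x = 0" for x
  proof (rule ccontr)
    assume "x \<noteq> 0"
    define e where "e = of_real (1 / norm x) *\<^sub>C x"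
    have ee: "cinner e e = 1"
      using \<open>x \<noteq> 0\<close> by (simp add: e_def cinner_self norm_scaleC norm_divide)
    have se: "cinner s e = 0" "cinner e s = 0" if "s \<in> S" for s
    proof -
      show "cinner s e = 0" using x that by (simp add: e_def cinner_scaleC_right)
      then show "cinner e s = 0" by (subst cinner_commute) simp
    qed
    have "orthonormal (insert e S)"
      using S ee se unfolding orthonormal_def by (auto split: if_splits)
    then have "e \<in> S" using max[of "insert e S"] by blast
    then show False using ee se(1)[of e] by simp
  qed
  with S have "orthonormal_basis S"
    unfolding orthonormal_basis_def orthonormal_def by simp
  then show ?thesis ..
qed

lemma bessel_finite:
  assumes S: "orthonormal S" and F: "finite F" "F \<subseteq> S"
  shows "(\<Sum>s\<in>F. (norm (cinner s x))\<^sup>2) \<le> (norm x)\<^sup>2"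
proof -
  define p where "p = (\<Sum>s\<in>F. cinner s x *\<^sub>C s)"
  have sp: "cinner s p = cinner s x" if "s \<in> F" for s
  proof -
    have "cinner s p = (\<Sum>r\<in>F. if s = r then cinner r x else 0)"
      unfolding p_def cinner_sum_right
    proof (intro sum.cong refl)
      fix r assume "r \<in> F"
      then have "cinner s r = (if s = r then 1 else 0)"
        using S F(2) that unfolding orthonormal_def by blast
      then show "cinner s (cinner r x *\<^sub>C r) = (if s = r then cinner r x else 0)"
        by (simp add: cinner_scaleC_right)
    qed
    also have "\<dots> = cinner s x" using F that by simp
    finally show ?thesis .
  qed
  have pp: "cinner p y = (\<Sum>s\<in>F. cnj (cinner s x) * cinner s y)" for y
    unfolding p_def by (simp add: cinner_sum_left cinner_scaleC_left)
  have "cinner p x = cinner p p" using sp by (simp add: pp)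
  then have "cinner p (x - p) = 0" by (simp add: cinner_diff_right)
  moreover from this have "cinner (x - p) p = 0" by (subst cinner_commute) simp
  ultimately have "cinner x x = cinner p p + cinner (x - p) (x - p)"
    by (simp add: cinner_simps)
  then have "complex_of_real ((norm x)\<^sup>2) = of_real ((norm p)\<^sup>2 + (norm (x - p))\<^sup>2)"
    by (simp add: cinner_self)
  then have 1: "(norm x)\<^sup>2 = (norm p)\<^sup>2 + (norm (x - p))\<^sup>2" using of_real_eq_iff by blast
  have "complex_of_real (\<Sum>s\<in>F. (norm (cinner s x))\<^sup>2) = (\<Sum>s\<in>F. cnj (cinner s x) * cinner s x)"
    unfolding of_real_sum by (intro sum.cong refl) (simp only: complex_norm_square mult.commute)
  also have "\<dots> = cinner p p" using \<open>cinner p x = cinner p p\<close> by (simp add: pp)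
  finally have "complex_of_real (\<Sum>s\<in>F. (norm (cinner s x))\<^sup>2) = of_real ((norm p)\<^sup>2)"
    by (simp only: cinner_self)
  then have "(\<Sum>s\<in>F. (norm (cinner s x))\<^sup>2) = (norm p)\<^sup>2" using of_real_eq_iff by blast
  then show ?thesis using 1 by simp
qed

text \<open>By Bessel's inequality only finitely many coefficients have squared modulus above
  \<open>1 / (n + 1)\<close>. This makes an arbitrary basis countable as far as one vector is
  concerned.\<close>

lemma bessel_countable:
  assumes S: "orthonormal S"
  shows "countable {s \<in> S. cinner s x \<noteq> 0}"
proof -
  have fin: "finite {s \<in> S. 1 / real (Suc n) < (norm (cinner s x))\<^sup>2}" (is "finite ?B") for n
  proof (rule ccontr)
    assume inf: "infinite ?B"
    obtain m :: nat where m: "(norm x)\<^sup>2 * real (Suc n) < real m" using reals_Archimedean2 by blast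
    obtain F where F: "finite F" "card F = m" "F \<subseteq> ?B"
      using infinite_arbitrarily_large[OF inf] by blast
    have "real m * (1 / real (Suc n)) \<le> (\<Sum>s\<in>F. (norm (cinner s x))\<^sup>2)"
      using sum_bounded_below[of F "1 / real (Suc n)" "\<lambda>s. (norm (cinner s x))\<^sup>2"] F
      by (force intro: less_imp_le)
    also have "\<dots> \<le> (norm x)\<^sup>2" using F by (intro bessel_finite[OF S]) auto
    finally show False using m by (simp add: field_simps)
  qed
  have "{s \<in> S. cinner s x \<noteq> 0} \<subseteq> (\<Union>n. {s \<in> S. 1 / real (Suc n) < (norm (cinner s x))\<^sup>2})"
  proof
    fix s assume s: "s \<in> {s \<in> S. cinner s x \<noteq> 0}"
    then have "0 < (norm (cinner s x))\<^sup>2" by simp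
    then obtain n where "1 / real (Suc n) < (norm (cinner s x))\<^sup>2" using nat_approx_posE by blast
    then show "s \<in> (\<Union>n. {s \<in> S. 1 / real (Suc n) < (norm (cinner s x))\<^sup>2})" using s by blast
  qed
  moreover have "countable (\<Union>n. {s \<in> S. 1 / real (Suc n) < (norm (cinner s x))\<^sup>2})"
    by (intro countable_UN countable_finite fin countableI_type)
  ultimately show ?thesis by (rule countable_subset)
qed

text \<open>A vector lies in the closed span of the basis elements to which it is not orthogonal.\<close>

lemma mem_closed_subspace_if_basis:
  fixes x :: "'h::chilbert_space"
  assumes S: "orthonormal_basis S" and K: "closed_csubspace K"
    and sub: "{s \<in> S. cinner s x \<noteq> 0} \<subseteq> K"
  shows "x \<in> K"
proof -
  let ?B = "{s \<in> S. cinner s x \<noteq> 0}"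
  define L where "L = \<Inter>{K. closed_csubspace K \<and> ?B \<subseteq> K}"
  have L: "closed_csubspace L"
    unfolding closed_csubspace_def L_def
    by (auto simp: closed_csubspaceD intro!: closed_Inter)
  have BL: "?B \<subseteq> L" by (auto simp: L_def)
  \<comment> \<open>The residual is orthogonal to elements of \<open>?B\<close> by projection; any
    other basis element is orthogonal to \<open>x\<close> and to all of \<open>?B\<close>, hence to
    \<open>L\<close>.\<close>
  have orth: "cinner s (x - proj_onto L x) = 0" if s: "s \<in> S" for s
  proof (cases "s \<in> ?B")
    case True
    then show ?thesis using proj_onto_orthogonal[OF L] BL by blast
  next
    case False
    define K where "K = {v. cinner s v = 0}"
    have "closed_csubspace K"
      unfolding closed_csubspace_def K_def
      by (auto simp: cinner_simps intro!: closed_Collect_eq continuous_on_cinner continuous_intros)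
    moreover have "?B \<subseteq> K"
      using S s False by (auto simp: K_def orthonormal_basis_def)
    ultimately have "L \<subseteq> K" by (auto simp: L_def)
    then have "cinner s (proj_onto L x) = 0" using proj_onto_mem[OF L, of x] by (auto simp: K_def)
    then show ?thesis using False s by (simp add: cinner_diff_right)
  qed
  have "x - proj_onto L x = 0" using S orth unfolding orthonormal_basis_def by blast
  then have "x \<in> L" using proj_onto_mem[OF L, of x] by simp
  then show ?thesis using K sub by (auto simp: L_def)
qed

section \<open>A countable total family of square integrable functions\<close>

text \<open>Finite intersections of a countable basis. Countability lets null sets be united, and
  stability under intersection lets the generator determine integrals; the empty intersection
  contributes \<open>UNIV\<close>.\<close>

lemma countable_Int_stable_generator:
  "\<exists>G :: 'a::second_countable_topology set set. countable G \<and> Int_stable G \<and> UNIV \<in> G \<and>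
     sets borel = sigma_sets UNIV G"
proof -
  obtain B :: "'a set set" where B: "countable B" "topological_basis B"
    using ex_countable_basis by blast
  define G where "G = Inter ` {F. finite F \<and> F \<subseteq> B}"
  have "countable G"
    unfolding G_def by (intro countable_image countable_Collect_finite_subset B(1))
  moreover have "Int_stable G"
    unfolding Int_stable_def G_def
  proof clarify
    fix F F' assume "F \<subseteq> B" "finite F" "F' \<subseteq> B" "finite F'"
    then show "\<Inter>F \<inter> \<Inter>F' \<in> Inter ` {F. finite F \<and> F \<subseteq> B}"
      by (intro image_eqI[of _ _ "F \<union> F'"]) auto
  qed
  moreover have "UNIV \<in> G" unfolding G_def by (rule image_eqI[of _ _ "{}"]) auto
  moreover have "sets borel = sigma_sets UNIV G"
  proof -
    have opens: "open b" if "b \<in> B" for b using B(2) that by (rule topological_basis_open)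
    have "sets borel = sigma_sets UNIV B"
      unfolding borel_eq_countable_basis[OF B] by simp
    also have "\<dots> = sigma_sets UNIV G"
    proof (rule sigma_sets_eqI)
      fix b assume "b \<in> B"
      then have "b \<in> G" unfolding G_def by (intro image_eqI[of _ _ "{b}"]) auto
      then show "b \<in> sigma_sets UNIV G" by (rule sigma_sets.Basic)
    next
      fix g assume "g \<in> G"
      then obtain F where F: "F \<subseteq> B" "finite F" "g = \<Inter>F" by (auto simp: G_def)
      then have "open g" using opens by (auto intro!: open_Inter)
      then have "g \<in> sets borel" by simp
      then show "g \<in> sigma_sets UNIV B" unfolding borel_eq_countable_basis[OF B] by simp
    qed
    finally show ?thesis .
  qed
  ultimately show ?thesis by blast
qed

lemma integral_zero_on_generator:
  fixes g :: "'a \<Rightarrow> real"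
  assumes int: "integrable M g" and sets_M: "sets M = sigma_sets UNIV G" and space_M: "space M = UNIV"
    and stable: "Int_stable G" and top: "UNIV \<in> G"
    and zero: "\<And>A. A \<in> G \<Longrightarrow> (\<integral>x. indicator A x * g x \<partial>M) = 0"
  shows "AE x in M. g x = 0"
proof -
  have [measurable]: "g \<in> borel_measurable M" using int by simp
  have ind: "integrable M (\<lambda>x. indicator A x * g x)" if "A \<in> sets M" for A
    using integrable_real_mult_indicator[OF that int] by (simp add: mult.commute)
  have all: "(\<integral>x. indicator A x * g x \<partial>M) = 0" if "A \<in> sigma_sets UNIV G" for A
    using stable subset_UNIV[of G, folded Pow_UNIV] that
  proof (induction rule: sigma_sets_induct_disjoint[consumes 3])
    case (compl A)
    have A: "A \<in> sets M" using compl(1) sets_M by simp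
    have "(\<integral>x. indicator (UNIV - A) x * g x \<partial>M) = (\<integral>x. indicator UNIV x * g x - indicator A x * g x \<partial>M)"
      by (intro Bochner_Integration.integral_cong) (auto simp: indicator_def)
    also have "\<dots> = 0"
      using ind[OF A] int zero[OF top] compl(2) by (subst Bochner_Integration.integral_diff) auto
    finally show ?case .
  next
    case (union A)
    have A: "A n \<in> sets M" for n using union(2) sets_M by auto
    \<comment> \<open>Sum and integral may be exchanged by absolute convergence: the integrals of
      \<open>|g|\<close> over the disjoint sets are masses of the finite measure with density
      \<open>|g|\<close>.\<close>
    have "(\<lambda>n. \<integral>x. indicator (A n) x * g x \<partial>M) sums (\<integral>x. (\<Sum>n. indicator (A n) x * g x) \<partial>M)"
    proof (rule sums_integral)
      show "integrable M (\<lambda>x. indicator (A n) x * g x)" for n by (rule ind[OF A])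
      have single: "(\<lambda>n. norm (indicator (A n) x * g x)) sums (indicator (\<Union>n. A n) x * \<bar>g x\<bar>)" for x
      proof (cases "x \<in> (\<Union>n. A n)")
        case True
        then obtain m where m: "x \<in> A m" by blast
        then have "x \<notin> A n" if "n \<noteq> m" for n
          using union(1) that by (auto simp: disjoint_family_on_def)
        then have "(\<lambda>n. norm (indicator (A n) x * g x)) = (\<lambda>n. if n = m then \<bar>g x\<bar> else 0)"
          using m by (auto simp: indicator_def)
        then show ?thesis using True sums_single[of m "\<lambda>_. \<bar>g x\<bar>"] by simp
      qed simp
      show "AE x in M. summable (\<lambda>n. norm (indicator (A n) x * g x))"
        using single sums_summable by blast
      have meas: "(\<lambda>n. measure (density M (\<lambda>x. ennreal \<bar>g x\<bar>)) (A n)) = (\<lambda>n. \<integral>x. norm (indicator (A n) x * g x) \<partial>M)"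
      proof
        fix n
        have "emeasure (density M (\<lambda>x. ennreal \<bar>g x\<bar>)) (A n) = (\<integral>\<^sup>+x. ennreal (norm (indicator (A n) x * g x)) \<partial>M)"
          by (subst emeasure_density) (auto intro!: nn_integral_cong simp: A indicator_def)
        also have "\<dots> = ennreal (\<integral>x. norm (indicator (A n) x * g x) \<partial>M)"
          by (intro nn_integral_eq_integral integrable_norm ind A) auto
        finally show "measure (density M (\<lambda>x. ennreal \<bar>g x\<bar>)) (A n) = (\<integral>x. norm (indicator (A n) x * g x) \<partial>M)"
          by (simp add: measure_def)
      qed
      have "finite_measure (density M (\<lambda>x. ennreal \<bar>g x\<bar>))"
      proof (rule finite_measureI)
        have "emeasure (density M (\<lambda>x. ennreal \<bar>g x\<bar>)) (space M) = ennreal (\<integral>x. \<bar>g x\<bar> \<partial>M)"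
          using nn_integral_eq_integral[OF integrable_abs[OF int]] sets.top[of M]
          by (subst emeasure_density) (auto simp: space_M)
        then show "emeasure (density M (\<lambda>x. ennreal \<bar>g x\<bar>)) (space (density M (\<lambda>x. ennreal \<bar>g x\<bar>))) \<noteq> \<infinity>"
          by simp
      qed
      from finite_measure.finite_measure_UNION[OF this, of A] union(1)
      have "summable (\<lambda>n. measure (density M (\<lambda>x. ennreal \<bar>g x\<bar>)) (A n))"
        using A by (auto intro: sums_summable)
      then show "summable (\<lambda>n. \<integral>x. norm (indicator (A n) x * g x) \<partial>M)"
        unfolding meas .
    qed
    moreover have "(\<Sum>n. indicator (A n) x * g x) = indicator (\<Union>n. A n) x * g x" for x
    proof (cases "x \<in> (\<Union>n. A n)")
      case True
      then obtain m where m: "x \<in> A m" by blast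
      then have "x \<notin> A n" if "n \<noteq> m" for n
        using union(1) that by (auto simp: disjoint_family_on_def)
      then have "(\<lambda>n. indicator (A n) x * g x) = (\<lambda>n. if n = m then g x else 0)"
        using m by (auto simp: indicator_def)
      then show ?thesis using True sums_unique[OF sums_single[of m "\<lambda>_. g x"]] by simp
    qed simp
    ultimately have "(\<lambda>n. 0 :: real) sums (\<integral>x. indicator (\<Union>n. A n) x * g x \<partial>M)"
      by (simp add: union(3))
    then show ?case using sums_unique2 sums_zero by blast
  qed (use zero in auto)
  \<comment> \<open>On the set where \<open>h\<close> is positive the integrand is nonnegative with
    integral zero. Applied to \<open>g\<close> and to \<open>- g\<close>.\<close>
  have pos: "AE x in M. \<not> h x > 0" if h: "h \<in> borel_measurable M" "integrable M h"
    and z: "\<And>A. A \<in> sets M \<Longrightarrow> (\<integral>x. indicator A x * h x \<partial>M) = 0" for h :: "'a \<Rightarrow> real"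
  proof -
    have A: "{x \<in> space M. h x > 0} \<in> sets M" using h(1) by measurable
    have "integrable M (\<lambda>x. indicator {x \<in> space M. h x > 0} x * h x)"
      using integrable_real_mult_indicator[OF A h(2)] by (simp add: mult.commute)
    then have "AE x in M. indicator {x \<in> space M. h x > 0} x * h x = 0"
      using z[OF A] by (subst integral_nonneg_eq_0_iff_AE[symmetric]) (auto simp: indicator_def)
    then show ?thesis by eventually_elim (auto simp: space_M split: split_indicator_asm)
  qed
  have "AE x in M. \<not> g x > 0"
    by (rule pos) (use int all sets_M in auto)
  moreover have "AE x in M. \<not> - g x > 0"
    by (rule pos) (use int all sets_M in auto)
  ultimately show ?thesis by eventually_elim linarith
qed

lemma L2_eq_0:
  assumes "square_integrable lborel f" and "AE x in lborel. f x = 0"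
  shows "abs_L2 f = 0"
proof -
  have "L2_rel f (\<lambda>_. 0)"
    using assms square_integrable_zero by (simp add: L2_rel_def)
  then have "abs_L2 f = abs_L2 (\<lambda>_. 0)" by (rule Quotient3_rel_abs[OF Quotient3_L2])
  then show ?thesis by (simp only: zero_L2_def)
qed

lemma cinner_abs_L2:
  assumes "square_integrable lborel f" "square_integrable lborel g"
  shows "cinner (abs_L2 f) (abs_L2 g) = (\<integral>x. cnj (f x) * g x \<partial>lborel)"
proof -
  have "L2_rel f f" "L2_rel g g" using assms by (simp_all add: L2_rel_def)
  then show ?thesis by (simp add: cinner_L2.abs_eq L2_inner_def)
qed

lemma unit_cube_measurable [measurable]: "(unit_cube :: (real ^ 'd::finite) set) \<in> sets borel"
  by (simp add: unit_cube_def)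

lemma cinner_chi_unit_cube: "cinner x (chi_unit_cube y) = cinner (chi_unit_cube x) y"
  by transfer (auto simp: L2_inner_def indicator_def intro!: Bochner_Integration.integral_cong)

text \<open>Supported in the unit cube, where the density of states gives information, and
  preshifted so that its translate by \<open>a\<close> is the indicator of \<open>G\<close> inside
  the cube around \<open>a\<close>. One set \<open>G\<close> thus tests all cubes.\<close>

definition cube_fun :: "(real ^ 'd::finite) set \<Rightarrow> real ^ 'd \<Rightarrow> real ^ 'd \<Rightarrow> complex" where
  "cube_fun G a x = indicator unit_cube x * indicator G (x + a)"

lemma square_integrable_indicator_cube:
  fixes B :: "(real ^ 'd::finite) set"
  assumes "B \<in> sets borel" and "\<And>x. f x = indicator B x" and "bounded B"
  shows "square_integrable lborel (f :: _ \<Rightarrow> complex)"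
proof -
  have "f = indicator B" using assms(2) by blast
  moreover have "integrable lborel (indicator B :: _ \<Rightarrow> real)"
    using assms emeasure_bounded_finite[of B] by (simp add: less_top)
  moreover have "(\<lambda>x. (norm (indicator B x :: complex))\<^sup>2) = (indicator B :: _ \<Rightarrow> real)"
    by (auto simp: indicator_def)
  ultimately show ?thesis
    using assms(1) by (simp add: square_integrable_def)
qed

lemma translation_measurable:
  assumes "G \<in> sets borel"
  shows "(\<lambda>x::'a::real_normed_vector. x + a) -` G \<in> sets borel"
proof -
  have "(\<lambda>x::'a. x + a) \<in> borel_measurable borel"
    by (intro borel_measurable_continuous_onI continuous_intros)
  from measurable_sets[OF this assms] show ?thesis by simp
qed

lemma square_integrable_cube_fun:
  assumes G: "G \<in> sets borel"
  shows "square_integrable lborel (cube_fun G a)"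
    and "square_integrable lborel (\<lambda>x. cube_fun G a (x - a))"
proof -
  have b: "bounded (unit_cube :: (real ^ 'a) set)" by (simp add: unit_cube_def)
  show "square_integrable lborel (cube_fun G a)"
  proof (rule square_integrable_indicator_cube)
    show "unit_cube \<inter> (\<lambda>x. x + a) -` G \<in> sets borel" using translation_measurable[OF G] by auto
    show "bounded (unit_cube \<inter> (\<lambda>x. x + a) -` G)" using b by (rule bounded_subset) auto
  qed (simp add: cube_fun_def indicator_def)
  show "square_integrable lborel (\<lambda>x. cube_fun G a (x - a))"
  proof (rule square_integrable_indicator_cube)
    show "(\<lambda>x. x + (- a)) -` unit_cube \<inter> G \<in> sets borel"
      using translation_measurable[OF unit_cube_measurable, of "- a"] G by auto
    have "(\<lambda>x. x + (- a)) -` unit_cube \<inter> G \<subseteq> (\<lambda>x. a + x) ` unit_cube"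
      by (auto intro!: image_eqI[where x = "_ - a"])
    then show "bounded ((\<lambda>x. x + (- a)) -` unit_cube \<inter> G)"
      by (rule bounded_subset[OF bounded_translation[OF b]])
  qed (simp add: cube_fun_def indicator_def)
qed

text \<open>Round every coordinate to a nearest integer.\<close>

lemma lattice_cubes_cover:
  fixes x :: "real ^ 'd::finite"
  shows "\<exists>i. x - lattice_vec i \<in> unit_cube"
proof (intro exI)
  have "- 1 / 2 \<le> r - real_of_int \<lfloor>r + 1 / 2\<rfloor>" "r - real_of_int \<lfloor>r + 1 / 2\<rfloor> \<le> 1 / 2" for r :: real
    by linarith+
  then show "x - lattice_vec (\<chi> k. \<lfloor>x $ k + 1 / 2\<rfloor>) \<in> unit_cube"
    by (simp add: unit_cube_def lattice_vec_def mem_box_cart)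
qed

text \<open>On each translated cube the function has zero integral over every generating set, so it
  vanishes there almost everywhere; countably many cubes cover the space.\<close>

lemma L2_zero_if_orthogonal_to_cubes:
  fixes G :: "(real ^ 'd::finite) set set" and v :: "(real ^ 'd) L2"
  assumes sets_G: "sets borel = sigma_sets UNIV G" and stable: "Int_stable G" and top: "UNIV \<in> G"
    and orth: "\<And>i A. A \<in> G \<Longrightarrow> cinner (L2_translation (lattice_vec i) (abs_L2 (cube_fun A (lattice_vec i)))) v = 0"
  shows "v = 0"
proof -
  obtain f where f: "square_integrable lborel f" and v: "v = abs_L2 f" by (rule L2_cases)
  have "AE x in lborel. indicator unit_cube (x - lattice_vec i) * f x = 0" for i :: "int ^ 'd"
  proof -
    define g where "g x = indicator unit_cube (x - lattice_vec i) * f x" for x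
    have GB: "A \<in> sets borel" if "A \<in> G" for A using that sets_G by auto
    have eq: "cnj (cube_fun A (lattice_vec i) (x - lattice_vec i)) * f x = of_real (indicator A x) * g x" for A x
      by (simp add: cube_fun_def g_def indicator_def)
    have int: "integrable lborel g"
      using square_integrable_mult[OF square_integrable_cube_fun(2)[of UNIV "lattice_vec i"] f]
      by (simp add: eq)
    have zero: "(\<integral>x. of_real (indicator A x) * g x \<partial>lborel) = 0" if A: "A \<in> G" for A
    proof -
      have "L2_rel (cube_fun A (lattice_vec i)) (cube_fun A (lattice_vec i))"
        using square_integrable_cube_fun(1)[OF GB[OF A]] by (simp add: L2_rel_def)
      then have "L2_translation (lattice_vec i) (abs_L2 (cube_fun A (lattice_vec i))) =
          abs_L2 (\<lambda>x. cube_fun A (lattice_vec i) (x - lattice_vec i))"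
        by (rule L2_translation.abs_eq)
      then show ?thesis
        using orth[OF A, of i] cinner_abs_L2[OF square_integrable_cube_fun(2)[OF GB[OF A], of "lattice_vec i"] f]
        by (simp add: v eq)
    qed
    have int_A: "integrable lborel (\<lambda>x. of_real (indicator A x) * g x)" if "A \<in> G" for A
      using square_integrable_mult[OF square_integrable_cube_fun(2)[OF GB[OF that], of "lattice_vec i"] f]
      by (simp add: eq)
    have "AE x in lborel. Re (g x) = 0"
    proof (rule integral_zero_on_generator[OF _ _ _ stable top])
      show "(\<integral>x. indicator A x * Re (g x) \<partial>lborel) = 0" if "A \<in> G" for A
        using integral_Re[OF int_A[OF that]] zero[OF that] by simp
    qed (use int sets_G in auto)
    moreover have "AE x in lborel. Im (g x) = 0"
    proof (rule integral_zero_on_generator[OF _ _ _ stable top])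
      show "(\<integral>x. indicator A x * Im (g x) \<partial>lborel) = 0" if "A \<in> G" for A
        using integral_Im[OF int_A[OF that]] zero[OF that] by simp
    qed (use int sets_G in auto)
    ultimately show ?thesis
      by eventually_elim (simp add: g_def[symmetric] complex_eq_iff)
  qed
  then have "AE x in lborel. \<forall>i :: int ^ 'd. indicator unit_cube (x - lattice_vec i) * f x = 0"
    by (simp only: AE_all_countable) blast
  then have "AE x in lborel. f x = 0"
  proof eventually_elim
    fix x assume 0: "\<forall>i :: int ^ 'd. indicator unit_cube (x - lattice_vec i) * f x = 0"
    obtain i :: "int ^ 'd" where "x - lattice_vec i \<in> unit_cube" using lattice_cubes_cover by blast
    then show "f x = 0" using 0[rule_format, of i] by simp
  qed
  then show ?thesis using L2_eq_0[OF f] by (simp add: v)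
qed

section \<open>The continuous model\<close>

lemma le_positive_trace:
  assumes "s \<in> (SOME S. orthonormal_basis S)"
  shows "ennreal (Re (cinner s (B s))) \<le> positive_trace B"
proof -
  have "infsum (\<lambda>s. ennreal (Re (cinner s (B s)))) {s} \<le> positive_trace B"
    unfolding positive_trace_def
    by (rule infsum_mono_neutral) (use assms in \<open>auto intro: nonneg_summable_on_complete\<close>)
  then show ?thesis by simp
qed

lemma continuous_case:
  fixes P :: "'w measure" and H :: "'w \<Rightarrow> (real ^ 'd::finite) L2 operator"
  assumes st: "stationary_with P (\<lambda>i :: int ^ 'd. L2_translation (lattice_vec i)) H"
    and pos: "positive_spectrum P H \<Sigma>"
    and zero: "dos_continuous P H (\<Sigma> \<inter> I) = 0" and I: "closed I"
  shows "\<Sigma> \<inter> interior I = {}"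
proof (rule positive_spectrum_contradiction[OF _ pos I])
  show meas: "measurable_selfadjoint_family P H" using st by (simp add: stationary_with_def)
  assume A: "\<Sigma> \<inter> I \<in> sets borel"
  let ?E = "\<lambda>\<omega>. spectral_projection (H \<omega>) (\<Sigma> \<inter> I)"
  note proj = spectral_projection_proj[OF family_selfadjoint[OF meas] A]
  define S :: "(real ^ 'd) L2 set" where "S = (SOME S. orthonormal_basis S)"
  have S: "orthonormal_basis S" unfolding S_def by (rule someI_ex[OF orthonormal_basis_exists])
  then have on: "orthonormal S" by (simp add: orthonormal_basis_def orthonormal_def)
  \<comment> \<open>Moving the multiplication operator across the inner product shows that a
    diagonal entry of the trace is the form of the projection at \<open>chi_unit_cube s\<close>;
    each entry is at most the whole trace.\<close>
  have basis_zero: "AE \<omega> in P. ?E \<omega> (chi_unit_cube s) = 0" if s: "s \<in> S" for s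
  proof (rule spectral_projection_AE_zero[OF meas A])
    have "(\<integral>\<^sup>+\<omega>. ennreal (Re (cinner (chi_unit_cube s) (?E \<omega> (chi_unit_cube s)))) \<partial>P)
        \<le> dos_continuous P H (\<Sigma> \<inter> I)"
      unfolding dos_continuous_def
    proof (rule nn_integral_mono)
      fix \<omega>
      show "ennreal (Re (cinner (chi_unit_cube s) (?E \<omega> (chi_unit_cube s))))
          \<le> positive_trace (chi_unit_cube \<circ> ?E \<omega> \<circ> chi_unit_cube)"
        using le_positive_trace[of s "chi_unit_cube \<circ> ?E \<omega> \<circ> chi_unit_cube"] s
        by (simp add: S_def cinner_chi_unit_cube)
    qed
    then show "(\<integral>\<^sup>+\<omega>. ennreal (Re (cinner (chi_unit_cube s) (?E \<omega> (chi_unit_cube s)))) \<partial>P) = 0"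
      using zero by simp
  qed
  \<comment> \<open>The null set depends on \<open>x\<close>: only the countably many basis elements
    not orthogonal to \<open>x\<close> are treated at once, and \<open>x\<close> lies in every
    closed subspace containing them.\<close>
  have chi_zero: "AE \<omega> in P. ?E \<omega> (chi_unit_cube x) = 0" for x
  proof -
    have "AE \<omega> in P. \<forall>s\<in>{s \<in> S. cinner s x \<noteq> 0}. ?E \<omega> (chi_unit_cube s) = 0"
      using basis_zero by (intro AE_ball_countable' bessel_countable[OF on]) auto
    with AE_space show ?thesis
    proof eventually_elim
      fix \<omega> assume w: "\<omega> \<in> space P"
        and 0: "\<forall>s\<in>{s \<in> S. cinner s x \<noteq> 0}. ?E \<omega> (chi_unit_cube s) = 0"
      note Pr = orthogonal_projectionD[OF proj[OF w]]
      define K where "K = {v. ?E \<omega> (chi_unit_cube v) = 0}"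
      \<comment> \<open>Presents the kernel as an intersection of orthogonal complements, from which
        it is seen to be a closed subspace.\<close>
      have K_iff: "v \<in> K \<longleftrightarrow> (\<forall>u. cinner (chi_unit_cube (?E \<omega> u)) v = 0)" for v
      proof -
        have "cinner (chi_unit_cube (?E \<omega> u)) v = cinner u (?E \<omega> (chi_unit_cube v))" for u
          by (simp add: cinner_chi_unit_cube[symmetric] Pr(3))
        then show ?thesis
          unfolding K_def using cinner_ext[of "?E \<omega> (chi_unit_cube v)" 0] by auto
      qed
      have "closed_csubspace K"
      proof -
        have "K = (\<Inter>u. {v. cinner (chi_unit_cube (?E \<omega> u)) v = 0})" using K_iff by auto
        moreover have "closed (\<Inter>u. {v. cinner (chi_unit_cube (?E \<omega> u)) v = 0})"
          by (intro closed_INT ballI closed_Collect_eq continuous_on_cinner continuous_intros)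
        ultimately have "closed K" by simp
        then show ?thesis
          unfolding closed_csubspace_def by (auto simp: K_iff cinner_simps)
      qed
      moreover have "{s \<in> S. cinner s x \<noteq> 0} \<subseteq> K" using 0 by (auto simp: K_def)
      ultimately have "x \<in> K" by (rule mem_closed_subspace_if_basis[OF S])
      then show "?E \<omega> (chi_unit_cube x) = 0" by (simp add: K_def)
    qed
  qed
  obtain G :: "(real ^ 'd) set set" where G: "countable G" "Int_stable G" "UNIV \<in> G" "sets borel = sigma_sets UNIV G"
    using countable_Int_stable_generator by blast
  \<comment> \<open>Test functions already supported in the cube are unchanged by the cutoff, so
    \<open>chi_zero\<close> applies to them before they are translated.\<close>
  have chi_cube: "chi_unit_cube (abs_L2 (cube_fun B a)) = abs_L2 (cube_fun B a)" if "B \<in> G" for B and a :: "real ^ 'd"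
  proof -
    have "B \<in> sets borel" using that G(4) by auto
    then have "L2_rel (cube_fun B a) (cube_fun B a)"
      using square_integrable_cube_fun(1) by (simp add: L2_rel_def)
    then have "chi_unit_cube (abs_L2 (cube_fun B a)) = abs_L2 (\<lambda>x. indicator unit_cube x * cube_fun B a x)"
      by (rule chi_unit_cube.abs_eq)
    also have "(\<lambda>x. indicator unit_cube x * cube_fun B a x) = cube_fun B a"
      by (auto simp: cube_fun_def indicator_def)
    finally show ?thesis .
  qed
  have "AE \<omega> in P. ?E \<omega> (L2_translation (lattice_vec i) (abs_L2 (cube_fun B (lattice_vec i)))) = 0"
    if "B \<in> G" for B and i :: "int ^ 'd"
    using stationary_AE_zero[OF st A, of "abs_L2 (cube_fun B (lattice_vec i))" i]
      chi_zero[of "abs_L2 (cube_fun B (lattice_vec i))"] by (simp add: chi_cube[OF that])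
  then have "AE \<omega> in P. \<forall>B\<in>G. \<forall>i :: int ^ 'd.
      ?E \<omega> (L2_translation (lattice_vec i) (abs_L2 (cube_fun B (lattice_vec i)))) = 0"
    by (intro AE_ball_countable' G(1)) (simp add: AE_all_countable)
  with AE_space show "AE \<omega> in P. \<forall>x. ?E \<omega> x = 0"
  proof eventually_elim
    fix \<omega> assume w: "\<omega> \<in> space P" and 0: "\<forall>B\<in>G. \<forall>i :: int ^ 'd.
      ?E \<omega> (L2_translation (lattice_vec i) (abs_L2 (cube_fun B (lattice_vec i)))) = 0"
    note Pr = orthogonal_projectionD[OF proj[OF w]]
    show "\<forall>x. ?E \<omega> x = 0"
    proof
      fix x
      show "?E \<omega> x = 0"
      proof (rule L2_zero_if_orthogonal_to_cubes[OF G(4,2,3)])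
        fix i :: "int ^ 'd" and B assume "B \<in> G"
        then show "cinner (L2_translation (lattice_vec i) (abs_L2 (cube_fun B (lattice_vec i)))) (?E \<omega> x) = 0"
          using 0 by (simp add: Pr(3)[symmetric])
      qed
    qed
  qed
qed

theorem theorem4:
  fixes P :: "'w measure"
    and H_discrete :: "'w \<Rightarrow> (int ^ 'd::finite) ell2 operator"
    and H_continuous :: "'w \<Rightarrow> (real ^ 'd) L2 operator"
    and I \<Sigma> :: "real set"
  assumes "prob_space P" and "complete_measure P"
    and "is_interval I" and "closed I"
  shows
    "(stationary_with P (ell2_translation :: int ^ 'd \<Rightarrow> _) H_discrete \<longrightarrow>
      positive_spectrum P H_discrete \<Sigma> \<longrightarrow>
      dos_discrete P H_discrete (\<Sigma> \<inter> I) = 0 \<longrightarrow> \<Sigma> \<inter> interior I = {}) \<and>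
     (stationary_with P (\<lambda>i :: int ^ 'd. L2_translation (lattice_vec i)) H_continuous \<longrightarrow>
      positive_spectrum P H_continuous \<Sigma> \<longrightarrow>
      dos_continuous P H_continuous (\<Sigma> \<inter> I) = 0 \<longrightarrow> \<Sigma> \<inter> interior I = {})"
  using discrete_case[OF _ _ _ assms(4)] continuous_case[OF _ _ _ assms(4)] by blast

end
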